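(* Let $d=1$, $p>1$ and $0<q<\min\{p-1,m\}$. Then $u_{c,m}$ has the closed form $$u_{c,m}(r)=\left(\frac{m+1}{q+1}\,B^{-1}\Big(\bar C(R-r);\frac{p-1-q}{p(m-q)},1-\frac1p\Big)\right)^{\frac1{m-q}},\qquad 0\le r\le R,$$ where $$R=\left(\frac{p-1}{p}\right)^{\frac1p}\frac{(m+1)^{\frac{p-q-1}{p(m-q)}}(q+1)^{\frac1p-\frac{p-q-1}{p(m-q)}}}{m-q}\,\mathcal{B}\Big(1-\frac1p,\frac{p-(q+1)}{p(m-q)}\Big),$$ $$\bar C=\left(\frac{p}{p-1}\right)^{1/p}(m-q)(m+1)^{\frac{1+q-p}{p(m-q)}}(q+1)^{\frac{p-m-1}{p(m-q)}},$$ and $u_{c,m}(0)=\left(\frac{m+1}{q+1}\right)^{1/(m-q)}$. The best constant $C_{q,m,p}$ has the exact value $$C_{q,m,p}=\left(\frac{2^p(p-1)^{1-p}\,\eta_1^{\frac{\eta_1}{m-q}}}{(m-q)^{2p-1}\,\eta_2^{\frac{\eta_2}{m-q}}}\,\mathcal{B}\Big(\frac{\eta_2}{p(m-q)},\frac{2p-1}{p}\Big)^p\right)^{-\ell},$$ where $\eta_1=(p-1)(m+1)+p$, $\eta_2=(p-1)(q+1)+p$ and $\ell=\dfrac{m-q}{(m+1)[(p-1)(q+1)+p]}$.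
   Context: $u_{c,m}$ is the unique decreasing solution (with free boundary point $R>0$ part of the unknown, $u>0$ on $[0,R)$, and $u$ extended by $0$ for $r\ge R$) of $$(|u'|^{p-2}u')'+u^m=u^q\quad(0<r<R),\qquad u'(0)=0,\quad u(R)=u'(R)=0.$$ $C_{q,m,p}$ is the smallest constant $C$ such that, with $\theta=\frac{p(m-q)}{(m+1)[(p-1)(q+1)+p]}$, $$\|u\|_{L^{m+1}(\mathbb{R})}\le C\,\|u\|_{L^{q+1}(\mathbb{R})}^{1-\theta}\|u'\|_{L^p(\mathbb{R})}^{\theta}\quad\text{for all }u\in L^{q+1}(\mathbb{R})\text{ with }u'\in L^p(\mathbb{R}).$$ $B(x;a,b)=\int_0^x t^{a-1}(1-t)^{b-1}dt$ is the incomplete Beta function, $B^{-1}(\,\cdot\,;a,b)$ is the inverse function of $x\mapsto B(x;a,b)$, and $\mathcal{B}(a,b)=B(1;a,b)$. *)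

theory Defs
  imports "HOL-Analysis.Analysis"
begin

section \<open>The free boundary problem\<close>

text \<open>
  A solution is a pair of a free boundary point \<open>R\<close> and a function \<open>u\<close> of the radial variable
  \<open>r \<ge> 0\<close>; \<open>v\<close> is the derivative \<open>u'\<close> on \<open>[0,R]\<close> (one-sided at the end points). Evenness fixes
  the values at negative arguments, which have no meaning for the problem, so that a solution
  is determined as a HOL function. Since \<open>0 powr s = 0\<close> for every \<open>s\<close>, the flux
  \<open>|u'|\<^sup>p\<^sup>-\<^sup>2 u'\<close> is \<open>0\<close> where \<open>u' = 0\<close>, also for \<open>p < 2\<close>.
\<close>

definition free_boundary_solution ::
    "real \<Rightarrow> real \<Rightarrow> real \<Rightarrow> real \<Rightarrow> (real \<Rightarrow> real) \<Rightarrow> bool" where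
  "free_boundary_solution p q m R u \<longleftrightarrow>
     0 < R \<and>
     (\<forall>r\<in>{0..<R}. 0 < u r) \<and>
     (\<forall>r\<ge>R. u r = 0) \<and>
     (\<forall>r. u (- r) = u r) \<and>
     strict_antimono_on {0..R} u \<and>
     (\<exists>v. (\<forall>r\<in>{0..R}. (u has_real_derivative v r) (at r within {0..R})) \<and>
          v 0 = 0 \<and> v R = 0 \<and>
          (\<forall>r\<in>{0<..<R}. \<exists>w.
             ((\<lambda>s. \<bar>v s\<bar> powr (p - 2) * v s) has_real_derivative w) (at r) \<and>
             w + u r powr m = u r powr q))"

definition R_c :: "real \<Rightarrow> real \<Rightarrow> real \<Rightarrow> real" where
  "R_c p q m = fst (THE (R, u). free_boundary_solution p q m R u)"

definition u_c :: "real \<Rightarrow> real \<Rightarrow> real \<Rightarrow> real \<Rightarrow> real" where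
  "u_c p q m = snd (THE (R, u). free_boundary_solution p q m R u)"

section \<open>The incomplete Beta function and its inverse\<close>

definition inc_beta :: "real \<Rightarrow> real \<Rightarrow> real \<Rightarrow> real" where
  "inc_beta x a b = integral {0..x} (\<lambda>t. t powr (a - 1) * (1 - t) powr (b - 1))"

definition inv_inc_beta :: "real \<Rightarrow> real \<Rightarrow> real \<Rightarrow> real" where
  "inv_inc_beta y a b = the_inv_into {0..1} (\<lambda>x. inc_beta x a b) y"

lemma inc_beta_1: "0 < a \<Longrightarrow> 0 < b \<Longrightarrow> inc_beta 1 a b = Beta a b"
  unfolding inc_beta_def by (rule integral_unique, rule has_integral_Beta_real)

section \<open>The Gagliardo--Nirenberg inequality on the real line\<close>

definition in_Lp :: "real \<Rightarrow> (real \<Rightarrow> real) \<Rightarrow> bool" where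
  "in_Lp s f \<longleftrightarrow> f \<in> borel_measurable lebesgue \<and> integrable lebesgue (\<lambda>x. \<bar>f x\<bar> powr s)"

definition Lp_norm :: "real \<Rightarrow> (real \<Rightarrow> real) \<Rightarrow> real" where
  "Lp_norm s f = (\<integral>x. \<bar>f x\<bar> powr s \<partial>lebesgue) powr (1 / s)"

definition test_function :: "(real \<Rightarrow> real) \<Rightarrow> bool" where
  "test_function \<phi> \<longleftrightarrow>
     (\<forall>n x. (deriv ^^ n) \<phi> differentiable (at x)) \<and> bounded {x. \<phi> x \<noteq> 0}"

definition locally_integrable :: "(real \<Rightarrow> real) \<Rightarrow> bool" where
  "locally_integrable f \<longleftrightarrow> (\<forall>a b. set_integrable lebesgue {a..b} f)"

definition has_weak_derivative :: "(real \<Rightarrow> real) \<Rightarrow> (real \<Rightarrow> real) \<Rightarrow> bool" where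
  "has_weak_derivative u g \<longleftrightarrow>
     locally_integrable u \<and> locally_integrable g \<and>
     (\<forall>\<phi>. test_function \<phi> \<longrightarrow>
        (\<integral>x. u x * deriv \<phi> x \<partial>lebesgue) = - (\<integral>x. g x * \<phi> x \<partial>lebesgue))"

text \<open>
  The Bochner integral of a non-integrable function is \<open>0\<close>, so finiteness of the left-hand norm
  has to be part of the inequality.
\<close>

definition GN_inequality :: "real \<Rightarrow> real \<Rightarrow> real \<Rightarrow> real \<Rightarrow> bool" where
  "GN_inequality q m p C \<longleftrightarrow>
     (let \<theta> = p * (m - q) / ((m + 1) * ((p - 1) * (q + 1) + p)) in
      \<forall>u u'. in_Lp (q + 1) u \<and> in_Lp p u' \<and> has_weak_derivative u u' \<longrightarrow>
        in_Lp (m + 1) u \<and>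
        Lp_norm (m + 1) u \<le> C * Lp_norm (q + 1) u powr (1 - \<theta>) * Lp_norm p u' powr \<theta>)"

definition C_best :: "real \<Rightarrow> real \<Rightarrow> real \<Rightarrow> real" where
  "C_best q m p = (LEAST C. GN_inequality q m p C)"

end

theory Submission
  imports Defs
begin

text \<open>
  The equation has the first integral \<open>(p-1)/p |u'|\<^sup>p = u\<^sup>q\<^sup>+\<^sup>1/(q+1) - u\<^sup>m\<^sup>+\<^sup>1/(m+1)\<close>, whose constant is
  fixed by the free boundary conditions. Separating variables, an incomplete Beta function of
  \<open>(u/u(0))\<^sup>m\<^sup>-\<^sup>q\<close> is affine in \<open>r\<close>, which gives existence, uniqueness and the closed form.

  For the inequality let \<open>M = sup |u|\<close> and \<open>G' (s) = (s\<^sup>q\<^sup>+\<^sup>1 - M\<^sup>q\<^sup>-\<^sup>m s\<^sup>m\<^sup>+\<^sup>1)\<^bsup>(p-1)/p\<^esup>\<close> with \<open>G(0) = 0\<close>.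
  As \<open>u\<close> rises to \<open>M\<close> and falls back to \<open>0\<close>, Hoelder's inequality gives
  \<open>2 G(M) \<le> \<integral> G'(|u|) |u'| \<le> \<parallel>u'\<parallel>\<^sub>p (\<integral> |u|\<^sup>q\<^sup>+\<^sup>1 - M\<^sup>q\<^sup>-\<^sup>m \<integral> |u|\<^sup>m\<^sup>+\<^sup>1)\<^bsup>(p-1)/p\<^esup>\<close>,
  where \<open>G(M)\<close> is a Beta value times a power of \<open>M\<close>. The resulting bound on \<open>\<integral> |u|\<^sup>m\<^sup>+\<^sup>1\<close>, maximised over
  all \<open>M > 0\<close>, is the asserted inequality. For the solution of the free boundary problem every
  step is an equality, so the constant is best possible.
\<close>

text \<open>Two obstacles shape the proof. The derivative in the inequality is weak, an identity
  tested with smooth compactly supported functions, so \<open>u\<close> must first be replaced by a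
  continuous primitive of it; this uses smoothed hat functions built from one explicit bump. And
  every end is degenerate: \<open>slope\<close> vanishes at 0 and at \<open>height\<close>, Beta
  integrands may be singular at 0 and 1, and \<open>v\<close> in the definition of a solution is not
  assumed continuous. Hence derivatives are taken in open intervals and continuity carries the
  results to the ends.

  The factor M^(q-m) makes the base of G' vanish at M. For M = \<open>height\<close> it equals
  (q+1)/(m+1), and that base becomes a multiple of the potential, as is |u'|^p, so Hoelder's
  inequality is an equality along the solution. With B, D the integrals of |u|^(q+1), |u|^(m+1), the
  maximisation over M concerns t^a (1-t)^(p-1), where t = D / (M^(m-q) B). That the solution sits at
  the maximum is a separate fact: testing its equation with u gives a second linear relation between
  the three integrals.\<close>

lemma has_real_derivative_continuous_extension:
  fixes f f' :: "real \<Rightarrow> real"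
  assumes "finite S" and f: "continuous_on {a..b} f" and f': "continuous_on {a..b} f'"
    and der: "\<And>x. x \<in> {a<..<b} - S \<Longrightarrow> (f has_real_derivative f' x) (at x)"
    and t: "t \<in> {a..b}"
  shows "(f has_real_derivative f' t) (at t within {a..b})"
proof -
  \<comment> \<open>The fundamental theorem allows finitely many exceptional points, so
    \<open>f\<close> is an integral of the continuous \<open>f'\<close> and is differentiable at
    those points and at the ends too.\<close>
  have eq: "f x = f a + integral {a..x} f'" if x: "x \<in> {a..b}" for x
  proof -
    have "(f' has_integral (f x - f a)) {a..x}"
    proof (rule fundamental_theorem_of_calculus_interior_strong[OF \<open>finite S\<close>])
      show "a \<le> x" using x by simp
      show "\<And>y. y \<in> {a<..<x} - S \<Longrightarrow> (f has_vector_derivative f' y) (at y)"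
        using der x by (auto simp: has_real_derivative_iff_has_vector_derivative)
      show "continuous_on {a..x} f"
        using f by (rule continuous_on_subset) (use x in auto)
    qed
    then show ?thesis by (simp add: integral_unique)
  qed
  have "((\<lambda>x. f a + integral {a..x} f') has_real_derivative f' t) (at t within {a..b})"
    using integral_has_real_derivative[OF f' t] by (auto intro!: derivative_eq_intros)
  then show ?thesis
    by (rule has_field_derivative_transform_within[OF _ zero_less_one t]) (rule eq[symmetric])
qed

lemma has_real_derivative_continuous_extension_UNIV:
  fixes f f' :: "real \<Rightarrow> real"
  assumes "finite S" and "continuous_on UNIV f" and "continuous_on UNIV f'"
    and der: "\<And>x. x \<notin> S \<Longrightarrow> (f has_real_derivative f' x) (at x)"
  shows "(f has_real_derivative f' t) (at t)"
proof -
  have "(f has_real_derivative f' t) (at t within {t-1..t+1})"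
  proof (rule has_real_derivative_continuous_extension[OF \<open>finite S\<close>])
    show "continuous_on {t-1..t+1} f" "continuous_on {t-1..t+1} f'"
      using assms(2,3) by (blast intro: continuous_on_subset)+
    show "(f has_real_derivative f' x) (at x)" if "x \<in> {t-1<..<t+1} - S" for x
      using der that by simp
  qed simp
  moreover have "at t within {t-1..t+1} = at t"
    by (rule at_within_interior) (simp add: interior_atLeastAtMost_real)
  ultimately show ?thesis
    by simp
qed

section \<open>The incomplete Beta function\<close>

lemma inc_beta_0 [simp]: "inc_beta 0 a b = 0"
  by (simp add: inc_beta_def)

lemma inc_beta_continuous:
  assumes "0 < a" "0 < b"
  shows "continuous_on {0..1} (\<lambda>x. inc_beta x a b)"
  unfolding inc_beta_def
  by (rule indefinite_integral_continuous_1) (use has_integral_Beta_real[OF assms] in blast)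

lemma inc_beta_deriv:
  assumes "0 < a" "0 < b" "0 < x" "x < 1"
  shows "((\<lambda>x. inc_beta x a b) has_real_derivative x powr (a - 1) * (1 - x) powr (b - 1)) (at x)"
proof -
  let ?f = "\<lambda>t::real. t powr (a - 1) * (1 - t) powr (b - 1)"
  have "((\<lambda>u. integral {0..u} ?f) has_vector_derivative ?f x) (at x within ({0..1} - {}))"
  proof (rule integral_has_vector_derivative_continuous_at)
    show "?f integrable_on {0..1}"
      using has_integral_Beta_real[OF assms(1,2)] by blast
    have "isCont ?f x"
      using assms by (intro continuous_intros) auto
    then show "continuous (at x within {0..1} - {}) ?f"
      using continuous_at_imp_continuous_at_within by blast
  qed (use assms in auto)
  then show ?thesis
    using assms at_within_interior[of x "{0..1}"]
    by (simp add: inc_beta_def[abs_def] has_real_derivative_iff_has_vector_derivative)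
qed

text \<open>The integrand may be singular at 0 and at 1, so positivity of the derivative is used in
  the open interval only and continuity supplies the ends.\<close>

lemma inc_beta_strict_mono:
  assumes "0 < a" "0 < b"
  shows "strict_mono_on {0..1} (\<lambda>x. inc_beta x a b)"
proof (rule strict_mono_onI)
  fix x y :: real assume xy: "x \<in> {0..1}" "y \<in> {0..1}" "x < y"
  show "inc_beta x a b < inc_beta y a b"
  proof (rule DERIV_pos_imp_increasing_open[OF \<open>x < y\<close>])
    fix t assume "x < t" "t < y"
    with xy have "0 < t" "t < 1" by auto
    then show "\<exists>D. ((\<lambda>x. inc_beta x a b) has_real_derivative D) (at t) \<and> 0 < D"
      using inc_beta_deriv[OF assms] by fastforce
  next
    show "continuous_on {x..y} (\<lambda>x. inc_beta x a b)"
      by (rule continuous_on_subset[OF inc_beta_continuous[OF assms]]) (use xy in auto)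
  qed
qed

lemma inv_inc_beta_inc_beta:
  assumes "0 < a" "0 < b" "x \<in> {0..1}"
  shows "inv_inc_beta (inc_beta x a b) a b = x"
  unfolding inv_inc_beta_def
  using strict_mono_on_imp_inj_on[OF inc_beta_strict_mono[OF assms(1,2)]] assms(3)
  by (intro the_inv_into_f_f[where f="\<lambda>x. inc_beta x a b"])

lemma inc_beta_powr_continuous:
  assumes "0 < a" "0 < b" "0 < M" "0 < k"
  shows "continuous_on {0..M} (\<lambda>s. inc_beta ((s / M) powr k) a b)"
proof (rule continuous_on_compose2[OF inc_beta_continuous[OF assms(1,2)]])
  show "continuous_on {0..M} (\<lambda>s. (s / M) powr k)"
    using assms by (intro continuous_on_powr') (auto intro!: continuous_intros)
  show "(\<lambda>s. (s / M) powr k) ` {0..M} \<subseteq> {0..1}"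
    using assms by (auto intro!: powr_le1)
qed

text \<open>Substituting \<open>(s / M) powr k\<close> for the Beta variable. The two primitives
  needed later, of \<open>1 / slope\<close> and of \<open>weight M\<close>, both have this form with
  \<open>k = m - q\<close> and differ only in \<open>a\<close>, \<open>b\<close> and
  \<open>M\<close>.\<close>

lemma inc_beta_powr_deriv:
  assumes "0 < a" "0 < b" "0 < k" "0 < s" "s < M"
  shows "((\<lambda>s. inc_beta ((s / M) powr k) a b) has_real_derivative
     k / M powr (k * a) * s powr (k * a - 1) * (1 - (s / M) powr k) powr (b - 1)) (at s)"
proof -
  have M: "0 < M" using assms by linarith
  have x: "0 < (s / M) powr k" "(s / M) powr k < 1"
    using assms M powr_less_mono2[of k "s / M" 1] by auto
  have "((\<lambda>s. (s / M) powr k) has_real_derivative k * (s / M) powr (k - 1) * (1 / M)) (at s)"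
    using assms M by (auto intro!: derivative_eq_intros)
  then have deriv: "((\<lambda>s. inc_beta ((s / M) powr k) a b) has_real_derivative
     ((s / M) powr k) powr (a - 1) * (1 - (s / M) powr k) powr (b - 1) *
     (k * (s / M) powr (k - 1) * (1 / M))) (at s)"
    by (rule DERIV_chain2[where f="\<lambda>x. inc_beta x a b" and g="\<lambda>s. (s / M) powr k",
          OF inc_beta_deriv[OF assms(1,2) x]])
  have eq: "((s / M) powr k) powr (a - 1) * ((s / M) powr (k - 1) * (1 / M)) =
      s powr (k * a - 1) / M powr (k * a)"
  proof -
    have "((s / M) powr k) powr (a - 1) * (s / M) powr (k - 1) = (s / M) powr (k * a - 1)"
      by (simp add: powr_powr powr_add[symmetric] right_diff_distrib)
    also have "\<dots> = s powr (k * a - 1) / M powr (k * a - 1)"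
      using assms M by (simp add: powr_divide)
    also have "M powr (k * a - 1) = M powr (k * a) / M"
      using M by (simp add: powr_diff)
    finally show ?thesis using M by (simp add: field_simps)
  qed
  have "((s / M) powr k) powr (a - 1) * (1 - (s / M) powr k) powr (b - 1) *
      (k * (s / M) powr (k - 1) * (1 / M)) =
      k * (1 - (s / M) powr k) powr (b - 1) *
      (((s / M) powr k) powr (a - 1) * ((s / M) powr (k - 1) * (1 / M)))"
    by (simp only: mult_ac)
  also have "\<dots> = k / M powr (k * a) * s powr (k * a - 1) * (1 - (s / M) powr k) powr (b - 1)"
    unfolding eq by simp
  finally show ?thesis
    using deriv by simp
qed

lemma inc_beta_powr_strict_mono:
  assumes "0 < a" "0 < b" "0 < M" "0 < k"
  shows "strict_mono_on {0..M} (\<lambda>s. inc_beta ((s / M) powr k) a b)"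
proof (rule strict_mono_onI)
  fix x y :: real assume xy: "x \<in> {0..M}" "y \<in> {0..M}" "x < y"
  have "(x / M) powr k < (y / M) powr k"
    using xy assms by (intro powr_less_mono2) (auto simp: divide_strict_right_mono)
  moreover have "(y / M) powr k \<le> 1"
    using xy assms by (intro powr_le1) auto
  ultimately show "inc_beta ((x / M) powr k) a b < inc_beta ((y / M) powr k) a b"
    by (intro strict_mono_onD[OF inc_beta_strict_mono[OF assms(1,2)]]) auto
qed

text \<open>At the origin the difference quotient is bounded by
  \<open>\<bar>h\<bar> powr (s - 1)\<close>, which tends to 0 because \<open>1 < s\<close>. This
  lets the flux be raised to the power \<open>p / (p - 1)\<close> even where it vanishes.\<close>

lemma DERIV_abs_powr:
  fixes x s :: real
  assumes "1 < s"
  shows "((\<lambda>x. \<bar>x\<bar> powr s) has_real_derivative s * \<bar>x\<bar> powr (s - 1) * sgn x) (at x)"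
proof -
  consider "x > 0" | "x < 0" | "x = 0" by linarith
  then show ?thesis
  proof cases
    case 1
    then have "((\<lambda>x. x powr s) has_real_derivative s * \<bar>x\<bar> powr (s - 1) * sgn x) (at x)"
      by (auto intro!: derivative_eq_intros)
    then show ?thesis
      by (rule has_field_derivative_transform_within_open[of _ _ _ "{0<..}"]) (use 1 in auto)
  next
    case 2
    then have "((\<lambda>x. (- x) powr s) has_real_derivative s * \<bar>x\<bar> powr (s - 1) * sgn x) (at x)"
      by (auto intro!: derivative_eq_intros)
    then show ?thesis
      by (rule has_field_derivative_transform_within_open[of _ _ _ "{..<0}"]) (use 2 in auto)
  next
    case 3
    have "((\<lambda>h::real. \<bar>h\<bar> powr (s - 1)) \<longlongrightarrow> \<bar>0\<bar> powr (s - 1)) (at 0)"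
      by (intro tendsto_powr' tendsto_rabs tendsto_ident_at tendsto_const) (use assms in auto)
    then have lim: "((\<lambda>h::real. \<bar>h\<bar> powr (s - 1)) \<longlongrightarrow> 0) (at 0)"
      using assms by simp
    have "((\<lambda>h. (\<bar>0 + h\<bar> powr s - \<bar>0\<bar> powr s) / h) \<longlongrightarrow> 0) (at (0::real))"
    proof (rule Lim_null_comparison[OF _ lim])
      show "\<forall>\<^sub>F h in at 0. norm ((\<bar>0 + h\<bar> powr s - \<bar>0\<bar> powr s) / h) \<le> \<bar>h\<bar> powr (s - 1)"
        by (auto simp: eventually_at_filter powr_diff)
    qed
    then show ?thesis
      using 3 by (simp add: DERIV_def)
  qed
qed

section \<open>Exponents, first integral and the Beta profile\<close>

locale gn_exponents =
  fixes p q m :: real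
  assumes p: "1 < p" and q: "0 < q" "q < p - 1" and m: "q < m"
begin

definition height :: real
  where "height = ((m + 1) / (q + 1)) powr (1 / (m - q))"

definition potential :: "real \<Rightarrow> real"
  where "potential s = s powr (q + 1) / (q + 1) - s powr (m + 1) / (m + 1)"

text \<open>The value of \<open>\<bar>u'\<bar>\<close> that the first integral prescribes where
  \<open>u = s\<close>.\<close>

definition slope :: "real \<Rightarrow> real"
  where "slope s = (p / (p - 1) * potential s) powr (1 / p)"

text \<open>Near 0 \<open>slope s\<close> is of order \<open>s powr ((q + 1) / p)\<close>.
  Positivity of \<alpha>, that is \<open>q < p - 1\<close>, is the integrability of
  \<open>1 / slope\<close> at 0, which makes the free boundary point finite.\<close>

definition \<alpha> :: real where "\<alpha> = (p - 1 - q) / (p * (m - q))"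

definition \<beta> :: real where "\<beta> = 1 - 1 / p"

text \<open>The constant of the asserted closed form. It is the normalisation for which
  \<open>profile\<close> has derivative \<open>rate / slope\<close>.\<close>

definition rate :: real
  where "rate = (p / (p - 1)) powr (1 / p) * (m - q) *
              (m + 1) powr ((1 + q - p) / (p * (m - q))) *
              (q + 1) powr ((p - m - 1) / (p * (m - q)))"

text \<open>Along a solution \<open>u' = - slope u\<close>, so \<open>profile (u r)\<close>
  decreases with constant speed \<open>rate\<close>, from \<open>Beta \<alpha> \<beta>\<close> at
  the top to 0 at the free boundary; this dictates \<open>radius\<close>.\<close>

definition profile :: "real \<Rightarrow> real"
  where "profile s = inc_beta ((s / height) powr (m - q)) \<alpha> \<beta>"

definition radius :: real where "radius = Beta \<alpha> \<beta> / rate"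

lemma height_pos: "0 < height"
  using q m by (simp add: height_def)

lemma height_powr: "height powr (m - q) = (m + 1) / (q + 1)"
  using q m by (simp add: height_def powr_powr)

lemma \<alpha>_pos: "0 < \<alpha>" and \<beta>_pos: "0 < \<beta>" and rate_pos: "0 < rate"
  using p q m by (auto simp: \<alpha>_def \<beta>_def rate_def field_simps)

text \<open>Uses \<open>height powr (m - q) = (m + 1) / (q + 1)\<close>. The factored form shows
  that 0 and \<open>height\<close> are the only zeros on the half line, and its last factor is one
  minus the Beta variable of \<open>profile\<close>.\<close>

lemma potential_factor:
  assumes "0 \<le> s"
  shows "potential s = s powr (q + 1) / (q + 1) * (1 - (s / height) powr (m - q))"
proof -
  have "(s / height) powr (m - q) = s powr (m - q) * ((q + 1) / (m + 1))"
    using assms height_pos by (simp add: powr_divide height_powr)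
  moreover have "s powr (m + 1) = s powr (q + 1) * s powr (m - q)"
    by (simp add: powr_add[symmetric] add.commute)
  moreover have "A / Q - A * B / M = A / Q * (1 - B * (Q / M))"
    if "Q \<noteq> 0" "M \<noteq> 0" for A B Q M :: real
    using that by (simp add: field_simps)
  ultimately show ?thesis
    using q m unfolding potential_def by simp
qed

lemma powr_frac_less_1:
  assumes "0 \<le> s" "s < height"
  shows "(s / height) powr (m - q) < 1"
  using powr_less_mono2[of "m - q" "s / height" 1] assms m height_pos by auto

lemma potential_pos: "0 < s \<Longrightarrow> s < height \<Longrightarrow> 0 < potential s"
  using q powr_frac_less_1[of s] by (simp add: potential_factor)

lemma potential_0 [simp]: "potential 0 = 0"
  using q m by (simp add: potential_def)

lemma potential_height [simp]: "potential height = 0"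
  using potential_factor[of height] height_pos by simp

lemma potential_eq_0_iff:
  assumes "0 < s"
  shows "potential s = 0 \<longleftrightarrow> s = height"
proof -
  have "s = height" if "(s / height) powr (m - q) = 1"
  proof -
    have "((s / height) powr (m - q)) powr (1 / (m - q)) = 1"
      using that by simp
    then have "s / height = 1"
      using assms height_pos m by (simp add: powr_powr)
    then show ?thesis using height_pos by simp
  qed
  then show ?thesis
    using assms q by (auto simp: potential_factor[of s] potential_factor[of height])
qed

lemma potential_nonneg: "s \<in> {0..height} \<Longrightarrow> 0 \<le> potential s"
  using potential_pos[of s] by (cases "s = 0 \<or> s = height") auto

lemma potential_continuous: "continuous_on {0..} potential"
  unfolding potential_def[abs_def]
  by (intro continuous_intros continuous_on_powr') (use q m in auto)

lemma potential_deriv: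
  "0 < s \<Longrightarrow> (potential has_real_derivative s powr q - s powr m) (at s)"
  unfolding potential_def[abs_def] using q m by (auto intro!: derivative_eq_intros)

lemma slope_pos: "0 < s \<Longrightarrow> s < height \<Longrightarrow> 0 < slope s"
  using potential_pos[of s] p by (simp add: slope_def)

lemma slope_0 [simp]: "slope 0 = 0" and slope_height [simp]: "slope height = 0"
  by (simp_all add: slope_def)

lemma slope_nonneg: "0 \<le> slope s"
  by (simp add: slope_def)

lemma slope_continuous: "continuous_on {0..height} slope"
  unfolding slope_def[abs_def]
  by (intro continuous_on_powr' continuous_intros continuous_on_subset[OF potential_continuous])
     (use p potential_nonneg in auto)

lemma profile_continuous: "continuous_on {0..height} profile"
  unfolding profile_def[abs_def]
  using inc_beta_powr_continuous[OF \<alpha>_pos \<beta>_pos height_pos] m by simp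

lemma profile_strict_mono: "strict_mono_on {0..height} profile"
  unfolding profile_def[abs_def]
  using inc_beta_powr_strict_mono[OF \<alpha>_pos \<beta>_pos height_pos] m by simp

lemma profile_0 [simp]: "profile 0 = 0"
  by (simp add: profile_def)

lemma profile_height: "profile height = Beta \<alpha> \<beta>"
  using height_pos \<alpha>_pos \<beta>_pos by (simp add: profile_def inc_beta_1)

text \<open>By \<open>potential_factor\<close>, \<open>slope s\<close> is a constant times
  \<open>s powr ((q + 1) / p)\<close> times the power \<open>1 / p\<close> of one minus the Beta
  variable. The choices of \<alpha> and \<beta> give
  \<open>(m - q) * \<alpha> - 1 = - ((q + 1) / p)\<close> and
  \<open>\<beta> - 1 = - (1 / p)\<close>, the exponents of its reciprocal.\<close>

lemma profile_deriv:
  assumes "0 < s" "s < height"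
  shows "(profile has_real_derivative rate / slope s) (at s)"
proof -
  define c1 where "c1 = (p / (p - 1)) powr (1 / p)"
  define x where "x = 1 - (s / height) powr (m - q)"
  have x: "0 < x" using powr_frac_less_1[of s] assms by (simp add: x_def)
  have slope: "slope s = c1 * (s powr ((q + 1) / p) * x powr (1 / p) / (q + 1) powr (1 / p))"
  proof -
    have "slope s = (p / (p - 1) * (s powr (q + 1) / (q + 1) * x)) powr (1 / p)"
      using assms by (simp add: slope_def potential_factor x_def)
    also have "\<dots> = c1 * ((s powr (q + 1) / (q + 1)) powr (1/p) * x powr (1 / p))"
      unfolding c1_def by (simp only: powr_mult)
    also have "(s powr (q + 1) / (q + 1)) powr (1/p) = s powr ((q + 1) / p) / (q + 1) powr (1 / p)"
      using q by (simp add: powr_divide powr_powr)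
    finally show ?thesis by simp
  qed
  have ka: "(m - q) * \<alpha> = (p - 1 - q) / p"
    using m p by (simp add: \<alpha>_def)
  have h: "height powr ((m - q) * \<alpha>) = (m + 1) powr \<alpha> / (q + 1) powr \<alpha>"
    using m q by (simp add: powr_powr[symmetric] height_powr powr_divide)
  have e1: "(1 + q - p) / (p * (m - q)) = - \<alpha>"
    by (simp add: \<alpha>_def minus_divide_left)
  have e2: "(p - m - 1) / (p * (m - q)) = \<alpha> - 1 / p"
    using m p by (simp add: \<alpha>_def field_simps)
  \<comment> \<open>The powers of \<open>m + 1\<close> and \<open>q + 1\<close> in
    \<open>rate\<close> combine the factor \<open>height powr ((m - q) * \<alpha>)\<close> of the
    substitution with the \<open>(q + 1) powr (1 / p)\<close> of the potential.\<close>
  have rate: "rate = c1 * (m - q) / height powr ((m - q) * \<alpha>) / (q + 1) powr (1 / p)"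
    unfolding rate_def e1 e2 h c1_def using q
    by (simp add: powr_minus powr_diff divide_inverse mult_ac)
  have "(profile has_real_derivative
     (m - q) / height powr ((m - q) * \<alpha>) * s powr ((m - q) * \<alpha> - 1) *
     (1 - (s / height) powr (m - q)) powr (\<beta> - 1)) (at s)"
    unfolding profile_def[abs_def] using inc_beta_powr_deriv[OF \<alpha>_pos \<beta>_pos _ assms] m by simp
  moreover have "s powr ((m - q) * \<alpha> - 1) = inverse (s powr ((q + 1) / p))"
  proof -
    have "(m - q) * \<alpha> - 1 = - ((q + 1) / p)"
      using p unfolding ka by (simp add: field_simps)
    then show ?thesis by (simp add: powr_minus)
  qed
  moreover have "(1 - (s / height) powr (m - q)) powr (\<beta> - 1) = inverse (x powr (1 / p))"
    by (simp add: x_def \<beta>_def powr_minus[symmetric])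
  moreover have "rate / slope s = (m - q) / height powr ((m - q) * \<alpha>) *
      inverse (s powr ((q + 1) / p)) * inverse (x powr (1 / p))"
  proof -
    have "c1 * k / H / K / (c1 * (S * X / K)) = k / H * inverse S * inverse X"
      if "c1 \<noteq> 0" "K \<noteq> 0" for k H K S X :: real
      using that by (simp add: field_simps)
    moreover have "c1 \<noteq> 0" "(q + 1) powr (1 / p) \<noteq> 0"
      using p q by (auto simp: c1_def)
    ultimately show ?thesis
      unfolding slope rate by blast
  qed
  ultimately show ?thesis
    by simp
qed


section \<open>Uniqueness of the free boundary solution\<close>

text \<open>Only the flux is known to be differentiable, not \<open>v\<close>. Therefore
  \<open>\<bar>v\<bar> powr p\<close> is written as the power \<open>p / (p - 1) > 1\<close> of the
  absolute flux, and the outer derivative gives back \<open>v\<close> up to the constant, zeros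
  included.\<close>

lemma flux_energy_deriv:
  assumes w: "((\<lambda>s. \<bar>v s\<bar> powr (p - 2) * v s) has_real_derivative w) (at r)"
  shows "((\<lambda>s. (p - 1) / p * \<bar>v s\<bar> powr p) has_real_derivative v r * w) (at r)"
proof -
  define f where "f s = \<bar>v s\<bar> powr (p - 2) * v s" for s
  have abs_f: "\<bar>f s\<bar> = \<bar>v s\<bar> powr (p - 1)" for s
  proof (cases "v s = 0")
    case False
    then have "\<bar>f s\<bar> = \<bar>v s\<bar> powr (p - 2) * \<bar>v s\<bar> powr 1"
      by (simp add: f_def abs_mult)
    also have "\<dots> = \<bar>v s\<bar> powr (p - 1)"
      by (simp only: powr_add[symmetric]) simp
    finally show ?thesis .
  qed (simp add: f_def)
  have sgn_f: "sgn (f s) = sgn (v s)" for s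
    by (cases "v s = 0") (auto simp: f_def sgn_mult)
  have e: "p / (p - 1) - 1 = 1 / (p - 1)"
    using p by (simp add: field_simps)
  have "1 < p / (p - 1)"
    using p by simp
  then have "((\<lambda>x. \<bar>x\<bar> powr (p / (p - 1))) has_real_derivative
      p / (p - 1) * \<bar>f r\<bar> powr (p / (p - 1) - 1) * sgn (f r)) (at (f r))"
    by (rule DERIV_abs_powr)
  then have "((\<lambda>s. \<bar>f s\<bar> powr (p / (p - 1))) has_real_derivative
      p / (p - 1) * \<bar>f r\<bar> powr (p / (p - 1) - 1) * sgn (f r) * w) (at r)"
    using w unfolding f_def[abs_def, symmetric] by (rule DERIV_chain2)
  moreover have "\<bar>f s\<bar> powr (p / (p - 1)) = \<bar>v s\<bar> powr p" for s
    using p by (simp add: abs_f powr_powr)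
  moreover have "\<bar>f r\<bar> powr (p / (p - 1) - 1) * sgn (f r) = v r"
    unfolding e using p by (simp add: abs_f powr_powr sgn_f abs_mult_sgn)
  ultimately have "((\<lambda>s. \<bar>v s\<bar> powr p) has_real_derivative p / (p - 1) * v r * w) (at r)"
    by (simp add: mult.assoc)
  then have "((\<lambda>s. (p - 1) / p * \<bar>v s\<bar> powr p) has_real_derivative
      (p - 1) / p * (p / (p - 1) * v r * w)) (at r)"
    by (rule DERIV_cmult)
  then show ?thesis using p by simp
qed

text \<open>The energy is constant inside, but the conditions \<open>v 0 = 0\<close> and
  \<open>v R = 0\<close> say nothing about it unless \<open>v\<close> is continuous up to the ends.
  This is obtained by writing \<open>v\<close> inside as a continuous function \<open>h\<close> of
  \<open>u\<close> and extending the derivative. Then \<open>v R = 0\<close> makes the energy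
  constant vanish, and \<open>v 0 = 0\<close> makes \<open>u 0\<close> a positive zero of the
  potential.\<close>

lemma free_boundary_solution_first_integral:
  assumes sol: "free_boundary_solution p q m R u"
  shows "u 0 = height" and "0 < R" and "continuous_on {0..R} u"
    and "\<And>r. r \<in> {0<..<R} \<Longrightarrow> 0 < u r \<and> u r < height \<and> (u has_real_derivative - slope (u r)) (at r)"
proof -
  from sol have R: "0 < R" and pos: "\<And>r. r \<in> {0..<R} \<Longrightarrow> 0 < u r" and uR: "u R = 0"
    and anti: "strict_antimono_on {0..R} u"
    by (auto simp: free_boundary_solution_def)
  from sol obtain v where v: "\<And>r. r \<in> {0..R} \<Longrightarrow> (u has_real_derivative v r) (at r within {0..R})"
    and v0: "v 0 = 0" and vR: "v R = 0"
    and ode: "\<And>r. r \<in> {0<..<R} \<Longrightarrow> \<exists>w. ((\<lambda>s. \<bar>v s\<bar> powr (p - 2) * v s) has_real_derivative w) (at r) \<and>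
             w + u r powr m = u r powr q"
    unfolding free_boundary_solution_def by blast
  have cont: "continuous_on {0..R} u"
    by (rule DERIV_continuous_on) (rule v)
  have unonneg: "0 \<le> u r" if "r \<in> {0..R}" for r
    using that pos[of r] uR by (cases "r = R") auto
  have vi: "(u has_real_derivative v r) (at r)" if "r \<in> {0<..<R}" for r
    using v[of r] that at_within_interior[of r "{0..R}"] by auto
  have vneg: "v r \<le> 0" if r: "r \<in> {0<..<R}" for r
  proof (rule ccontr)
    assume "\<not> v r \<le> 0"
    then obtain d where "d > 0" and d: "\<forall>h > 0. h < d \<longrightarrow> u r < u (r + h)"
      using DERIV_pos_inc_right[OF vi[OF r]] by auto
    define h where "h = min (d / 2) ((R - r) / 2)"
    have h: "0 < h" "h < d" "r + h < R"
      using \<open>d > 0\<close> r by (auto simp: h_def min_def field_simps)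
    then have "u (r + h) < u r"
      using anti r by (intro monotone_onD[OF anti]) auto
    then show False using d h by force
  qed
  define E where "E r = (p - 1) / p * \<bar>v r\<bar> powr p - potential (u r)" for r
  have "(E has_real_derivative 0) (at r)" if r: "r \<in> {0<..<R}" for r
  proof -
    from ode[OF r] obtain w where w: "((\<lambda>s. \<bar>v s\<bar> powr (p - 2) * v s) has_real_derivative w) (at r)"
      and "w + u r powr m = u r powr q" by blast
    then have w_eq: "w = u r powr q - u r powr m" by simp
    have "0 < u r" using pos r by simp
    from DERIV_chain2[OF potential_deriv[OF this] vi[OF r]]
    have "((\<lambda>r. potential (u r)) has_real_derivative (u r powr q - u r powr m) * v r) (at r)" .
    from DERIV_diff[OF flux_energy_deriv[OF w] this] show ?thesis
      unfolding E_def[abs_def] w_eq by (simp add: algebra_simps)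
  qed
  then have E_const: "E r = E (R / 2)" if "r \<in> {0<..<R}" for r
    using that R by (intro DERIV_isconst3[of 0 R]) auto
  define e where "e = E (R / 2)"
  \<comment> \<open>The maximum with 0 guards the end points, where the sign of
    \<open>e + potential (u r)\<close> is not known yet.\<close>
  define h where "h r = - (max 0 (p / (p - 1) * (e + potential (u r))) powr (1 / p))" for r
  have v_eq: "v r = h r" if r: "r \<in> {0<..<R}" for r
  proof -
    have "\<bar>v r\<bar> powr p = p / (p - 1) * (e + potential (u r))"
    proof -
      have "(p - 1) / p * \<bar>v r\<bar> powr p = e + potential (u r)"
        using E_const[OF r] by (simp add: E_def e_def)
      then have "p / (p - 1) * (e + potential (u r)) = p / (p - 1) * ((p - 1) / p * \<bar>v r\<bar> powr p)"
        by simp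
      then show ?thesis using p by simp
    qed
    then have "(max 0 (p / (p - 1) * (e + potential (u r)))) powr (1 / p) = (\<bar>v r\<bar> powr p) powr (1 / p)"
      by (metis max.absorb2 powr_ge_zero)
    also have "\<dots> = \<bar>v r\<bar>"
      using p by (simp add: powr_powr)
    finally show ?thesis using vneg[OF r] by (simp add: h_def)
  qed
  have cont_pot: "continuous_on {0..R} (\<lambda>r. potential (u r))"
    by (rule continuous_on_compose2[OF potential_continuous cont]) (use unonneg in auto)
  have cont_h: "continuous_on {0..R} h"
    unfolding h_def[abs_def]
    by (intro continuous_on_minus continuous_on_powr' continuous_intros cont_pot) (use p in auto)
  \<comment> \<open>A one-sided derivative is unique, and by continuous extension \<open>h\<close>
    is one, so \<open>v\<close> agrees with \<open>h\<close> at 0 and at \<open>R\<close> as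
    well.\<close>
  have v_eq': "v r = h r" if r: "r \<in> {0..R}" for r
  proof -
    have "(u has_real_derivative h r) (at r within {0..R})"
      by (rule has_real_derivative_continuous_extension[of "{}"]) (use cont cont_h vi v_eq r in auto)
    then show ?thesis
      using vector_derivative_unique_within_closed_interval[of 0 R r u "v r" "h r"] v[OF r] r R
      unfolding has_real_derivative_iff_has_vector_derivative cbox_interval by blast
  qed
  have zero: "e + potential (u r) \<le> 0" if "r \<in> {0..R}" "v r = 0" for r
  proof -
    have "max 0 (p / (p - 1) * (e + potential (u r))) = 0"
      using v_eq'[OF that(1)] that(2) by (simp add: h_def)
    then have "p / (p - 1) * (e + potential (u r)) \<le> 0"
      by (metis max.cobounded2)
    moreover have "0 < p / (p - 1)" using p by simp
    ultimately show ?thesis by (meson linorder_not_le mult_pos_pos)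
  qed
  \<comment> \<open>Because of the maximum in \<open>h\<close>, a zero of \<open>v\<close> yields
    only \<open>\<le> 0\<close>. The reverse inequality holds inside, where the expression is a
    multiple of \<open>\<bar>v r\<bar> powr p\<close>, and passes to the closure.\<close>
  have nonneg: "0 \<le> e + potential (u r)" if r: "r \<in> {0..R}" for r
  proof -
    have "{0..R} \<subseteq> {r \<in> {0..R}. 0 \<le> e + potential (u r)}"
    proof -
      have "closed {r \<in> {0..R}. 0 \<le> e + potential (u r)}"
        using continuous_closed_preimage[OF continuous_on_add[OF continuous_on_const cont_pot], of "{0..}" e]
        by (auto simp: vimage_def Int_def)
      moreover have "{0<..<R} \<subseteq> {r \<in> {0..R}. 0 \<le> e + potential (u r)}"
      proof
        fix r assume r: "r \<in> {0<..<R}"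
        have "e + potential (u r) = (p - 1) / p * \<bar>v r\<bar> powr p"
          using E_const[OF r] by (simp add: E_def e_def)
        then show "r \<in> {r \<in> {0..R}. 0 \<le> e + potential (u r)}"
          using r p by simp
      qed
      ultimately have "closure {0<..<R} \<subseteq> {r \<in> {0..R}. 0 \<le> e + potential (u r)}"
        by (simp add: closure_minimal)
      then show ?thesis using R by simp
    qed
    then show ?thesis using r by blast
  qed
  have "e = 0"
    using zero[of R] nonneg[of R] R vR uR by simp
  moreover have "e + potential (u 0) = 0"
    using zero[of 0] nonneg[of 0] R v0 by simp
  ultimately show u0: "u 0 = height"
    using potential_eq_0_iff[of "u 0"] pos[of 0] R by simp
  show "0 < R" by (rule R)
  show "continuous_on {0..R} u" by (rule cont)
  fix r assume r: "r \<in> {0<..<R}"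
  have less: "u r < height"
    using r u0 monotone_onD[OF anti, of 0 r] by auto
  have "0 < u r" using r pos by simp
  then have "h r = - slope (u r)"
    using potential_pos[of "u r"] less p \<open>e = 0\<close> by (simp add: h_def slope_def max_def)
  then show "0 < u r \<and> u r < height \<and> (u has_real_derivative - slope (u r)) (at r)"
    using less \<open>0 < u r\<close> vi[OF r] v_eq[OF r] by simp
qed

text \<open>Separation of variables: \<open>profile (u r) + rate * r\<close> has derivative 0 in the
  open interval, where \<open>slope (u r)\<close> is positive, and is continuous up to both ends.
  Its values at 0 and at \<open>R\<close> determine \<open>R\<close>.\<close>

lemma free_boundary_solution_profile:
  assumes sol: "free_boundary_solution p q m R u"
  shows "R = radius" and "\<And>r. r \<in> {0..R} \<Longrightarrow> u r \<in> {0..height} \<and> profile (u r) = rate * (R - r)"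
proof -
  note fi = free_boundary_solution_first_integral[OF sol]
  have uR: "u R = 0" using sol by (auto simp: free_boundary_solution_def)
  have range: "u r \<in> {0..height}" if "r \<in> {0..R}" for r
    using fi(4)[of r] that fi(1) uR height_pos by (cases "r = 0 \<or> r = R") auto
  define f where "f r = profile (u r) + rate * r" for r
  have contf: "continuous_on {0..R} f"
    unfolding f_def[abs_def]
    by (intro continuous_intros continuous_on_compose2[OF profile_continuous fi(3)]) (use range in auto)
  have "(f has_real_derivative 0) (at r)" if r: "0 < r" "r < R" for r
  proof -
    from fi(4)[of r] r have u: "0 < u r" "u r < height" "(u has_real_derivative - slope (u r)) (at r)"
      by auto
    have "((\<lambda>r. profile (u r)) has_real_derivative rate / slope (u r) * - slope (u r)) (at r)"
      by (rule DERIV_chain2[OF profile_deriv[OF u(1,2)] u(3)])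
    then show ?thesis
      unfolding f_def[abs_def] using slope_pos[OF u(1,2)] by (auto intro!: derivative_eq_intros)
  qed
  then have const: "f r = f 0" if "r \<in> {0..R}" for r
    using DERIV_isconst2[OF fi(2) contf, of r] that by auto
  have "rate * R = Beta \<alpha> \<beta>"
    using const[of R] fi(1,2) uR profile_height by (simp add: f_def)
  then show "R = radius"
    using rate_pos by (simp add: radius_def field_simps)
  show "u r \<in> {0..height} \<and> profile (u r) = rate * (R - r)" if "r \<in> {0..R}" for r
    using const[OF that] const[of R] fi(2) uR range[OF that] by (simp add: f_def algebra_simps)
qed

text \<open>On \<open>{0..R}\<close> the injective \<open>profile\<close> determines the value;
  beyond \<open>R\<close> it is 0 by definition, and at negative arguments it is fixed by
  evenness.\<close>

lemma free_boundary_solution_unique: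
  assumes sol1: "free_boundary_solution p q m R1 u1" and sol2: "free_boundary_solution p q m R2 u2"
  shows "R1 = R2" and "u1 = u2"
proof -
  note pr = free_boundary_solution_profile
  show R: "R1 = R2" using pr(1)[OF sol1] pr(1)[OF sol2] by simp
  have eq: "u1 r = u2 r" if "0 \<le> r" for r
  proof (cases "r \<le> R1")
    case True
    then have "r \<in> {0..R1}" "r \<in> {0..R2}" using that R by auto
    from pr(2)[OF sol1 this(1)] pr(2)[OF sol2 this(2)] have
      "profile (u1 r) = profile (u2 r)" "u1 r \<in> {0..height}" "u2 r \<in> {0..height}"
      using R by auto
    then show ?thesis
      by (rule inj_onD[OF strict_mono_on_imp_inj_on[OF profile_strict_mono]])
  next
    case False
    then show ?thesis
      using sol1 sol2 R by (simp add: free_boundary_solution_def)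
  qed
  show "u1 = u2"
  proof
    fix r
    have "u1 \<bar>r\<bar> = u2 \<bar>r\<bar>" by (rule eq) simp
    then show "u1 r = u2 r"
      using sol1 sol2 unfolding free_boundary_solution_def by (metis abs_if)
  qed
qed

section \<open>Existence\<close>

text \<open>Solves \<open>profile u = rate * (radius - \<bar>r\<bar>)\<close> for \<open>u\<close>.
  The case distinction keeps the inverse within the image of \<open>profile\<close>.\<close>

definition sol :: "real \<Rightarrow> real"
  where "sol r = (if \<bar>r\<bar> < radius then the_inv_into {0..height} profile (rate * (radius - \<bar>r\<bar>)) else 0)"

definition sol' :: "real \<Rightarrow> real"
  where "sol' r = - sgn r * slope (sol r)"

lemma radius_pos: "0 < radius"
  using strict_mono_onD[OF profile_strict_mono, of 0 height] height_pos rate_pos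
  by (simp add: radius_def profile_height)

lemma profile_image: "profile ` {0..height} = {0..Beta \<alpha> \<beta>}"
proof
  have mono: "mono_on {0..height} profile"
    using profile_strict_mono by (rule strict_mono_on_imp_mono_on)
  show "profile ` {0..height} \<subseteq> {0..Beta \<alpha> \<beta>}"
    using mono_onD[OF mono, of 0] mono_onD[OF mono, of _ height] height_pos profile_height by auto
  show "{0..Beta \<alpha> \<beta>} \<subseteq> profile ` {0..height}"
  proof
    fix y assume "y \<in> {0..Beta \<alpha> \<beta>}"
    then show "y \<in> profile ` {0..height}"
      using IVT'[of profile 0 y height] profile_continuous profile_height height_pos by auto
  qed
qed

lemma sol_profile:
  assumes "\<bar>r\<bar> \<le> radius"
  shows "sol r \<in> {0..height}" and "profile (sol r) = rate * (radius - \<bar>r\<bar>)"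
proof -
  let ?y = "rate * (radius - \<bar>r\<bar>)"
  have inj: "inj_on profile {0..height}"
    using profile_strict_mono by (rule strict_mono_on_imp_inj_on)
  have "?y \<in> {0..Beta \<alpha> \<beta>}"
    using assms rate_pos by (auto simp: radius_def field_simps)
  then have y: "?y \<in> profile ` {0..height}" by (simp add: profile_image)
  have "sol r = the_inv_into {0..height} profile ?y"
  proof (cases "\<bar>r\<bar> < radius")
    case False
    then have "\<bar>r\<bar> = radius" using assms by simp
    then show ?thesis
      using the_inv_into_f_f[OF inj, of 0] height_pos by (simp add: sol_def)
  qed (simp add: sol_def)
  then show "sol r \<in> {0..height}" and "profile (sol r) = ?y"
    using the_inv_into_into[OF inj y order_refl] f_the_inv_into_f[OF inj y] by auto
qed

lemma sol_range: "sol r \<in> {0..height}"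
  using sol_profile(1)[of r] height_pos by (cases "\<bar>r\<bar> \<le> radius") (auto simp: sol_def)

lemma sol_outside: "radius \<le> \<bar>r\<bar> \<Longrightarrow> sol r = 0"
  by (simp add: sol_def)

lemma sol_0: "sol 0 = height"
proof -
  have "profile (sol 0) = profile height"
    using sol_profile(2)[of 0] radius_pos rate_pos by (simp add: profile_height radius_def)
  then show ?thesis
    using inj_onD[OF strict_mono_on_imp_inj_on[OF profile_strict_mono]] sol_range height_pos by auto
qed

lemma sol_less_iff:
  assumes "\<bar>x\<bar> \<le> radius" "\<bar>y\<bar> \<le> radius"
  shows "sol x < sol y \<longleftrightarrow> \<bar>y\<bar> < \<bar>x\<bar>"
proof -
  have "sol x < sol y \<longleftrightarrow> profile (sol x) < profile (sol y)"
    using strict_mono_on_less[OF profile_strict_mono sol_range sol_range] by simp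
  then show ?thesis
    using assms rate_pos by (simp add: sol_profile)
qed

lemma sol_strict: "0 < \<bar>r\<bar> \<Longrightarrow> \<bar>r\<bar> < radius \<Longrightarrow> 0 < sol r \<and> sol r < height"
  using sol_less_iff[of r 0] sol_less_iff[of radius r] radius_pos by (simp add: sol_0 sol_outside)

text \<open>Since the inverse of \<open>profile\<close> is 0 at 0, both branches of
  \<open>sol\<close> are one formula with \<open>max 0 (radius - \<bar>r\<bar>)\<close>, a
  composition of continuous functions.\<close>

lemma sol_continuous: "continuous_on UNIV sol"
proof -
  have inv: "continuous_on (profile ` {0..height}) (the_inv_into {0..height} profile)"
    using strict_mono_on_imp_inj_on[OF profile_strict_mono]
    by (intro continuous_on_inv profile_continuous) (auto intro: the_inv_into_f_f)
  have "continuous_on UNIV (\<lambda>r. the_inv_into {0..height} profile (rate * max 0 (radius - \<bar>r\<bar>)))"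
  proof (rule continuous_on_compose2[OF inv])
    show "continuous_on UNIV (\<lambda>r. rate * max 0 (radius - \<bar>r\<bar>))"
      by (intro continuous_intros)
    show "range (\<lambda>r. rate * max 0 (radius - \<bar>r\<bar>)) \<subseteq> profile ` {0..height}"
      unfolding profile_image using rate_pos radius_pos by (auto simp: radius_def field_simps max_def)
  qed
  moreover have "the_inv_into {0..height} profile (rate * max 0 (radius - \<bar>r\<bar>)) = sol r" for r
    using the_inv_into_f_f[OF strict_mono_on_imp_inj_on[OF profile_strict_mono], of 0] height_pos
    by (auto simp: sol_def max_def)
  ultimately show ?thesis by simp
qed

lemma slope_sol_continuous: "continuous_on UNIV (\<lambda>r. slope (sol r))"
  by (rule continuous_on_compose2[OF slope_continuous sol_continuous]) (use sol_range in auto)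

lemma sol'_continuous: "continuous_on UNIV sol'"
proof -
  \<comment> \<open>The jump of \<open>sgn\<close> at 0 is harmless because
    \<open>slope (sol 0) = slope height = 0\<close>; the formula with \<open>min\<close> and
    \<open>max\<close> makes this visible.\<close>
  have "sol' = (\<lambda>r. slope (sol (min r 0)) - slope (sol (max r 0)))"
    by (auto simp: sol'_def sol_0 min_def max_def sgn_if not_le)
  moreover have "continuous_on UNIV (\<lambda>r. slope (sol (min r 0)) - slope (sol (max r 0)))"
    by (intro continuous_on_diff continuous_on_compose2[OF slope_sol_continuous] continuous_intros) auto
  ultimately show ?thesis by simp
qed

text \<open>At 0 and at \<open>radius\<close>, \<open>- radius\<close> the slope vanishes and the
  inverse function rule breaks down. These three points are the exceptional set of the continuous
  extension lemma.\<close>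

lemma sol_deriv: "(sol has_real_derivative sol' r) (at r)"
proof (rule has_real_derivative_continuous_extension_UNIV[OF _ sol_continuous sol'_continuous])
  show "finite {0, radius, - radius}" by simp
  fix r assume r: "r \<notin> {0, radius, - radius}"
  have pos: "(sol has_real_derivative - slope (sol r)) (at r)" if r: "0 < r" "r < radius" for r
  proof -
    have s: "0 < sol r" "sol r < height" using sol_strict[of r] r by auto
    \<comment> \<open>\<open>P\<close> recovers the radius from the height of the solution; its
      derivative is \<open>- 1 / slope\<close>.\<close>
    define P where "P s = radius - profile s / rate" for s
    have "(sol has_real_derivative inverse (- 1 / slope (sol r))) (at r)"
    proof (rule DERIV_inverse_function[of P _ _ _ 0 radius])
      show "(P has_real_derivative - 1 / slope (sol r)) (at (sol r))"
        unfolding P_def[abs_def] using profile_deriv[OF s] rate_pos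
        by (auto intro!: derivative_eq_intros)
      show "- 1 / slope (sol r) \<noteq> 0" using slope_pos[OF s] by simp
      show "P (sol y) = y" if "0 < y" "y < radius" for y
        using sol_profile(2)[of y] that rate_pos by (simp add: P_def)
      show "isCont sol r"
        using sol_continuous continuous_on_eq_continuous_at by blast
    qed (use r in auto)
    then show ?thesis by simp
  qed
  consider "0 < r" "r < radius" | "r < 0" "- radius < r" | "radius < \<bar>r\<bar>"
    using r by fastforce
  then show "(sol has_real_derivative sol' r) (at r)"
  proof cases
    case 1
    then show ?thesis using pos by (simp add: sol'_def)
  next
    case 2
    have even: "sol (- x) = sol x" for x by (simp add: sol_def)
    have "((\<lambda>x. sol (- x)) has_real_derivative - slope (sol (- r)) * - 1) (at r)"
      by (rule DERIV_chain2[where f=sol and g=uminus, OF pos[of "- r"]]) (use 2 in \<open>auto intro!: derivative_eq_intros\<close>)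
    then show ?thesis using 2 by (simp add: even sol'_def)
  next
    case 3
    have "((\<lambda>x. 0) has_real_derivative 0) (at r)" by simp
    then have "(sol has_real_derivative 0) (at r)"
      by (rule has_field_derivative_transform_within_open[of _ _ _ "{x. radius < \<bar>x\<bar>}"])
         (use 3 in \<open>auto simp: sol_outside intro!: open_Collect_less continuous_intros\<close>)
    then show ?thesis using 3 by (simp add: sol'_def sol_outside)
  qed
qed

text \<open>The flux is minus the power \<open>(p - 1) / p\<close> of a multiple of
  \<open>potential (sol s)\<close>, which is positive here. In the chain rule the outer derivative
  contributes \<open>1 / slope\<close> and \<open>sol'\<close> contributes \<open>- slope\<close>,
  so that only the derivative of the potential remains.\<close>

lemma flux_sol_deriv:
  assumes "0 < r" "r < radius"
  shows "((\<lambda>s. - (slope (sol s) powr (p - 1))) has_real_derivative sol r powr q - sol r powr m) (at r)"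
proof -
  have s: "0 < sol r" "sol r < height" using sol_strict[of r] assms by auto
  have pot: "0 < potential (sol r)" using potential_pos[OF s] .
  have exps: "(p - 1) / p - 1 = - (1 / p)" using p by (simp add: field_simps)
  define c where "c = p / (p - 1)"
  have c: "0 < c" using p by (simp add: c_def)
  define X where "X = (c * potential (sol r)) powr (1 / p)"
  have X: "0 < X" using c pot by (simp add: X_def)
  have "((\<lambda>s. potential (sol s)) has_real_derivative (sol r powr q - sol r powr m) * sol' r) (at r)"
    by (rule DERIV_chain2[OF potential_deriv[OF s(1)] sol_deriv])
  then have "((\<lambda>s. c * potential (sol s)) has_real_derivative c * ((sol r powr q - sol r powr m) * sol' r)) (at r)"
    by (rule DERIV_cmult)
  then have "((\<lambda>s. (c * potential (sol s)) powr ((p - 1) / p)) has_real_derivative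
      ((p - 1) / p * (c * potential (sol r)) powr ((p - 1) / p - 1)) * (c * ((sol r powr q - sol r powr m) * sol' r))) (at r)"
    using c pot
    by (intro DERIV_chain2[where f="\<lambda>z. z powr ((p - 1) / p)"] has_real_derivative_powr) auto
  moreover have "((p - 1) / p * (c * potential (sol r)) powr ((p - 1) / p - 1)) * (c * ((sol r powr q - sol r powr m) * sol' r))
      = - (sol r powr q - sol r powr m)"
  proof -
    have "(c * potential (sol r)) powr ((p - 1) / p - 1) = inverse X"
      unfolding exps X_def by (rule powr_minus)
    moreover have "sol' r = - X"
      using assms by (simp add: sol'_def slope_def X_def c_def)
    moreover have "(p - 1) / p * c = 1" using p by (simp add: c_def)
    moreover have "P * inverse X * (c * (d * - X)) = - d" if "P * c = 1" for P d
      using that X by (simp add: field_simps)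
    ultimately show ?thesis by (simp only:)
  qed
  ultimately have "((\<lambda>s. (c * potential (sol s)) powr ((p - 1) / p)) has_real_derivative
      - (sol r powr q - sol r powr m)) (at r)" by simp
  then have "((\<lambda>s. - ((c * potential (sol s)) powr ((p - 1) / p))) has_real_derivative
      sol r powr q - sol r powr m) (at r)"
    using DERIV_minus by fastforce
  moreover have "slope (sol s) powr (p - 1) = (c * potential (sol s)) powr ((p - 1) / p)" for s
    by (simp add: slope_def powr_powr c_def)
  ultimately show ?thesis by simp
qed

lemma free_boundary_solution_sol: "free_boundary_solution p q m radius sol"
  unfolding free_boundary_solution_def
proof (intro conjI exI ballI allI impI)
  show "0 < radius" by (rule radius_pos)
  show "0 < sol r" if "r \<in> {0..<radius}" for r
    using sol_less_iff[of radius r] that by (simp add: sol_outside)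
  show "sol r = 0" if "radius \<le> r" for r
    using that by (simp add: sol_outside)
  show "sol (- r) = sol r" for r by (simp add: sol_def)
  show "strict_antimono_on {0..radius} sol"
    by (rule monotone_onI) (auto simp: sol_less_iff)
  show "(sol has_real_derivative sol' r) (at r within {0..radius})" for r
    using sol_deriv by (rule DERIV_subset) simp
  show "sol' 0 = 0" by (simp add: sol'_def)
  show "sol' radius = 0" by (simp add: sol'_def sol_outside)
  fix r assume r: "r \<in> {0<..<radius}"
  show "((\<lambda>s. \<bar>sol' s\<bar> powr (p - 2) * sol' s) has_real_derivative sol r powr q - sol r powr m) (at r)"
  proof (rule has_field_derivative_transform_within_open[OF flux_sol_deriv])
    fix s assume s: "s \<in> {0<..<radius}"
    have "\<bar>sol' s\<bar> = slope (sol s)" "sol' s = - slope (sol s)"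
      using s by (auto simp: sol'_def slope_nonneg)
    moreover have "slope (sol s) powr (p - 2) * slope (sol s) powr 1 = slope (sol s) powr (p - 1)"
      by (simp only: powr_add[symmetric]) simp
    ultimately show "- (slope (sol s) powr (p - 1)) = \<bar>sol' s\<bar> powr (p - 2) * sol' s"
      using slope_nonneg by simp
  qed (use r in auto)
  show "sol r powr q - sol r powr m + sol r powr m = sol r powr q" by simp
qed

end

section \<open>Integrals of continuous functions with compact support\<close>

lemma lebesgue_integral_compact_support:
  fixes f :: "real \<Rightarrow> real"
  assumes cont: "continuous_on UNIV f" and zero: "\<And>x. R \<le> \<bar>x\<bar> \<Longrightarrow> f x = 0"
  shows "integrable lebesgue f" and "(\<integral>x. f x \<partial>lebesgue) = integral {-R..R} f"
    and "f integrable_on {-R..R}"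
proof -
  have abs: "f absolutely_integrable_on {-R..R}"
    by (rule absolutely_integrable_continuous_real) (rule continuous_on_subset[OF cont subset_UNIV])
  have eq: "(\<lambda>x. indicator {-R..R} x *\<^sub>R f x) = f"
  proof
    show "indicator {-R..R} x *\<^sub>R f x = f x" for x
      using zero[of x] by (cases "R \<le> \<bar>x\<bar>") (auto simp: indicator_def)
  qed
  show "integrable lebesgue f"
    using abs unfolding set_integrable_def eq .
  show "f integrable_on {-R..R}"
    using abs set_lebesgue_integral_eq_integral(1) by blast
  show "(\<integral>x. f x \<partial>lebesgue) = integral {-R..R} f"
    using set_lebesgue_integral_eq_integral(2)[OF abs] unfolding set_lebesgue_integral_def eq .
qed

lemma lebesgue_integral_even_compact_support:
  fixes f :: "real \<Rightarrow> real"
  assumes cont: "continuous_on UNIV f" and even: "\<And>x. f (- x) = f x"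
    and zero: "\<And>x. R \<le> \<bar>x\<bar> \<Longrightarrow> f x = 0" and R: "0 < R"
  shows "integrable lebesgue f" and "(\<integral>x. f x \<partial>lebesgue) = 2 * integral {0..R} f"
proof -
  show "integrable lebesgue f"
    by (rule lebesgue_integral_compact_support(1)[OF cont]) (rule zero)
  have int: "f integrable_on {-R..R}"
    by (rule lebesgue_integral_compact_support(3)[OF cont]) (rule zero)
  have "(\<integral>x. f x \<partial>lebesgue) = integral {-R..R} f"
    by (rule lebesgue_integral_compact_support(2)[OF cont]) (rule zero)
  also have "\<dots> = integral {-R..0} f + integral {0..R} f"
    by (rule Henstock_Kurzweil_Integration.integral_combine[symmetric]) (use R int in auto)
  also have "integral {-R..0} f = integral {0..R} f"
    using Henstock_Kurzweil_Integration.integral_reflect_real[of R 0 f] by (simp add: even)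
  finally show "(\<integral>x. f x \<partial>lebesgue) = 2 * integral {0..R} f" by simp
qed

section \<open>The weight for Hoelder's inequality and its Beta primitive\<close>

context gn_exponents
begin

definition \<eta>1 :: real where "\<eta>1 = (p - 1) * (m + 1) + p"
definition \<eta>2 :: real where "\<eta>2 = (p - 1) * (q + 1) + p"

lemma \<eta>_pos: "0 < \<eta>1" "0 < \<eta>2"
  using p q m by (auto simp: \<eta>1_def \<eta>2_def intro!: add_pos_pos mult_pos_pos)

text \<open>The function G' of the overview. The exponent \<open>(p - 1) / p\<close> is the
  reciprocal of the conjugate exponent of \<open>p\<close>, so Hoelder's inequality leaves the bare
  base under the integral.\<close>

definition weight :: "real \<Rightarrow> real \<Rightarrow> real"
  where "weight M s = (s powr (q + 1) - M powr (q - m) * s powr (m + 1)) powr ((p - 1) / p)"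

definition antideriv :: "real \<Rightarrow> real \<Rightarrow> real"
  where "antideriv M s = M powr (\<eta>2 / p) / (m - q) *
     inc_beta ((s / M) powr (m - q)) (\<eta>2 / (p * (m - q))) ((2 * p - 1) / p)"

text \<open>Twice the value of \<open>antideriv M\<close> at \<open>M\<close>, with the power of
  \<open>M\<close> removed; the factor 2 counts the rise to the maximum and the fall from
  it.\<close>

definition K :: real
  where "K = 2 / (m - q) * Beta (\<eta>2 / (p * (m - q))) ((2 * p - 1) / p)"

lemma antideriv_exponents_pos: "0 < \<eta>2 / (p * (m - q))" "0 < (2 * p - 1) / p"
  using p m \<eta>_pos by auto

lemma weight_factor:
  assumes "0 < M" "0 \<le> s"
  shows "s powr (q + 1) - M powr (q - m) * s powr (m + 1) = s powr (q + 1) * (1 - (s / M) powr (m - q))"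
proof -
  have "s powr (m + 1) = s powr (q + 1) * s powr (m - q)"
    by (simp add: powr_add[symmetric] add.commute)
  moreover have "M powr (q - m) = inverse (M powr (m - q))"
    by (simp add: powr_minus[symmetric])
  moreover have "(s / M) powr (m - q) = s powr (m - q) * inverse (M powr (m - q))"
    using powr_divide[of s M "m - q"] assms by (simp only: divide_inverse)
  ultimately show ?thesis by (simp add: algebra_simps)
qed

lemma weight_base_nonneg:
  assumes "0 < M" "s \<in> {0..M}"
  shows "0 \<le> s powr (q + 1) - M powr (q - m) * s powr (m + 1)"
proof -
  have "(s / M) powr (m - q) \<le> 1"
    using assms m by (intro powr_le1) auto
  then show ?thesis using assms by (simp add: weight_factor)
qed

lemma weight_continuous: "0 < M \<Longrightarrow> continuous_on {0..M} (weight M)"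
  unfolding weight_def[abs_def]
  by (intro continuous_on_powr' continuous_intros) (use p q m weight_base_nonneg in auto)

lemma weight_nonneg: "0 \<le> weight M s"
  by (simp add: weight_def)

lemma antideriv_0 [simp]: "antideriv M 0 = 0"
  by (simp add: antideriv_def)

lemma antideriv_continuous: "0 < M \<Longrightarrow> continuous_on {0..M} (antideriv M)"
  unfolding antideriv_def[abs_def]
  using inc_beta_powr_continuous[OF antideriv_exponents_pos] m by (intro continuous_intros) auto

lemma antideriv_end: "0 < M \<Longrightarrow> 2 * antideriv M M = K * M powr (\<eta>2 / p)"
  using inc_beta_1[OF antideriv_exponents_pos] by (simp add: antideriv_def K_def)

lemma K_pos: "0 < K"
proof -
  have "inc_beta 0 (\<eta>2 / (p * (m - q))) ((2 * p - 1) / p) < inc_beta 1 (\<eta>2 / (p * (m - q))) ((2 * p - 1) / p)"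
    by (rule strict_mono_onD[OF inc_beta_strict_mono[OF antideriv_exponents_pos]]) auto
  then show ?thesis
    using m inc_beta_1[OF antideriv_exponents_pos] by (simp add: K_def)
qed

text \<open>The Beta parameters of \<open>antideriv\<close> are chosen so that, after the
  substitution, the exponents become \<open>\<eta>2 / p - 1 = (q + 1) * ((p - 1) / p)\<close> and
  \<open>(2 * p - 1) / p - 1 = (p - 1) / p\<close>, those of the factored weight.\<close>

lemma antideriv_deriv:
  assumes "0 < s" "s < M"
  shows "(antideriv M has_real_derivative weight M s) (at s)"
proof -
  have M: "0 < M" using assms by simp
  define x where "x = 1 - (s / M) powr (m - q)"
  have x: "0 < x"
    using powr_less_mono2[of "m - q" "s / M" 1] assms m by (simp add: x_def)
  have ka: "(m - q) * (\<eta>2 / (p * (m - q))) = \<eta>2 / p" using m by simp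
  have e1: "\<eta>2 / p - 1 = (q + 1) * ((p - 1) / p)"
    using p by (simp add: \<eta>2_def field_simps)
  have e2: "(2 * p - 1) / p - 1 = (p - 1) / p"
    using p by (simp add: field_simps)
  have "((\<lambda>s. inc_beta ((s / M) powr (m - q)) (\<eta>2 / (p * (m - q))) ((2 * p - 1) / p)) has_real_derivative
     (m - q) / M powr (\<eta>2 / p) * s powr ((q + 1) * ((p - 1) / p)) * x powr ((p - 1) / p)) (at s)"
    using inc_beta_powr_deriv[OF antideriv_exponents_pos _ assms, of "m - q"] m
    unfolding ka e1 e2 x_def by simp
  then have "(antideriv M has_real_derivative M powr (\<eta>2 / p) / (m - q) *
     ((m - q) / M powr (\<eta>2 / p) * s powr ((q + 1) * ((p - 1) / p)) * x powr ((p - 1) / p))) (at s)"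
    unfolding antideriv_def[abs_def] by (rule DERIV_cmult)
  moreover have "weight M s = s powr ((q + 1) * ((p - 1) / p)) * x powr ((p - 1) / p)"
    using weight_factor[OF M, of s] assms
    by (simp add: weight_def powr_mult powr_powr flip: x_def)
  moreover have "a / b * (b / a * S * X) = S * X" if "a \<noteq> 0" "b \<noteq> 0" for a b S X :: real
    using that by simp
  ultimately show ?thesis using m M by simp
qed

section \<open>The integrals of the free boundary solution\<close>

lemma sol'_abs: "\<bar>sol' r\<bar> = slope (sol r)"
  by (cases "r = 0") (simp_all add: sol'_def sol_0 abs_mult slope_nonneg)

lemma sol'_abs_powr: "\<bar>sol' r\<bar> powr p = p / (p - 1) * potential (sol r)"
  using p potential_nonneg[OF sol_range[of r]] by (simp add: sol'_abs slope_def powr_powr)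

lemma potential_sol_continuous: "continuous_on UNIV (\<lambda>r. potential (sol r))"
  by (rule continuous_on_compose2[OF potential_continuous sol_continuous]) (use sol_range in auto)

lemma sol_powr_continuous: "0 < e \<Longrightarrow> continuous_on UNIV (\<lambda>r. sol r powr e)"
  by (intro continuous_on_powr' sol_continuous continuous_intros) (use sol_range in auto)

lemma sol_even: "sol (- r) = sol r"
  by (simp add: sol_def)

lemma sol_powr_integral:
  assumes "0 < e"
  shows "integrable lebesgue (\<lambda>r. sol r powr e)"
    and "(\<integral>r. sol r powr e \<partial>lebesgue) = 2 * integral {0..radius} (\<lambda>r. sol r powr e)"
  by (rule lebesgue_integral_even_compact_support[OF sol_powr_continuous[OF assms] _ _ radius_pos];
      simp add: sol_even sol_outside)+

lemma potential_sol_integral: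
  shows "(\<integral>r. potential (sol r) \<partial>lebesgue) = 2 * integral {0..radius} (\<lambda>r. potential (sol r))"
  by (rule lebesgue_integral_even_compact_support[OF potential_sol_continuous _ _ radius_pos];
      simp add: sol_even sol_outside)

definition intA :: real where "intA = (\<integral>r. \<bar>sol' r\<bar> powr p \<partial>lebesgue)"
definition intB :: real where "intB = (\<integral>r. \<bar>sol r\<bar> powr (q + 1) \<partial>lebesgue)"
definition intD :: real where "intD = (\<integral>r. \<bar>sol r\<bar> powr (m + 1) \<partial>lebesgue)"

lemma abs_sol [simp]: "\<bar>sol r\<bar> = sol r"
  using sol_range[of r] by simp

lemma potential_integral_eq: "(\<integral>r. potential (sol r) \<partial>lebesgue) = intB / (q + 1) - intD / (m + 1)"
  unfolding potential_def intB_def intD_def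
  using q m sol_powr_integral(1)[of "q + 1"] sol_powr_integral(1)[of "m + 1"] by simp

lemma intA_eq: "intA = p / (p - 1) * (intB / (q + 1) - intD / (m + 1))"
  unfolding intA_def sol'_abs_powr potential_integral_eq[symmetric] by simp

lemma integrable_sol'_powr: "integrable lebesgue (\<lambda>r. \<bar>sol' r\<bar> powr p)"
  unfolding sol'_abs_powr potential_def
  using q m sol_powr_integral(1)[of "q + 1"] sol_powr_integral(1)[of "m + 1"] by simp

text \<open>The equation tested with the solution itself: the product of flux and \<open>sol\<close>
  has derivative \<open>f\<close>, and it vanishes at both ends, at 0 because
  \<open>slope height = 0\<close> and at \<open>radius\<close> because
  \<open>sol radius = 0\<close>.\<close>

lemma intB_intD_intA: "intD = intB + intA"
proof -
  define f where "f r = sol r powr (q + 1) - sol r powr (m + 1) + p / (p - 1) * potential (sol r)" for r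
  have "(f has_integral (- (slope (sol radius) powr (p - 1)) * sol radius - - (slope (sol 0) powr (p - 1)) * sol 0)) {0..radius}"
  proof (rule fundamental_theorem_of_calculus_interior)
    show "continuous_on {0..radius} (\<lambda>r. - (slope (sol r) powr (p - 1)) * sol r)"
      by (intro continuous_intros continuous_on_powr' continuous_on_subset[OF slope_sol_continuous]
            continuous_on_subset[OF sol_continuous]) (use p slope_nonneg in auto)
    fix r assume r: "r \<in> {0<..<radius}"
    then have "0 < sol r" using sol_strict[of r] by auto
    moreover have "slope (sol r) powr (p - 1) * slope (sol r) powr 1 = slope (sol r) powr p"
      by (simp only: powr_add[symmetric]) simp
    moreover have "sol' r = - slope (sol r)" using r by (simp add: sol'_def)
    ultimately have "(sol r powr q - sol r powr m) * sol r + sol' r * - (slope (sol r) powr (p - 1)) = f r"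
      using sol'_abs_powr[of r] slope_nonneg[of "sol r"]
      by (simp add: f_def sol'_abs powr_add algebra_simps)
    moreover have "((\<lambda>r. - (slope (sol r) powr (p - 1)) * sol r) has_real_derivative
       (sol r powr q - sol r powr m) * sol r + sol' r * - (slope (sol r) powr (p - 1))) (at r)"
      by (rule DERIV_mult[OF flux_sol_deriv sol_deriv]) (use r in auto)
    ultimately show "((\<lambda>r. - (slope (sol r) powr (p - 1)) * sol r) has_vector_derivative f r) (at r)"
      by (simp add: has_real_derivative_iff_has_vector_derivative)
  qed (use radius_pos in simp)
  then have f0: "integral {0..radius} f = 0"
    by (simp add: sol_0 sol_outside integral_unique)
  have "(\<integral>r. f r \<partial>lebesgue) = 2 * integral {0..radius} f"
    using q m unfolding f_def[abs_def]
    by (intro lebesgue_integral_even_compact_support continuous_intros sol_powr_continuous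
          potential_sol_continuous) (auto simp: sol_even sol_outside radius_pos)
  then have "(\<integral>r. f r \<partial>lebesgue) = 0" by (simp add: f0)
  moreover have "(\<integral>r. f r \<partial>lebesgue) = intB - intD + intA"
    using q m sol_powr_integral(1)[of "q + 1"] sol_powr_integral(1)[of "m + 1"] integrable_sol'_powr
    unfolding f_def intB_def intD_def intA_def sol'_abs_powr by simp
  ultimately show ?thesis by simp
qed

text \<open>Equality in the rise-and-fall estimate. As
  \<open>height powr (q - m) = (q + 1) / (m + 1)\<close>, the base of \<open>weight height\<close>
  is \<open>(q + 1) * potential\<close>, so the weight times the slope is a multiple of the
  potential. On the other hand it is minus the derivative of
  \<open>antideriv height (sol r)\<close>.\<close>

lemma potential_integral_K:
  "(p / (p - 1)) powr (1 / p) * (q + 1) powr ((p - 1) / p) * (\<integral>r. potential (sol r) \<partial>lebesgue)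
     = K * height powr (\<eta>2 / p)"
proof -
  define c where "c = (p / (p - 1)) powr (1 / p) * (q + 1) powr ((p - 1) / p)"
  have slope_weight: "slope s * weight height s = c * potential s" if s: "s \<in> {0..height}" for s
  proof -
    have "height powr (q - m) = (q + 1) / (m + 1)"
    proof -
      have "height powr (q - m) = inverse (height powr (m - q))"
        by (simp add: powr_minus[symmetric])
      then show ?thesis by (simp add: height_powr)
    qed
    then have "s powr (q + 1) - height powr (q - m) * s powr (m + 1) = (q + 1) * potential s"
      using q by (simp add: potential_def field_simps)
    then have "weight height s = (q + 1) powr ((p - 1) / p) * potential s powr ((p - 1) / p)"
      by (simp add: weight_def powr_mult)
    moreover have "slope s = (p / (p - 1)) powr (1 / p) * potential s powr (1 / p)"
      unfolding slope_def by (simp only: powr_mult)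
    moreover have "potential s powr (1 / p) * potential s powr ((p - 1) / p) = potential s"
    proof -
      have "potential s powr (1 / p) * potential s powr ((p - 1) / p) = potential s powr (1 / p + (p - 1) / p)"
        by (rule powr_add[symmetric])
      also have "1 / p + (p - 1) / p = 1" using p by (simp add: field_simps)
      finally show ?thesis using potential_nonneg[OF s] by simp
    qed
    ultimately show ?thesis by (simp add: c_def)
  qed
  have boundary: "- antideriv height (sol radius) - - antideriv height (sol 0) = antideriv height height"
    by (simp add: sol_0 sol_outside)
  have "((\<lambda>r. c * potential (sol r)) has_integral - antideriv height (sol radius) - - antideriv height (sol 0)) {0..radius}"
  proof (rule fundamental_theorem_of_calculus_interior)
    show "continuous_on {0..radius} (\<lambda>r. - antideriv height (sol r))"
      by (intro continuous_on_minus continuous_on_compose2[OF antideriv_continuous[OF height_pos]]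
            continuous_on_subset[OF sol_continuous]) (use sol_range in auto)
    fix r assume r: "r \<in> {0<..<radius}"
    then have s: "0 < sol r" "sol r < height" using sol_strict[of r] by auto
    have "((\<lambda>r. - antideriv height (sol r)) has_real_derivative - (weight height (sol r) * sol' r)) (at r)"
      by (intro DERIV_minus DERIV_chain2[OF antideriv_deriv[OF s] sol_deriv])
    moreover have "- (weight height (sol r) * sol' r) = c * potential (sol r)"
      using slope_weight[OF sol_range[of r]] r by (simp add: sol'_def mult.commute)
    ultimately show "((\<lambda>r. - antideriv height (sol r)) has_vector_derivative c * potential (sol r)) (at r)"
      by (simp add: has_real_derivative_iff_has_vector_derivative)
  qed (use radius_pos in simp)
  then have "integral {0..radius} (\<lambda>r. c * potential (sol r)) = antideriv height height"
    unfolding boundary by (rule integral_unique)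
  then show ?thesis
    using antideriv_end[OF height_pos] unfolding potential_sol_integral c_def[symmetric] by simp
qed

end

section \<open>Smooth functions\<close>

definition smooth_real :: "(real \<Rightarrow> real) \<Rightarrow> bool"
  where "smooth_real f \<longleftrightarrow> (\<forall>n x. (deriv ^^ n) f differentiable (at x))"

text \<open>Replaces formulas for the n-th derivative: it suffices to find a class of differentiable
  functions that contains \<open>f\<close> and is closed under \<open>deriv\<close>.\<close>

lemma smooth_real_coinduct:
  assumes "f \<in> S" and "\<And>f x. f \<in> S \<Longrightarrow> f differentiable (at x)" and "\<And>f. f \<in> S \<Longrightarrow> deriv f \<in> S"
  shows "smooth_real f"
proof -
  have "(deriv ^^ n) f \<in> S" for n
    by (induction n) (use assms in auto)
  then show ?thesis using assms(2) by (auto simp: smooth_real_def)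
qed

lemma smooth_real_differentiable: "smooth_real f \<Longrightarrow> f differentiable (at x)"
  unfolding smooth_real_def by (metis funpow_0)

lemma smooth_real_deriv: "smooth_real f \<Longrightarrow> smooth_real (deriv f)"
  unfolding smooth_real_def by (metis funpow_Suc_right comp_apply)

lemma smooth_real_has_deriv: "smooth_real f \<Longrightarrow> (f has_real_derivative deriv f x) (at x)"
  using smooth_real_differentiable DERIV_deriv_iff_real_differentiable by blast

lemma smooth_real_antideriv:
  assumes f: "\<And>x. (f has_real_derivative g x) (at x)" and g: "smooth_real g"
  shows "smooth_real f"
proof -
  have d: "deriv f = g" using f by (auto simp: DERIV_imp_deriv fun_eq_iff)
  show ?thesis unfolding smooth_real_def
  proof (intro allI)
    fix n x
    show "(deriv ^^ n) f differentiable (at x)"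
    proof (cases n)
      case 0
      then show ?thesis using f by (auto simp: real_differentiable_def)
    next
      case (Suc k)
      then show ?thesis
        using g d by (simp add: smooth_real_def funpow_Suc_right del: funpow.simps)
    qed
  qed
qed

lemma smooth_real_add:
  assumes "smooth_real f" "smooth_real g"
  shows "smooth_real (\<lambda>x. f x + g x)"
proof (rule smooth_real_coinduct[where S="{\<lambda>x. f x + g x | f g. smooth_real f \<and> smooth_real g}"])
  fix h assume "h \<in> {\<lambda>x. f x + g x | f g. smooth_real f \<and> smooth_real g}"
  then obtain f g where h: "h = (\<lambda>x. f x + g x)" and fg: "smooth_real f" "smooth_real g" by auto
  have d: "(h has_real_derivative deriv f x + deriv g x) (at x)" for x
    unfolding h using fg by (intro DERIV_add smooth_real_has_deriv)
  then show "h differentiable (at x)" for x by (auto simp: real_differentiable_def)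
  have "deriv h = (\<lambda>x. deriv f x + deriv g x)"
    using d by (auto simp: DERIV_imp_deriv fun_eq_iff)
  then show "deriv h \<in> {\<lambda>x. f x + g x | f g. smooth_real f \<and> smooth_real g}"
    using fg smooth_real_deriv by blast
qed (use assms in blast)

lemma smooth_real_affine:
  assumes "smooth_real f"
  shows "smooth_real (\<lambda>x. c * f (k * x + d))"
proof (rule smooth_real_coinduct[where S="{\<lambda>x. c * f (k * x + d) | c f. smooth_real f}"])
  fix h assume "h \<in> {\<lambda>x. c * f (k * x + d) | c f. smooth_real f}"
  then obtain c f where h: "h = (\<lambda>x. c * f (k * x + d))" and f: "smooth_real f" by auto
  have d: "(h has_real_derivative (c * k) * deriv f (k * x + d)) (at x)" for x
  proof -
    have "((\<lambda>x. f (k * x + d)) has_real_derivative deriv f (k * x + d) * k) (at x)"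
      by (rule DERIV_chain2[where g="\<lambda>x. k * x + d", OF smooth_real_has_deriv[OF f]])
         (auto intro!: derivative_eq_intros)
    from DERIV_cmult[OF this, of c] show ?thesis unfolding h by (simp add: mult_ac)
  qed
  then show "h differentiable (at x)" for x by (auto simp: real_differentiable_def)
  have "deriv h = (\<lambda>x. (c * k) * deriv f (k * x + d))"
    using d by (auto simp: DERIV_imp_deriv fun_eq_iff)
  then show "deriv h \<in> {\<lambda>x. c * f (k * x + d) | c f. smooth_real f}"
    using f smooth_real_deriv by blast
qed (use assms in blast)

text \<open>The numerator polynomial and the power \<open>k\<close> are there so that the family is
  closed under differentiation; \<open>bump 1 0\<close> is the standard bump on the unit
  interval.\<close>

definition bump :: "real poly \<Rightarrow> nat \<Rightarrow> real \<Rightarrow> real"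
  where "bump P k x = (if 0 < x \<and> x < 1
     then poly P x * inverse (x * (1 - x)) ^ k * exp (- inverse (x * (1 - x))) else 0)"

text \<open>Put \<open>y = x * (1 - x)\<close>. A single term of the exponential series bounds
  \<open>exp (inverse y)\<close> below by \<open>inverse y ^ (k + 2) / fact (k + 2)\<close>. What
  remains is of order \<open>y\<^sup>2\<close>, and \<open>y\<close> is at most \<open>x\<close> and
  at most \<open>1 - x\<close>. A quadratic bound gives derivative 0 at the two gluing
  points.\<close>

lemma bump_bound: "\<exists>C. \<forall>x. \<bar>bump P k x\<bar> \<le> C * x\<^sup>2 \<and> \<bar>bump P k x\<bar> \<le> C * (x - 1)\<^sup>2"
proof -
  have "compact (poly P ` {0..1})"
    by (intro compact_continuous_image continuous_intros) auto
  then obtain B where B: "\<And>x. x \<in> {0..1} \<Longrightarrow> \<bar>poly P x\<bar> \<le> B"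
    by (meson compact_imp_bounded bounded_real imageI)
  define C where "C = B * fact (k + 2)"
  have B0: "0 \<le> B" using B[of 0] by auto
  have "\<bar>bump P k x\<bar> \<le> C * x\<^sup>2 \<and> \<bar>bump P k x\<bar> \<le> C * (x - 1)\<^sup>2" for x
  proof (cases "0 < x \<and> x < 1")
    case True
    define y where "y = x * (1 - x)"
    have y: "0 < y" "y \<le> x" "y \<le> 1 - x"
      using True mult_left_le[of "1 - x" x] mult_left_le[of x "1 - x"] by (auto simp: y_def mult.commute)
    have "inverse y ^ (k + 2) / fact (k + 2) \<le> exp (inverse y)"
    proof -
      have "(\<Sum>n\<in>{k+2}. inverse y ^ n /\<^sub>R fact n) \<le> exp (inverse y)"
        unfolding exp_def
        by (rule sum_le_suminf) (use y summable_exp[of "inverse y"] in auto)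
      then show ?thesis by (simp add: divide_inverse mult.commute)
    qed
    then have le: "inverse y ^ (k + 2) \<le> fact (k + 2) * exp (inverse y)"
      by (subst (asm) pos_divide_le_eq) (simp_all only: fact_gt_zero mult.commute)
    have "inverse y ^ k * exp (- inverse y) = inverse y ^ (k + 2) * (y\<^sup>2 * exp (- inverse y))"
      using y by (simp add: power_add power2_eq_square, simp add: field_simps)
    also have "\<dots> \<le> (fact (k + 2) * exp (inverse y)) * (y\<^sup>2 * exp (- inverse y))"
      by (rule mult_right_mono[OF le]) simp
    also have "\<dots> = fact (k + 2) * y\<^sup>2"
      by (simp only: exp_minus) (simp only: mult_ac, simp)
    finally have "inverse y ^ k * exp (- inverse y) \<le> fact (k + 2) * y\<^sup>2" .
    then have "\<bar>poly P x\<bar> * (inverse y ^ k * exp (- inverse y)) \<le> B * (fact (k + 2) * y\<^sup>2)"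
      by (rule mult_mono[rotated 1]) (use B[of x] B0 True y in auto)
    moreover have "\<bar>bump P k x\<bar> = \<bar>poly P x\<bar> * (inverse y ^ k * exp (- inverse y))"
      using True y by (simp add: bump_def y_def abs_mult)
    ultimately have "\<bar>bump P k x\<bar> \<le> C * y\<^sup>2"
      by (simp add: C_def mult.assoc)
    moreover have "C * y\<^sup>2 \<le> C * x\<^sup>2" "C * y\<^sup>2 \<le> C * (1 - x)\<^sup>2"
      using y B0 by (auto intro!: mult_left_mono power_mono simp: C_def)
    ultimately show ?thesis by (simp add: power2_commute)
  next
    case False
    then show ?thesis using B0 by (auto simp: bump_def C_def)
  qed
  then show ?thesis by blast
qed

text \<open>With \<open>y = x * (1 - x)\<close>, whose derivative is \<open>1 - 2 * x\<close>, this
  is the numerator left after taking \<open>inverse y ^ (k + 2)\<close> out of the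
  derivative.\<close>

definition bump_poly' :: "real poly \<Rightarrow> nat \<Rightarrow> real poly"
  where "bump_poly' P k = pderiv P * [:0, 1, -1:]\<^sup>2 - smult (real k) (P * [:1, -2:] * [:0, 1, -1:]) + P * [:1, -2:]"

lemma bump_deriv: "(bump P k has_real_derivative bump (bump_poly' P k) (k + 2) x) (at x)"
proof -
  consider "0 < x \<and> x < 1" | "x < 0 \<or> 1 < x" | "x = 0 \<or> x = 1" by linarith
  then show ?thesis
  proof cases
    case 1
    define y where "y = x * (1 - x)"
    have y: "0 < y" using 1 by (simp add: y_def)
    have "((\<lambda>x. poly P x * inverse (x * (1 - x)) ^ k * exp (- inverse (x * (1 - x)))) has_real_derivative
        bump (bump_poly' P k) (k + 2) x) (at x)"
    proof -
      have dy: "((\<lambda>x. x * (1 - x)) has_real_derivative (1 - 2 * x)) (at x)"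
        by (auto intro!: derivative_eq_intros)
      have di: "((\<lambda>x. inverse (x * (1 - x))) has_real_derivative - ((1 - 2 * x) * (inverse y)\<^sup>2)) (at x)"
        using DERIV_inverse_fun[OF dy] 1 by (simp add: y_def power2_eq_square)
      have dk: "((\<lambda>x. inverse (x * (1 - x)) ^ k) has_real_derivative
          - (real k * inverse y ^ k * inverse y * (1 - 2 * x))) (at x)"
      proof (cases k)
        case (Suc j)
        from DERIV_power[OF di, of k] show ?thesis
          unfolding Suc y_def[symmetric] by (simp add: power2_eq_square mult_ac)
      qed simp
      have de: "((\<lambda>x. exp (- inverse (x * (1 - x)))) has_real_derivative
          exp (- inverse y) * ((1 - 2 * x) * (inverse y)\<^sup>2)) (at x)"
        unfolding y_def using DERIV_chain2[where f=exp, OF DERIV_exp DERIV_minus[OF di]]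
        by (simp add: y_def)
      have "((\<lambda>x. poly P x * inverse (x * (1 - x)) ^ k * exp (- inverse (x * (1 - x)))) has_real_derivative
        (poly (pderiv P) x * inverse y ^ k + - (real k * inverse y ^ k * inverse y * (1 - 2 * x)) * poly P x) * exp (- inverse y) +
        (exp (- inverse y) * ((1 - 2 * x) * (inverse y)\<^sup>2)) * (poly P x * inverse y ^ k)) (at x)"
        unfolding y_def using DERIV_mult[OF DERIV_mult[OF poly_DERIV dk] de] by (simp add: y_def)
      moreover have "bump (bump_poly' P k) (k + 2) x =
        (poly (pderiv P) x * inverse y ^ k + - (real k * inverse y ^ k * inverse y * (1 - 2 * x)) * poly P x) * exp (- inverse y) +
        (exp (- inverse y) * ((1 - 2 * x) * (inverse y)\<^sup>2)) * (poly P x * inverse y ^ k)"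
      proof -
        have "poly (bump_poly' P k) x = poly (pderiv P) x * y\<^sup>2 - real k * (poly P x * (1 - 2 * x) * y) + poly P x * (1 - 2 * x)"
          by (simp add: bump_poly'_def y_def algebra_simps)
        then have "bump (bump_poly' P k) (k + 2) x =
           (poly (pderiv P) x * y\<^sup>2 - real k * (poly P x * (1 - 2 * x) * y) + poly P x * (1 - 2 * x))
           * (inverse y ^ k * (inverse y * inverse y)) * exp (- inverse y)"
          using 1 by (simp add: bump_def y_def power_add power2_eq_square)
        also have "\<dots> = (poly (pderiv P) x * inverse y ^ k + - (real k * inverse y ^ k * inverse y * (1 - 2 * x)) * poly P x) * exp (- inverse y) +
        (exp (- inverse y) * ((1 - 2 * x) * (inverse y)\<^sup>2)) * (poly P x * inverse y ^ k)"
        proof -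
          have yy: "y * inverse y = 1" using y by simp
          have "(a * y\<^sup>2 - c * (b * z * y) + b * z) * (Y * (i * i)) * e
            = (a * Y + - (c * Y * i * z) * b) * e + (e * (z * i\<^sup>2)) * (b * Y)"
            if "y * i = 1" for a b c z Y e i :: real
          proof -
            have "(a * y\<^sup>2 - c * (b * z * y) + b * z) * (Y * (i * i)) * e
              = (a * Y * (y * i)\<^sup>2 + - (c * Y * i * z) * b * (y * i)) * e + (e * (z * i\<^sup>2)) * (b * Y)"
              by (simp add: algebra_simps power2_eq_square)
            then show ?thesis by (simp add: that)
          qed
          from this[OF yy] show ?thesis .
        qed
        finally show ?thesis .
      qed
      ultimately show ?thesis by simp
    qed
    then show ?thesis
      by (rule has_field_derivative_transform_within_open[of _ _ _ "{0<..<1}"]) (use 1 in \<open>auto simp: bump_def\<close>)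
  next
    case 2
    have "((\<lambda>x. 0) has_real_derivative 0) (at x)" by simp
    then have "(bump P k has_real_derivative 0) (at x)"
      by (rule has_field_derivative_transform_within_open[of _ _ _ "{..<0} \<union> {1<..}"]) (use 2 in \<open>auto simp: bump_def\<close>)
    then show ?thesis using 2 by (auto simp: bump_def)
  next
    case 3
    obtain C where C: "\<And>x. \<bar>bump P k x\<bar> \<le> C * x\<^sup>2" "\<And>x. \<bar>bump P k x\<bar> \<le> C * (x - 1)\<^sup>2"
      using bump_bound[of P k] by blast
    have b: "\<bar>bump P k (x + h)\<bar> \<le> C * h\<^sup>2" for h
      using C[of "x + h"] 3 by auto
    have "bump P k x = 0" using 3 by (auto simp: bump_def)
    have "((\<lambda>h. C * \<bar>h\<bar>) \<longlongrightarrow> C * \<bar>0\<bar>) (at 0)"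
      by (intro tendsto_intros)
    then have lim: "((\<lambda>h. C * \<bar>h\<bar>) \<longlongrightarrow> 0) (at 0)" by simp
    have "((\<lambda>h. (bump P k (x + h) - bump P k x) / h) \<longlongrightarrow> 0) (at 0)"
    proof (rule Lim_null_comparison[OF _ lim])
      show "\<forall>\<^sub>F h in at 0. norm ((bump P k (x + h) - bump P k x) / h) \<le> C * \<bar>h\<bar>"
        unfolding eventually_at_filter
      proof (intro always_eventually allI impI)
        fix h :: real assume "h \<noteq> 0"
        then have "\<bar>bump P k (x + h)\<bar> / \<bar>h\<bar> \<le> C * h\<^sup>2 / \<bar>h\<bar>"
          using b by (intro divide_right_mono) auto
        also have "\<dots> = C * \<bar>h\<bar>"
          using \<open>h \<noteq> 0\<close> by (simp add: power2_eq_square abs_if)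
        finally show "norm ((bump P k (x + h) - bump P k x) / h) \<le> C * \<bar>h\<bar>"
          using \<open>bump P k x = 0\<close> by simp
      qed
    qed
    then show ?thesis using 3 by (auto simp: DERIV_def bump_def)
  qed
qed

lemma bump_smooth: "smooth_real (bump P k)"
proof (rule smooth_real_coinduct[where S="{bump P k | P k. True}"])
  fix f x assume "f \<in> {bump P k | P k. True}"
  then obtain P k where f: "f = bump P k" by blast
  show "f differentiable (at x)"
    unfolding f using bump_deriv real_differentiable_def by blast
  have "deriv f = bump (bump_poly' P k) (k + 2)"
    unfolding f using bump_deriv by (auto simp: DERIV_imp_deriv fun_eq_iff)
  then show "deriv f \<in> {bump P k | P k. True}" by blast
qed auto

lemma antiderivative_real:
  fixes f :: "real \<Rightarrow> real"
  assumes f: "continuous_on UNIV f"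
  obtains g where "g 0 = 0" "\<And>x. (g has_real_derivative f x) (at x)"
proof -
  define g where "g x = (if 0 \<le> x then integral {0..x} f else - integral {x..0} f)" for x
  have "(g has_real_derivative f x) (at x)" for x
  proof -
    define N where "N = \<bar>x\<bar> + 1"
    have x: "x \<in> {-N..N}" "0 \<le> N" by (auto simp: N_def)
    have cont: "continuous_on {-N..N} f" using f by (rule continuous_on_subset) simp
    have "((\<lambda>y. integral {-N..y} f - integral {-N..0} f) has_real_derivative f x - 0) (at x within {-N..N})"
      by (intro DERIV_diff integral_has_real_derivative[OF cont x(1)] DERIV_const)
    moreover have "at x within {-N..N} = at x"
      by (rule at_within_interior) (auto simp: N_def interior_atLeastAtMost_real)
    ultimately have d: "((\<lambda>y. integral {-N..y} f - integral {-N..0} f) has_real_derivative f x) (at x)"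
      by simp
    have int: "f integrable_on {-N..N}" using cont by (rule integrable_continuous_real)
    show ?thesis
    proof (rule has_field_derivative_transform_within_open[OF d, of "{-N<..<N}"])
      fix y assume y: "y \<in> {-N<..<N}"
      show "integral {-N..y} f - integral {-N..0} f = g y"
      proof (cases "0 \<le> y")
        case True
        have "integral {-N..0} f + integral {0..y} f = integral {-N..y} f"
          using y True by (intro Henstock_Kurzweil_Integration.integral_combine integrable_subinterval_real[OF int]) auto
        then show ?thesis using True by (simp add: g_def)
      next
        case False
        have "integral {-N..y} f + integral {y..0} f = integral {-N..0} f"
          using y False by (intro Henstock_Kurzweil_Integration.integral_combine integrable_subinterval_real[OF int]) auto
        then show ?thesis using False by (simp add: g_def)
      qed
    qed (auto simp: N_def)
  qed
  moreover have "g 0 = 0" by (simp add: g_def)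
  ultimately show ?thesis using that by blast
qed

lemma zero_derivative_constant_on:
  fixes f :: "real \<Rightarrow> real"
  assumes "convex S" "\<And>x. x \<in> S \<Longrightarrow> (f has_real_derivative 0) (at x)" "x \<in> S" "y \<in> S"
  shows "f x = f y"
proof -
  have "\<exists>c. \<forall>x\<in>S. f x = c"
    by (rule has_field_derivative_zero_constant[OF assms(1)])
       (rule has_field_derivative_at_within[OF assms(2)])
  then show ?thesis using assms(3,4) by auto
qed

text \<open>\<open>\<Theta>\<close> is the normalised primitive of a bump, a smooth step, and
  \<open>\<rho>\<close> is the primitive of \<open>\<Theta>\<close>. The rescaled ramps
  \<open>\<rho> (n * x) / n\<close> converge to \<open>max 0 x\<close>, and all their corners are
  smooth.\<close>

lemma smooth_ramp_exists:
  obtains \<rho> \<Theta> :: "real \<Rightarrow> real" and c where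
    "\<And>x. (\<rho> has_real_derivative \<Theta> x) (at x)" "smooth_real \<rho>" "continuous_on UNIV \<Theta>"
    "\<And>x. 0 \<le> \<Theta> x \<and> \<Theta> x \<le> 1" "\<And>x. x \<le> 0 \<Longrightarrow> \<Theta> x = 0 \<and> \<rho> x = 0"
    "\<And>x. 1 \<le> x \<Longrightarrow> \<Theta> x = 1 \<and> \<rho> x = x - c" "\<And>x. \<bar>\<rho> x\<bar> \<le> \<bar>x\<bar>"
proof -
  define b where "b = bump 1 0"
  have b0: "0 \<le> b x" for x by (simp add: b_def bump_def)
  have bpos: "0 < b x" if "0 < x" "x < 1" for x using that by (simp add: b_def bump_def)
  have bz: "b x = 0" if "x \<le> 0 \<or> 1 \<le> x" for x using that by (auto simp: b_def bump_def)
  have bs: "smooth_real b" unfolding b_def by (rule bump_smooth)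
  have contb: "continuous_on UNIV b"
    by (rule DERIV_continuous_on) (rule has_field_derivative_at_within[OF smooth_real_has_deriv[OF bs]])
  obtain T where T0: "T 0 = 0" and T: "\<And>x. (T has_real_derivative b x) (at x)"
    using antiderivative_real[OF contb] by blast
  have contT: "continuous_on UNIV T"
    by (rule DERIV_continuous_on) (rule has_field_derivative_at_within[OF T])
  have "T 0 < T 1"
    by (rule DERIV_pos_imp_increasing_open)
       (use T bpos in \<open>auto intro: continuous_on_subset[OF contT]\<close>)
  then have T1: "0 < T 1" by (simp add: T0)
  define \<Theta> where "\<Theta> x = T x / T 1" for x
  have \<Theta>': "(\<Theta> has_real_derivative (1 / T 1) * b (1 * x + 0)) (at x)" for x
    unfolding \<Theta>_def[abs_def] using DERIV_cdivide[OF T[of x], of "T 1"] by simp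
  have \<Theta>smooth: "smooth_real \<Theta>"
    by (rule smooth_real_antideriv[OF \<Theta>']) (rule smooth_real_affine[OF bs])
  have \<Theta>cont: "continuous_on UNIV \<Theta>"
    by (rule DERIV_continuous_on) (rule has_field_derivative_at_within[OF \<Theta>'])
  have \<Theta>mono: "\<Theta> x \<le> \<Theta> y" if "x \<le> y" for x y
  proof (rule DERIV_nonneg_imp_nondecreasing[OF that])
    fix z
    have "0 \<le> (1 / T 1) * b (1 * z + 0)" using T1 b0 by simp
    with \<Theta>'[of z] show "\<exists>d. (\<Theta> has_real_derivative d) (at z) \<and> 0 \<le> d" by blast
  qed
  have d0: "(\<Theta> has_real_derivative 0) (at x)" if "x \<le> 0 \<or> 1 \<le> x" for x
    using \<Theta>'[of x] bz[OF that] by simp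
  have \<Theta>low: "\<Theta> x = 0" if "x \<le> 0" for x
  proof -
    have "\<Theta> x = \<Theta> 0"
      by (rule zero_derivative_constant_on[of "{..0}"]) (use d0 that in auto)
    then show ?thesis by (simp add: \<Theta>_def T0)
  qed
  have \<Theta>high: "\<Theta> x = 1" if "1 \<le> x" for x
  proof -
    have "\<Theta> x = \<Theta> 1"
      by (rule zero_derivative_constant_on[of "{1..}"]) (use d0 that in auto)
    then show ?thesis using T1 by (simp add: \<Theta>_def)
  qed
  have \<Theta>01: "0 \<le> \<Theta> x \<and> \<Theta> x \<le> 1" for x
    using \<Theta>mono[of x 0] \<Theta>mono[of 0 x] \<Theta>mono[of x 1] \<Theta>mono[of 1 x] \<Theta>low[of 0] \<Theta>low[of x] \<Theta>high[of 1] \<Theta>high[of x]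
    by linarith
  obtain \<rho> where \<rho>0: "\<rho> 0 = 0" and \<rho>: "\<And>x. (\<rho> has_real_derivative \<Theta> x) (at x)"
    using antiderivative_real[OF \<Theta>cont] by blast
  have \<rho>low: "\<rho> x = 0" if "x \<le> 0" for x
  proof -
    have "(\<rho> has_real_derivative 0) (at z)" if "z \<in> {..0}" for z
      using \<rho>[of z] \<Theta>low[of z] that by simp
    from zero_derivative_constant_on[of "{..0}", OF _ this, of x 0] that show ?thesis
      by (simp add: \<rho>0)
  qed
  have \<rho>high: "\<rho> x = x - (1 - \<rho> 1)" if "1 \<le> x" for x
  proof -
    have "((\<lambda>x. \<rho> x - x) has_real_derivative 0) (at x)" if "x \<in> {1..}" for x
      using DERIV_diff[OF \<rho> DERIV_ident, of x] \<Theta>high[of x] that by simp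
    from zero_derivative_constant_on[of "{1..}", OF _ this, of x 1] that show ?thesis by simp
  qed
  have \<rho>bound: "\<bar>\<rho> x\<bar> \<le> \<bar>x\<bar>" for x
  proof (cases "x \<le> 0")
    case False
    then have x: "0 \<le> x" by simp
    have "\<rho> 0 \<le> \<rho> x"
      by (rule DERIV_nonneg_imp_nondecreasing[OF x]) (use \<rho> \<Theta>01 in blast)
    moreover have "(\<lambda>x. x - \<rho> x) 0 \<le> (\<lambda>x. x - \<rho> x) x"
    proof (rule DERIV_nonneg_imp_nondecreasing[OF x])
      show "\<exists>y. ((\<lambda>x. x - \<rho> x) has_real_derivative y) (at x) \<and> 0 \<le> y" for x
        using DERIV_diff[OF DERIV_ident \<rho>, of x] \<Theta>01[of x] by auto
    qed
    ultimately show ?thesis using x \<rho>0 by simp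
  qed (simp add: \<rho>low)
  show ?thesis
  proof (rule that[OF \<rho> smooth_real_antideriv[OF \<rho> \<Theta>smooth] \<Theta>cont \<Theta>01])
    show "\<Theta> x = 0 \<and> \<rho> x = 0" if "x \<le> 0" for x
      using \<Theta>low[OF that] \<rho>low[OF that] by blast
    show "\<Theta> x = 1 \<and> \<rho> x = x - (1 - \<rho> 1)" if "1 \<le> x" for x
      using \<Theta>high[OF that] \<rho>high[OF that] by blast
  qed (rule \<rho>bound)
qed

section \<open>Weak derivatives on the line\<close>

lemma smooth_real_sum:
  assumes "finite I" "\<And>i. i \<in> I \<Longrightarrow> smooth_real (f i)"
  shows "smooth_real (\<lambda>x. \<Sum>i\<in>I. f i x)"
  using assms
proof (induction I)
  case empty
  have "smooth_real (\<lambda>x. 0 * bump 1 0 (1 * x + 0))"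
    by (rule smooth_real_affine[OF bump_smooth])
  then show ?case by simp
next
  case (insert i I)
  then show ?case using smooth_real_add[of "f i" "\<lambda>x. \<Sum>i\<in>I. f i x"] by simp
qed

lemma set_integrable_bounded_mult:
  fixes f h :: "real \<Rightarrow> real"
  assumes f: "set_integrable lebesgue S f" and "S \<in> sets lebesgue" and h: "h \<in> borel_measurable borel"
    and B: "\<And>x. x \<in> S \<Longrightarrow> \<bar>h x\<bar> \<le> B"
  shows "set_integrable lebesgue S (\<lambda>x. f x * h x)"
  unfolding set_integrable_def
proof (rule Bochner_Integration.integrable_bound)
  show "integrable lebesgue (\<lambda>x. B * (indicator S x *\<^sub>R f x))"
    using f unfolding set_integrable_def by simp
  have "(\<lambda>x. indicator S x *\<^sub>R f x) \<in> borel_measurable lebesgue"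
    using f unfolding set_integrable_def by auto
  moreover have "h \<in> borel_measurable lebesgue"
    using h by (intro measurable_completion) simp
  ultimately have "(\<lambda>x. indicator S x *\<^sub>R f x * h x) \<in> borel_measurable lebesgue"
    by (rule borel_measurable_times)
  then show "(\<lambda>x. indicator S x *\<^sub>R (f x * h x)) \<in> borel_measurable lebesgue"
    by (simp add: mult.assoc)
  show "AE x in lebesgue. norm (indicator S x *\<^sub>R (f x * h x)) \<le> norm (B * (indicator S x *\<^sub>R f x))"
  proof (rule AE_I2)
    fix x
    show "norm (indicator S x *\<^sub>R (f x * h x)) \<le> norm (B * (indicator S x *\<^sub>R f x))"
    proof (cases "x \<in> S")
      case True
      then have "\<bar>h x\<bar> \<le> \<bar>B\<bar>" using B[of x] by linarith
      then show ?thesis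
        using True by (simp add: abs_mult) (metis abs_ge_zero mult.commute mult_left_mono)
    qed simp
  qed
qed

text \<open>
  Both sides are limits of the defining identity of the weak derivative, tested with smooth
  approximations of the piecewise linear function \<open>\<Sum>i\<in>I. c i * max 0 (a i - x)\<close>, which has compact support because of the
  two moment conditions.
\<close>

lemma weak_derivative_piecewise_linear:
  fixes a c :: "'i \<Rightarrow> real"
  assumes weak: "has_weak_derivative u g" and I: "finite I"
    and c0: "(\<Sum>i\<in>I. c i) = 0" and c1: "(\<Sum>i\<in>I. c i * a i) = 0"
    and aL: "\<And>i. i \<in> I \<Longrightarrow> L + 1 \<le> a i"
  shows "(\<Sum>i\<in>I. c i * (LINT x:{L..a i}|lebesgue. u x)) =
         (\<Sum>i\<in>I. c i * (LINT x:{L..a i}|lebesgue. g x * (a i - x)))"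
proof -
  obtain \<rho> \<Theta> :: "real \<Rightarrow> real" and \<gamma> where
    \<rho>: "\<And>x. (\<rho> has_real_derivative \<Theta> x) (at x)" "smooth_real \<rho>" "continuous_on UNIV \<Theta>"
    and \<Theta>01: "\<And>x. 0 \<le> \<Theta> x \<and> \<Theta> x \<le> 1"
    and low: "\<And>x. x \<le> 0 \<Longrightarrow> \<Theta> x = 0 \<and> \<rho> x = 0"
    and high: "\<And>x. 1 \<le> x \<Longrightarrow> \<Theta> x = 1 \<and> \<rho> x = x - \<gamma>"
    and \<rho>bound: "\<And>x. \<bar>\<rho> x\<bar> \<le> \<bar>x\<bar>"
    using smooth_ramp_exists by metis
  obtain U where U: "\<And>i. i \<in> I \<Longrightarrow> a i \<le> U" and LU: "L \<le> U"
  proof -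
    obtain U0 where U0: "\<And>i. i \<in> I \<Longrightarrow> a i \<le> U0"
      using I by (metis finite_imageI Max_ge imageI)
    show ?thesis by (rule that[of "max U0 L"]) (use U0 in \<open>auto simp: max.coboundedI1\<close>)
  qed
  have intu: "set_integrable lebesgue {s..t} u" and intg: "set_integrable lebesgue {s..t} g" for s t
    using weak by (auto simp: has_weak_derivative_def locally_integrable_def)
  define C where "C = (\<Sum>i\<in>I. \<bar>c i\<bar>)"
  \<comment> \<open>Rescaling moves the smoothing of the corner at \<open>a i\<close> into an
    interval of length \<open>1 / real (Suc n)\<close>; \<open>\<psi> n\<close> is the derivative of
    \<open>\<phi> n\<close>. Taking \<open>Suc n\<close> keeps the scale at least 1.\<close>
  define \<phi> where "\<phi> n x = (\<Sum>i\<in>I. c i / real (Suc n) * \<rho> (- real (Suc n) * x + real (Suc n) * a i))" for n x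
  define \<psi> where "\<psi> n x = (\<Sum>i\<in>I. - c i * \<Theta> (real (Suc n) * (a i - x)))" for n x
  have \<phi>': "(\<phi> n has_real_derivative \<psi> n x) (at x)" for n x
    unfolding \<phi>_def[abs_def] \<psi>_def
  proof (rule DERIV_sum)
    fix i
    have "((\<lambda>x. \<rho> (- real (Suc n) * x + real (Suc n) * a i)) has_real_derivative
        \<Theta> (- real (Suc n) * x + real (Suc n) * a i) * - real (Suc n)) (at x)"
      by (rule DERIV_chain2[where f=\<rho>, OF \<rho>(1)]) (auto intro!: derivative_eq_intros)
    from DERIV_cmult[OF this, of "c i / real (Suc n)"]
    show "((\<lambda>x. c i / real (Suc n) * \<rho> (- real (Suc n) * x + real (Suc n) * a i)) has_real_derivative
        - c i * \<Theta> (real (Suc n) * (a i - x))) (at x)"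
      by (simp add: right_diff_distrib del: of_nat_Suc)
  qed
  have \<phi>high: "\<phi> n x = 0 \<and> \<psi> n x = 0" if "U \<le> x" for n x
  proof -
    have "real (Suc n) * (a i - x) \<le> 0" if "i \<in> I" for i
      using U[OF that] \<open>U \<le> x\<close> by (intro mult_nonneg_nonpos) auto
    then have "\<rho> (real (Suc n) * (a i - x)) = 0" "\<Theta> (real (Suc n) * (a i - x)) = 0" if "i \<in> I" for i
      using low that by auto
    then show ?thesis
      by (simp add: \<phi>_def \<psi>_def right_diff_distrib del: of_nat_Suc)
  qed
  \<comment> \<open>To the left of \<open>L\<close> every node is at distance at least 1, so all
    ramps are in their affine part. There \<open>c0\<close> cancels the terms in \<open>x\<close>
    and \<open>\<gamma>\<close>, and \<open>c1\<close> the terms \<open>c i * a i\<close>.\<close>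
  have \<phi>low: "\<phi> n x = 0 \<and> \<psi> n x = 0" if "x \<le> L" for n x
  proof -
    have "1 \<le> real (Suc n) * (a i - x)" if "i \<in> I" for i
    proof -
      have "1 * 1 \<le> real (Suc n) * (a i - x)"
        using aL[OF that] \<open>x \<le> L\<close> by (intro mult_mono) auto
      then show ?thesis by simp
    qed
    then have r: "\<rho> (real (Suc n) * (a i - x)) = real (Suc n) * (a i - x) - \<gamma>"
      "\<Theta> (real (Suc n) * (a i - x)) = 1" if "i \<in> I" for i
      using high that by auto
    have "\<phi> n x = (\<Sum>i\<in>I. c i / real (Suc n) * (real (Suc n) * (a i - x) - \<gamma>))"
      unfolding \<phi>_def using r(1) by (intro sum.cong) (auto simp: right_diff_distrib simp del: of_nat_Suc)
    also have "\<dots> = (\<Sum>i\<in>I. c i * a i - c i * (x + \<gamma> / real (Suc n)))"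
      by (intro sum.cong) (auto simp: field_simps simp del: of_nat_Suc)
    also have "\<dots> = 0"
      by (simp add: sum_subtractf c1 sum_distrib_right[symmetric] c0)
    finally have "\<phi> n x = 0" .
    moreover have "\<psi> n x = 0"
      unfolding \<psi>_def using r(2) c0 by (simp add: sum_negf)
    ultimately show ?thesis by simp
  qed
  have out: "\<phi> n x = 0 \<and> \<psi> n x = 0" if "x \<notin> {L..U}" for n x
  proof (cases "x \<le> L")
    case False
    then have "U \<le> x" using that by simp
    then show ?thesis by (rule \<phi>high)
  qed (rule \<phi>low)
  have test: "test_function (\<phi> n)" for n
  proof -
    have "smooth_real (\<phi> n)"
      unfolding \<phi>_def[abs_def] by (intro smooth_real_sum[OF I] smooth_real_affine \<rho>(2))
    moreover have "{x. \<phi> n x \<noteq> 0} \<subseteq> {L..U}"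
      using out[where n=n] by blast
    then have "bounded {x. \<phi> n x \<noteq> 0}"
      by (rule bounded_subset[OF bounded_closed_interval])
    ultimately show ?thesis by (simp add: test_function_def smooth_real_def)
  qed
  have deriv: "deriv (\<phi> n) = \<psi> n" for n
    using \<phi>' by (auto simp: DERIV_imp_deriv fun_eq_iff)
  have identity: "(\<integral>x. u x * \<psi> n x \<partial>lebesgue) = - (\<integral>x. g x * \<phi> n x \<partial>lebesgue)" for n
    using weak test[of n] deriv[of n] unfolding has_weak_derivative_def by metis
  have cont\<phi>: "continuous_on UNIV (\<phi> n)" for n
    by (rule DERIV_continuous_on) (rule has_field_derivative_at_within[OF \<phi>'])
  have cont\<psi>: "continuous_on UNIV (\<psi> n)" for n
    unfolding \<psi>_def[abs_def]
    by (intro continuous_intros continuous_on_compose2[OF \<rho>(3)]) auto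
  have \<psi>bound: "\<bar>\<psi> n x\<bar> \<le> C" for n x
    unfolding \<psi>_def C_def
    by (rule order_trans[OF sum_abs sum_mono]) (use \<Theta>01 in \<open>auto simp: abs_mult intro!: mult_left_le\<close>)
  have \<phi>bound: "\<bar>\<phi> n x\<bar> \<le> C * (U - L)" if x: "x \<in> {L..U}" for n x
  proof -
    have "\<bar>c i / real (Suc n) * \<rho> (- real (Suc n) * x + real (Suc n) * a i)\<bar> \<le> \<bar>c i\<bar> * (U - L)" if "i \<in> I" for i
    proof -
      have "\<bar>\<rho> (real (Suc n) * (a i - x))\<bar> \<le> real (Suc n) * \<bar>a i - x\<bar>"
        using \<rho>bound[of "real (Suc n) * (a i - x)"] by (simp add: abs_mult del: of_nat_Suc)
      also have "\<dots> \<le> real (Suc n) * (U - L)"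
        using x aL[OF that] U[OF that] by (intro mult_left_mono) auto
      finally have "\<bar>\<rho> (real (Suc n) * (a i - x))\<bar> / real (Suc n) \<le> U - L"
        by (simp add: pos_divide_le_eq mult.commute del: of_nat_Suc)
      then have "\<bar>c i\<bar> * (\<bar>\<rho> (real (Suc n) * (a i - x))\<bar> / real (Suc n)) \<le> \<bar>c i\<bar> * (U - L)"
        by (rule mult_left_mono) simp
      then show ?thesis by (simp add: abs_mult right_diff_distrib del: of_nat_Suc)
    qed
    then show ?thesis
      unfolding \<phi>_def C_def sum_distrib_right by (rule order_trans[OF sum_abs sum_mono])
  qed
  define H where "H x = (\<Sum>i\<in>I. - c i * (if x < a i then 1 else 0))" for x
  define T where "T x = (\<Sum>i\<in>I. c i * max 0 (a i - x))" for x
  have large: "\<forall>\<^sub>F n in sequentially. 1 \<le> real (Suc n) * y" if "0 < y" for y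
  proof -
    obtain N where "1 / y \<le> real N" using real_arch_simple by blast
    then have "1 \<le> real (Suc n) * y" if "N \<le> n" for n
      using that \<open>0 < y\<close> by (simp add: pos_divide_le_eq) (smt (verit) mult_right_mono of_nat_mono)
    then show ?thesis by (auto simp: eventually_sequentially)
  qed
  have limH: "(\<lambda>n. \<psi> n x) \<longlonglongrightarrow> H x" for x
    unfolding \<psi>_def H_def
  proof (intro tendsto_sum tendsto_mult tendsto_const)
    fix i
    show "(\<lambda>n. \<Theta> (real (Suc n) * (a i - x))) \<longlonglongrightarrow> (if x < a i then 1 else 0)"
    proof (cases "x < a i")
      case True
      then have pos: "0 < a i - x" by simp
      have "\<forall>\<^sub>F n in sequentially. \<Theta> (real (Suc n) * (a i - x)) = 1"
        using large[OF pos] by (auto elim!: eventually_mono simp: high simp del: of_nat_Suc)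
      then show ?thesis using True by (simp add: tendsto_eventually del: of_nat_Suc)
    next
      case False
      then have "\<Theta> (real (Suc n) * (a i - x)) = 0" for n
        using low[of "real (Suc n) * (a i - x)"] by (simp add: mult_nonneg_nonpos)
      then show ?thesis using False by simp
    qed
  qed
  have limT: "(\<lambda>n. \<phi> n x) \<longlonglongrightarrow> T x" for x
    unfolding \<phi>_def T_def
  proof (intro tendsto_sum)
    fix i
    show "(\<lambda>n. c i / real (Suc n) * \<rho> (- real (Suc n) * x + real (Suc n) * a i)) \<longlonglongrightarrow> c i * max 0 (a i - x)"
    proof (cases "x < a i")
      case True
      then have pos: "0 < a i - x" by simp
      have ev: "\<forall>\<^sub>F n in sequentially. c i * ((a i - x) - \<gamma> / real (Suc n)) =
          c i / real (Suc n) * \<rho> (- real (Suc n) * x + real (Suc n) * a i)"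
        using large[OF pos]
      proof (eventually_elim)
        case (elim n)
        then have "\<rho> (real (Suc n) * (a i - x)) = real (Suc n) * (a i - x) - \<gamma>"
          using high True by simp
        then have "\<rho> (- real (Suc n) * x + real (Suc n) * a i) = real (Suc n) * (a i - x) - \<gamma>"
          by (simp add: right_diff_distrib del: of_nat_Suc)
        moreover have "b * (d - \<gamma> / k) = b / k * (k * d - \<gamma>)" if "k \<noteq> 0" for b d k :: real
          using that by (simp add: field_simps)
        ultimately show ?case by (simp del: of_nat_Suc)
      qed
      have "(\<lambda>n. c i * ((a i - x) - \<gamma> / real (Suc n))) \<longlonglongrightarrow> c i * ((a i - x) - 0)"
        using LIMSEQ_Suc[OF lim_const_over_n[of \<gamma>]] by (intro tendsto_intros)
      then have "(\<lambda>n. c i / real (Suc n) * \<rho> (- real (Suc n) * x + real (Suc n) * a i)) \<longlonglongrightarrow> c i * ((a i - x) - 0)"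
        by (rule Lim_transform_eventually[OF _ ev])
      then show ?thesis
        using True by (simp only: max_def) (simp del: of_nat_Suc)
    next
      case False
      then have "\<rho> (real (Suc n) * (a i - x)) = 0" for n
        using low[of "real (Suc n) * (a i - x)"] by (simp add: mult_nonneg_nonpos)
      then show ?thesis using False by (simp add: right_diff_distrib max_def del: of_nat_Suc)
    qed
  qed
  \<comment> \<open>Dominated convergence with majorant
    \<open>\<bar>B\<bar> * \<bar>f x\<bar>\<close> on \<open>{L..U}\<close>, stated once for both
    sides of the identity.\<close>
  have dom: "(\<lambda>n. \<integral>x. f x * h n x \<partial>lebesgue) \<longlonglongrightarrow> (LINT x:{L..U}|lebesgue. f x * l x)"
    if f: "\<And>s t. set_integrable lebesgue {s..t} f" and h: "\<And>n. continuous_on UNIV (h n)"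
      and bound: "\<And>n x. x \<in> {L..U} \<Longrightarrow> \<bar>h n x\<bar> \<le> B" and zero: "\<And>n x. x \<notin> {L..U} \<Longrightarrow> h n x = 0"
      and lim: "\<And>x. (\<lambda>n. h n x) \<longlonglongrightarrow> l x"
    for f l :: "real \<Rightarrow> real" and h B
  proof -
    have hm: "h n \<in> borel_measurable borel" for n
      using h by (rule borel_measurable_continuous_onI)
    then have lm: "l \<in> borel_measurable borel"
      by (rule borel_measurable_LIMSEQ_metric) (rule lim)
    have lB: "\<bar>l x\<bar> \<le> B" if "x \<in> {L..U}" for x
      by (rule LIMSEQ_le_const2[OF tendsto_rabs[OF lim]]) (use bound that in auto)
    have eq: "(\<lambda>x. indicator {L..U} x *\<^sub>R (f x * h n x)) = (\<lambda>x. f x * h n x)" for n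
      using zero[of _ n] by (auto simp: fun_eq_iff indicator_def)
    have "(\<lambda>n. \<integral>x. indicator {L..U} x *\<^sub>R (f x * h n x) \<partial>lebesgue) \<longlonglongrightarrow>
        (\<integral>x. indicator {L..U} x *\<^sub>R (f x * l x) \<partial>lebesgue)"
    proof (rule integral_dominated_convergence)
      show "(\<lambda>x. indicator {L..U} x *\<^sub>R (f x * l x)) \<in> borel_measurable lebesgue"
        using set_integrable_bounded_mult[OF f _ lm lB] unfolding set_integrable_def by auto
      show "(\<lambda>x. indicator {L..U} x *\<^sub>R (f x * h n x)) \<in> borel_measurable lebesgue" for n
        using set_integrable_bounded_mult[OF f _ hm bound] unfolding set_integrable_def by auto
      show "integrable lebesgue (\<lambda>x. \<bar>B\<bar> * \<bar>indicator {L..U} x *\<^sub>R f x\<bar>)"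
        using f[of L U] unfolding set_integrable_def by simp
      show "AE x in lebesgue. (\<lambda>n. indicator {L..U} x *\<^sub>R (f x * h n x)) \<longlonglongrightarrow> indicator {L..U} x *\<^sub>R (f x * l x)"
        by (intro AE_I2 tendsto_intros lim)
      show "AE x in lebesgue. norm (indicator {L..U} x *\<^sub>R (f x * h n x)) \<le> \<bar>B\<bar> * \<bar>indicator {L..U} x *\<^sub>R f x\<bar>" for n
      proof (rule AE_I2)
        fix x
        show "norm (indicator {L..U} x *\<^sub>R (f x * h n x)) \<le> \<bar>B\<bar> * \<bar>indicator {L..U} x *\<^sub>R f x\<bar>"
        proof (cases "x \<in> {L..U}")
          case True
          then have "\<bar>h n x\<bar> \<le> \<bar>B\<bar>" using bound[of x n] by linarith
          then have "\<bar>f x\<bar> * \<bar>h n x\<bar> \<le> \<bar>f x\<bar> * \<bar>B\<bar>" by (rule mult_left_mono) simp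
          then show ?thesis using True by (simp add: abs_mult mult.commute)
        qed simp
      qed
    qed
    then show ?thesis unfolding eq set_lebesgue_integral_def .
  qed
  have limu: "(\<lambda>n. \<integral>x. u x * \<psi> n x \<partial>lebesgue) \<longlonglongrightarrow> (LINT x:{L..U}|lebesgue. u x * H x)"
    by (rule dom[where B=C, OF intu cont\<psi> \<psi>bound _ limH]) (use out in blast)
  have limg: "(\<lambda>n. \<integral>x. g x * \<phi> n x \<partial>lebesgue) \<longlonglongrightarrow> (LINT x:{L..U}|lebesgue. g x * T x)"
    by (rule dom[where B="C * (U - L)", OF intg cont\<phi> \<phi>bound _ limT]) (use out in blast)+
  have "(LINT x:{L..U}|lebesgue. u x * H x) = - (LINT x:{L..U}|lebesgue. g x * T x)"
    using LIMSEQ_unique[OF limu] tendsto_minus[OF limg] unfolding identity by blast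
  moreover have "(LINT x:{L..U}|lebesgue. u x * H x) = - (\<Sum>i\<in>I. c i * (LINT x:{L..a i}|lebesgue. u x))"
  proof -
    have ui: "integrable lebesgue (\<lambda>x. indicator {L..a i} x *\<^sub>R u x)" for i
      using intu unfolding set_integrable_def .
    have "(LINT x:{L..U}|lebesgue. u x * H x) = (\<integral>x. (\<Sum>i\<in>I. - c i * (indicator {L..a i} x *\<^sub>R u x)) \<partial>lebesgue)"
      unfolding set_lebesgue_integral_def
    proof (rule integral_cong_AE)
      have "H \<in> borel_measurable borel"
        unfolding H_def[abs_def] by measurable
      moreover have "\<bar>H x\<bar> \<le> C" for x
        by (rule LIMSEQ_le_const2[OF tendsto_rabs[OF limH]]) (use \<psi>bound in auto)
      ultimately show "(\<lambda>x. indicator {L..U} x *\<^sub>R (u x * H x)) \<in> borel_measurable lebesgue"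
        using set_integrable_bounded_mult[OF intu[of L U], of H C] unfolding set_integrable_def by auto
      show "(\<lambda>x. \<Sum>i\<in>I. - c i * (indicator {L..a i} x *\<^sub>R u x)) \<in> borel_measurable lebesgue"
        using ui by (intro borel_measurable_sum borel_measurable_times borel_measurable_const) auto
      \<comment> \<open>The steps of \<open>H\<close> are open at the nodes and the intervals of the
        claim are closed; the two differ on a finite set only.\<close>
      have "AE x in lebesgue. \<forall>i\<in>I. x \<noteq> a i"
        by (subst AE_finite_all[OF I]) (intro ballI AE_completion AE_lborel_singleton)
      then show "AE x in lebesgue. indicator {L..U} x *\<^sub>R (u x * H x) = (\<Sum>i\<in>I. - c i * (indicator {L..a i} x *\<^sub>R u x))"
      proof eventually_elim
        case (elim x)
        have "indicator {L..U} x * (if x < a i then 1 else 0) = (indicator {L..a i} x :: real)" if "i \<in> I" for i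
          using elim that U[OF that] by (fastforce simp: indicator_def)
        then have "(\<Sum>i\<in>I. - c i * (indicator {L..a i} x *\<^sub>R u x)) =
            (\<Sum>i\<in>I. indicator {L..U} x * u x * (- c i * (if x < a i then 1 else 0)))"
          by (intro sum.cong) (auto simp: mult_ac)
        then show ?case by (simp add: H_def sum_distrib_left mult.assoc)
      qed
    qed
    also have "\<dots> = (\<Sum>i\<in>I. - c i * (LINT x:{L..a i}|lebesgue. u x))"
      unfolding set_lebesgue_integral_def using ui
      by (subst Bochner_Integration.integral_sum) auto
    finally show ?thesis by (simp add: sum_negf)
  qed
  moreover have "(LINT x:{L..U}|lebesgue. g x * T x) = (\<Sum>i\<in>I. c i * (LINT x:{L..a i}|lebesgue. g x * (a i - x)))"
  proof -
    have gi: "integrable lebesgue (\<lambda>x. indicator {L..a i} x *\<^sub>R (g x * (a i - x)))" for i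
      using set_integrable_bounded_mult[OF intg[of L "a i"], of "\<lambda>x. a i - x" "\<bar>a i - L\<bar>"]
      unfolding set_integrable_def by auto
    have "(LINT x:{L..U}|lebesgue. g x * T x) = (\<integral>x. (\<Sum>i\<in>I. c i * (indicator {L..a i} x *\<^sub>R (g x * (a i - x)))) \<partial>lebesgue)"
      unfolding set_lebesgue_integral_def
    proof (rule Bochner_Integration.integral_cong[OF refl])
      fix x
      have "indicator {L..U} x * max 0 (a i - x) = (indicator {L..a i} x * (a i - x) :: real)" if "i \<in> I" for i
        using U[OF that] by (auto simp: indicator_def max_def)
      then have "(\<Sum>i\<in>I. c i * (indicator {L..a i} x *\<^sub>R (g x * (a i - x)))) =
          (\<Sum>i\<in>I. g x * (c i * (indicator {L..U} x * max 0 (a i - x))))"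
        by (intro sum.cong) (auto simp: mult_ac)
      also have "\<dots> = indicator {L..U} x *\<^sub>R (g x * T x)"
        by (simp add: T_def sum_distrib_left mult_ac)
      finally show "indicator {L..U} x *\<^sub>R (g x * T x) = (\<Sum>i\<in>I. c i * (indicator {L..a i} x *\<^sub>R (g x * (a i - x))))" ..
    qed
    also have "\<dots> = (\<Sum>i\<in>I. c i * (LINT x:{L..a i}|lebesgue. g x * (a i - x)))"
      unfolding set_lebesgue_integral_def using gi
      by (subst Bochner_Integration.integral_sum) auto
    finally show ?thesis .
  qed
  ultimately show ?thesis by simp
qed

text \<open>The half lines generate the Borel sets and are stable under intersection, and
  \<open>tot\<close> is what the complement step of the induction needs. Then \<open>f\<close>,
  replaced by a Borel version, has the same density as 0.\<close>

lemma AE_zero_of_interval_integrals: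
  fixes f :: "real \<Rightarrow> real"
  assumes f: "integrable lebesgue f" and z: "\<And>x. (LINT t:{..x}|lebesgue. f t) = 0"
    and tot: "(\<integral>x. f x \<partial>lebesgue) = 0"
  shows "AE x in lebesgue. f x = 0"
proof -
  have "f \<in> borel_measurable (completion lborel)" using f by auto
  from completion_ex_borel_measurable_real[OF this] obtain h where h: "h \<in> borel_measurable lborel"
    and fh: "AE x in lborel. f x = h x" by blast
  have fh': "AE x in lebesgue. f x = h x" using fh by (rule AE_completion)
  have hleb: "h \<in> borel_measurable lebesgue" using h by (rule measurable_completion)
  have "integrable lebesgue h"
    using f integrable_cong_AE[of f lebesgue h] fh' hleb by auto
  then have hi: "integrable lborel h" using integrable_completion[OF h] by blast
  have set_eq: "(LINT t:A|lborel. h t) = (LINT t:A|lebesgue. f t)" if A: "A \<in> sets borel" for A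
  proof -
    have m: "(\<lambda>t. indicator A t *\<^sub>R h t) \<in> borel_measurable lborel" using A h by simp
    have "(LINT t:A|lborel. h t) = (LINT t:A|lebesgue. h t)"
      unfolding set_lebesgue_integral_def using integral_completion[OF m] by simp
    also have "\<dots> = (LINT t:A|lebesgue. f t)"
      unfolding set_lebesgue_integral_def
    proof (rule integral_cong_AE)
      have "A \<in> sets lebesgue" using A by auto
      then show "(\<lambda>x. indicator A x *\<^sub>R h x) \<in> borel_measurable lebesgue"
        "(\<lambda>x. indicator A x *\<^sub>R f x) \<in> borel_measurable lebesgue"
        using hleb f by auto
      show "AE x in lebesgue. indicator A x *\<^sub>R h x = indicator A x *\<^sub>R f x"
        using fh' by eventually_elim simp
    qed
    finally show ?thesis .
  qed
  have si: "set_integrable lborel A h" if "A \<in> sets borel" for A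
    using hi that unfolding set_integrable_def by (intro integrable_mult_indicator) auto
  have hz: "(LINT t:A|lborel. h t) = 0" if "A \<in> sets borel" for A
  proof -
    have "Int_stable (range (\<lambda>a::real. {..a}))" "range (\<lambda>a::real. {..a}) \<subseteq> Pow UNIV"
      by (auto simp: Int_stable_def)
    moreover have "A \<in> sigma_sets UNIV (range (\<lambda>a::real. {..a}))"
      using that unfolding borel_eq_atMost by simp
    ultimately show ?thesis
    proof (induction rule: sigma_sets_induct_disjoint)
      case (basic A)
      then show ?case using set_eq z by auto
    next
      case empty
      show ?case by (simp add: set_lebesgue_integral_def)
    next
      case (compl A)
      have A: "A \<in> sets borel" using compl.hyps unfolding borel_eq_atMost by simp
      have "(LINT t:UNIV|lborel. h t) = (LINT t:(UNIV - A)|lborel. h t) + (LINT t:A|lborel. h t)"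
        using set_integral_Un[of "UNIV - A" A lborel h] si[OF A] si[of "UNIV - A"] A by (simp add: Int_commute Diff_disjoint)
      moreover have "(LINT t:UNIV|lborel. h t) = 0"
        using set_eq[of UNIV] tot by (simp add: set_lebesgue_integral_def)
      ultimately show ?case using compl.IH by simp
    next
      case (union A)
      have A: "A i \<in> sets borel" for i using union.hyps(2) unfolding borel_eq_atMost by auto
      have "(LINT t:(\<Union>i. A i)|lborel. h t) = (\<Sum>i. LINT t:A i|lborel. h t)"
        using A union.hyps(1) by (intro lebesgue_integral_countable_add si) (auto simp: disjoint_family_on_def)
      then show ?case using union.IH by simp
    qed
  qed
  have "AE x in lborel. h x = 0"
    by (rule density_unique_real[OF hi integrable_zero]) (use hz in \<open>simp add: set_lebesgue_integral_def\<close>)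
  then have "AE x in lebesgue. h x = 0" by (rule AE_completion)
  with fh' show ?thesis by eventually_elim simp
qed

lemma continuous_on_indefinite_integral:
  fixes w g :: "real \<Rightarrow> real"
  assumes "g absolutely_integrable_on {a..b}"
    and "\<And>x. x \<in> {a..b} \<Longrightarrow> w x - w a = integral {a..x} g"
  shows "continuous_on {a..b} w"
proof -
  have "continuous_on {a..b} (\<lambda>x. w a + integral {a..x} g)"
    by (intro continuous_intros indefinite_integral_continuous_1 set_lebesgue_integral_eq_integral(1)[OF assms(1)])
  moreover have "w a + integral {a..x} g = w x" if "x \<in> {a..b}" for x
    using assms(2)[OF that] by simp
  ultimately show ?thesis by (rule continuous_on_eq)
qed

lemma absolutely_integrable_mult_continuous:
  fixes g h :: "real \<Rightarrow> real"
  assumes g: "g absolutely_integrable_on {s..t}" and h: "continuous_on {s..t} h"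
  shows "(\<lambda>x. g x * h x) absolutely_integrable_on {s..t}"
proof -
  have "(\<lambda>t. h t * g t) absolutely_integrable_on {s..t}"
  proof (rule absolutely_integrable_bounded_measurable_product_real)
    show "h \<in> borel_measurable (lebesgue_on {s..t})"
      using h by (rule continuous_imp_measurable_on_sets_lebesgue) simp
    show "bounded (h ` {s..t})"
      using compact_continuous_image[OF h] compact_imp_bounded by auto
  qed (use g in auto)
  then show ?thesis by (simp add: mult.commute)
qed

text \<open>As \<open>g\<close> is only integrable, its primitive need not be differentiable
  everywhere, but the second primitive is. With \<open>J\<close> the primitive of
  \<open>\<bar>g\<bar>\<close>, the error of the linear approximation is at most
  \<open>\<bar>y - x\<bar> * \<bar>J y - J x\<bar>\<close>, and \<open>J\<close> is
  continuous.\<close>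

lemma second_antiderivative:
  fixes g :: "real \<Rightarrow> real"
  assumes g: "\<And>s t. g absolutely_integrable_on {s..t}" and x: "L < x"
  shows "((\<lambda>x. integral {L..x} (\<lambda>t. g t * (x - t))) has_real_derivative integral {L..x} g) (at x)"
proof -
  define N where "N = x + 1"
  have gi: "g integrable_on {s..t}" and ga: "(\<lambda>t. \<bar>g t\<bar>) integrable_on {s..t}" for s t
    using g[of s t] by (auto simp: absolutely_integrable_on_def)
  have mult: "(\<lambda>t. g t * h t) absolutely_integrable_on {s..t}" if "continuous_on {s..t} h" for h s t
    by (rule absolutely_integrable_mult_continuous[OF g that])
  have ga': "(\<lambda>t. \<bar>g t\<bar>) absolutely_integrable_on {s..t}" for s t
    using absolutely_integrable_norm[OF g] by (simp add: o_def)
  have lin: "(\<lambda>t. g t * (y - t)) integrable_on {s..t}" for s t y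
    by (intro set_lebesgue_integral_eq_integral(1) mult continuous_intros)
  define J where "J y = integral {L..y} (\<lambda>t. \<bar>g t\<bar>)" for y
  have contJ: "continuous_on {L..N} J"
    unfolding J_def by (rule indefinite_integral_continuous_1[OF ga])
  define Z where "Z y = integral {L..y} (\<lambda>t. g t * (y - t))" for y
  have sub: "integral {y..z} f + integral {z..w} f = integral {y..w} f"
    if "f absolutely_integrable_on {y..w}" "y \<le> z" "z \<le> w" for f :: "real \<Rightarrow> real" and y z w
    using that set_lebesgue_integral_eq_integral(1)[OF that(1)]
    by (intro Henstock_Kurzweil_Integration.integral_combine) auto
  have key: "\<bar>Z y - Z x - (y - x) * integral {L..x} g\<bar> \<le> \<bar>y - x\<bar> * \<bar>J y - J x\<bar>" if y: "L \<le> y" for y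
  proof (cases "x \<le> y")
    case True
    have "Z y = integral {L..x} (\<lambda>t. g t * (y - t)) + integral {x..y} (\<lambda>t. g t * (y - t))"
      unfolding Z_def using True x by (intro sub[symmetric] mult continuous_intros) auto
    also have "integral {L..x} (\<lambda>t. g t * (y - t)) = integral {L..x} (\<lambda>t. g t * (x - t) + (y - x) * g t)"
      by (intro Henstock_Kurzweil_Integration.integral_cong) (simp add: algebra_simps)
    also have "\<dots> = Z x + (y - x) * integral {L..x} g"
      unfolding Z_def
      by (subst Henstock_Kurzweil_Integration.integral_add)
         (use gi lin in \<open>auto intro!: integrable_on_mult_right\<close>)
    finally have "Z y - Z x - (y - x) * integral {L..x} g = integral {x..y} (\<lambda>t. g t * (y - t))" by simp
    moreover have "norm (integral {x..y} (\<lambda>t. g t * (y - t))) \<le> integral {x..y} (\<lambda>t. (y - x) * \<bar>g t\<bar>)"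
    proof (rule integral_norm_bound_integral)
      show "(\<lambda>t. g t * (y - t)) integrable_on {x..y}"
        by (intro set_lebesgue_integral_eq_integral(1) mult continuous_intros)
      show "(\<lambda>t. (y - x) * \<bar>g t\<bar>) integrable_on {x..y}" using ga by (rule integrable_on_mult_right)
      show "norm (g t * (y - t)) \<le> (y - x) * \<bar>g t\<bar>" if "t \<in> {x..y}" for t
        using that by (simp add: abs_mult mult.commute mult_left_mono)
    qed
    moreover have "J y = J x + integral {x..y} (\<lambda>t. \<bar>g t\<bar>)"
      unfolding J_def using True x ga' by (intro sub[symmetric]) auto
    moreover have "0 \<le> integral {x..y} (\<lambda>t. \<bar>g t\<bar>)"
      using ga by (intro Henstock_Kurzweil_Integration.integral_nonneg) auto
    ultimately show ?thesis
      using True by simp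
  next
    case False
    then have yx: "y \<le> x" by simp
    have "Z x = integral {L..y} (\<lambda>t. g t * (x - t)) + integral {y..x} (\<lambda>t. g t * (x - t))"
      unfolding Z_def using yx y by (intro sub[symmetric] mult continuous_intros) auto
    also have "integral {L..y} (\<lambda>t. g t * (x - t)) = integral {L..y} (\<lambda>t. g t * (y - t) + (x - y) * g t)"
      by (intro Henstock_Kurzweil_Integration.integral_cong) (simp add: algebra_simps)
    also have "\<dots> = Z y + (x - y) * integral {L..y} g"
      unfolding Z_def
      by (subst Henstock_Kurzweil_Integration.integral_add)
         (use gi lin in \<open>auto intro!: integrable_on_mult_right\<close>)
    also have "integral {L..y} g = integral {L..x} g - integral {y..x} g"
      using sub[OF g y yx] by simp
    finally have "Z y - Z x - (y - x) * integral {L..x} g =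
        (x - y) * integral {y..x} g - integral {y..x} (\<lambda>t. g t * (x - t))"
      by (simp add: algebra_simps)
    also have "\<dots> = integral {y..x} (\<lambda>t. (x - y) * g t - g t * (x - t))"
      by (subst Henstock_Kurzweil_Integration.integral_diff)
         (use gi lin in \<open>auto intro!: integrable_on_mult_right\<close>)
    also have "\<dots> = integral {y..x} (\<lambda>t. g t * (t - y))"
      by (intro Henstock_Kurzweil_Integration.integral_cong) (simp add: algebra_simps)
    finally have "Z y - Z x - (y - x) * integral {L..x} g = integral {y..x} (\<lambda>t. g t * (t - y))" .
    moreover have "norm (integral {y..x} (\<lambda>t. g t * (t - y))) \<le> integral {y..x} (\<lambda>t. (x - y) * \<bar>g t\<bar>)"
    proof (rule integral_norm_bound_integral)
      show "(\<lambda>t. g t * (t - y)) integrable_on {y..x}"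
        by (intro set_lebesgue_integral_eq_integral(1) mult continuous_intros)
      show "(\<lambda>t. (x - y) * \<bar>g t\<bar>) integrable_on {y..x}" using ga by (rule integrable_on_mult_right)
      show "norm (g t * (t - y)) \<le> (x - y) * \<bar>g t\<bar>" if "t \<in> {y..x}" for t
        using that by (simp add: abs_mult mult.commute mult_left_mono)
    qed
    moreover have "J x = J y + integral {y..x} (\<lambda>t. \<bar>g t\<bar>)"
      unfolding J_def using yx y ga' by (intro sub[symmetric]) auto
    moreover have "0 \<le> integral {y..x} (\<lambda>t. \<bar>g t\<bar>)"
      using ga by (intro Henstock_Kurzweil_Integration.integral_nonneg) auto
    ultimately show ?thesis
      using yx by simp
  qed
  have "((\<lambda>y. (Z y - Z x) / (y - x)) \<longlongrightarrow> integral {L..x} g) (at x)"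
  proof (subst LIM_zero_iff[symmetric], rule Lim_null_comparison)
    have "isCont J x"
      using contJ x by (intro continuous_on_interior[OF contJ]) (simp add: N_def interior_atLeastAtMost_real)
    then have "((\<lambda>y. J y - J x) \<longlongrightarrow> 0) (at x)"
      by (simp add: isCont_def LIM_zero_iff)
    then show "((\<lambda>y. \<bar>J y - J x\<bar>) \<longlongrightarrow> 0) (at x)"
      by (rule tendsto_rabs_zero)
    have "\<forall>\<^sub>F y in at x. L < y"
      using x by (intro order_tendstoD(1)[OF tendsto_ident_at])
    then show "\<forall>\<^sub>F y in at x. norm ((Z y - Z x) / (y - x) - integral {L..x} g) \<le> \<bar>J y - J x\<bar>"
      using eventually_neq_at_within[of x x UNIV]
    proof eventually_elim
      case (elim y)
      then have "(Z y - Z x) / (y - x) - integral {L..x} g = (Z y - Z x - (y - x) * integral {L..x} g) / (y - x)"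
        by (simp add: field_simps)
      then show ?case
        using key[of y] elim by (simp add: abs_divide pos_divide_le_eq mult.commute)
    qed
  qed
  then show ?thesis
    unfolding has_field_derivative_iff Z_def .
qed

text \<open>Testing with hat functions shows that the primitive of \<open>u\<close> and the second
  primitive of \<open>g\<close> differ by an affine function \<open>E\<close> on
  \<open>{c..d}\<close>. Differentiating once gives \<open>u\<close>, with the slope of
  \<open>E\<close> as constant. The start \<open>L = c - 1\<close> leaves the unit of room that the
  ramps need.\<close>

lemma weak_derivative_local:
  assumes weak: "has_weak_derivative u g" and cd: "c < d"
  obtains \<kappa> where "AE x in lebesgue. x \<in> {c..d} \<longrightarrow> u x = \<kappa> + integral {c-1..x} g"
proof -
  define L where "L = c - 1"
  have ua: "u absolutely_integrable_on {s..t}" and ga: "g absolutely_integrable_on {s..t}" for s t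
    using weak by (auto simp: has_weak_derivative_def locally_integrable_def)
  have ga': "(\<lambda>x. g x * (y - x)) absolutely_integrable_on {s..t}" for s t y
  proof -
    have "(\<lambda>x. g x * (y - x)) absolutely_integrable_on {s..t}"
      by (rule set_integrable_bounded_mult[OF ga, where B="\<bar>y - s\<bar> + \<bar>y - t\<bar>"]) auto
    then show ?thesis .
  qed
  define E where "E x = integral {L..x} u - integral {L..x} (\<lambda>t. g t * (x - t))" for x
  have affine: "E x - E c = (E d - E c) / (d - c) * (x - c)" if x: "x \<in> {c..d}" for x
  proof -
    \<comment> \<open>Three nodes \<open>c\<close>, \<open>x\<close>, \<open>d\<close> with
      coefficients \<open>d - x\<close>, \<open>c - d\<close>, \<open>x - c\<close>. Both moments
      vanish, and the piecewise linear function is a multiple of the hat with these corners.\<close>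
    define a where "a i = (if i = 0 then c else if i = 1 then x else d)" for i :: nat
    define k where "k i = (if i = 0 then d - x else if i = 1 then c - d else x - c)" for i :: nat
    have "(\<Sum>i\<in>{0,1,2}. k i * (LINT x:{L..a i}|lebesgue. u x)) =
         (\<Sum>i\<in>{0,1,2}. k i * (LINT x:{L..a i}|lebesgue. g x * (a i - x)))"
      by (rule weak_derivative_piecewise_linear[OF weak])
         (use x in \<open>auto simp: a_def k_def L_def algebra_simps\<close>)
    then have "(d - x) * E c + (c - d) * E x + (x - c) * E d = 0"
      unfolding E_def using set_lebesgue_integral_eq_integral(2)[OF ua] set_lebesgue_integral_eq_integral(2)[OF ga']
      by (simp add: a_def k_def algebra_simps)
    then show ?thesis using cd by (simp add: field_simps)
  qed
  define \<kappa> where "\<kappa> = (E d - E c) / (d - c)"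
  define G where "G x = integral {L..x} g" for x
  have contG: "continuous_on {c..d} G"
    unfolding G_def
    by (rule continuous_on_subset[OF indefinite_integral_continuous_1[of g L d]])
       (use ga in \<open>auto simp: L_def intro: set_lebesgue_integral_eq_integral(1)\<close>)
  \<comment> \<open>Affinity of \<open>E\<close> says that the increments of the primitive of
    \<open>u\<close> are those of \<open>\<kappa> * x\<close> plus the second primitive of
    \<open>g\<close>, whose derivative is \<open>\<kappa> + G\<close>.\<close>
  have int: "integral {c..x} u = integral {c..x} (\<lambda>t. \<kappa> + G t)" if x: "x \<in> {c..d}" for x
  proof -
    have "((\<lambda>t. \<kappa> + G t) has_integral
        ((\<kappa> * x + integral {L..x} (\<lambda>t. g t * (x - t))) - (\<kappa> * c + integral {L..c} (\<lambda>t. g t * (c - t))))) {c..x}"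
    proof (rule fundamental_theorem_of_calculus)
      show "c \<le> x" using x by simp
      fix t assume "t \<in> {c..x}"
      then have "L < t" by (simp add: L_def)
      have "((\<lambda>x. \<kappa> * x + integral {L..x} (\<lambda>t. g t * (x - t))) has_real_derivative \<kappa> + G t) (at t)"
        using DERIV_add[OF DERIV_cmult[OF DERIV_ident, of \<kappa>] second_antiderivative[OF ga \<open>L < t\<close>]]
        by (simp add: G_def)
      then show "((\<lambda>x. \<kappa> * x + integral {L..x} (\<lambda>t. g t * (x - t))) has_vector_derivative \<kappa> + G t) (at t within {c..x})"
        using has_field_derivative_at_within has_real_derivative_iff_has_vector_derivative by blast
    qed
    then have "integral {c..x} (\<lambda>t. \<kappa> + G t) =
        \<kappa> * (x - c) + integral {L..x} (\<lambda>t. g t * (x - t)) - integral {L..c} (\<lambda>t. g t * (c - t))"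
      by (simp add: integral_unique algebra_simps)
    also have "\<dots> = integral {L..x} u - integral {L..c} u"
      using affine[OF x, folded \<kappa>_def] unfolding E_def by simp
    also have "\<dots> = integral {c..x} u"
      using Henstock_Kurzweil_Integration.integral_combine[of L c x u] x set_lebesgue_integral_eq_integral(1)[OF ua]
      by (simp add: L_def)
    finally show ?thesis ..
  qed
  define f where "f x = u x - (\<kappa> + G x)" for x
  have fa: "f absolutely_integrable_on {c..x}" if "x \<le> d" for x
    unfolding f_def
    by (intro set_integral_diff ua absolutely_integrable_continuous_real continuous_intros
          continuous_on_subset[OF contG]) (use that in auto)
  have fz: "integral {c..x} f = 0" if "x \<in> {c..d}" for x
    unfolding f_def using int[OF that]
    by (subst Henstock_Kurzweil_Integration.integral_diff)
       (use that in \<open>auto intro!: set_lebesgue_integral_eq_integral(1)[OF ua] integrable_continuous_real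
          continuous_intros continuous_on_subset[OF contG]\<close>)
  have "AE x in lebesgue. indicator {c..d} x *\<^sub>R f x = 0"
  proof (rule AE_zero_of_interval_integrals)
    show "integrable lebesgue (\<lambda>x. indicator {c..d} x *\<^sub>R f x)"
      using fa[of d] by (simp add: set_integrable_def)
    have part: "(LINT t:{c..x}|lebesgue. f t) = 0" if "x \<le> d" for x
    proof (cases "c \<le> x")
      case True
      then show ?thesis using set_lebesgue_integral_eq_integral(2)[OF fa[OF that]] fz[of x] that by simp
    qed (simp add: set_lebesgue_integral_def)
    show "(LINT t:{..x}|lebesgue. indicator {c..d} t *\<^sub>R f t) = 0" for x
    proof -
      have "(\<lambda>t. indicator {..x} t *\<^sub>R (indicator {c..d} t *\<^sub>R f t)) = (\<lambda>t. indicator {c..min x d} t *\<^sub>R f t)"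
        by (auto simp: indicator_def fun_eq_iff)
      then show ?thesis using part[of "min x d"] unfolding set_lebesgue_integral_def by (simp only: min.cobounded2)
    qed
    show "(\<integral>x. indicator {c..d} x *\<^sub>R f x \<partial>lebesgue) = 0"
      using part[of d] by (simp add: set_lebesgue_integral_def)
  qed
  then have "AE x in lebesgue. x \<in> {c..d} \<longrightarrow> u x = \<kappa> + integral {c-1..x} g"
    by eventually_elim (auto simp: f_def G_def L_def)
  then show ?thesis by (rule that)
qed

text \<open>On each of the growing intervals \<open>u\<close> differs from the fixed primitive
  \<open>U\<close> by a constant. The constants agree because all intervals contain
  \<open>{-1..1}\<close>, a set of positive measure, and countably many null sets are
  discarded.\<close>

lemma weak_derivative_representative:
  assumes weak: "has_weak_derivative u g"
  obtains w where "AE x in lebesgue. u x = w x"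
    and "\<And>a b. a \<le> b \<Longrightarrow> w b - w a = integral {a..b} g"
proof -
  have ga: "g absolutely_integrable_on {s..t}" for s t
    using weak by (auto simp: has_weak_derivative_def locally_integrable_def)
  then have gi: "g integrable_on {s..t}" for s t
    using set_lebesgue_integral_eq_integral(1) by blast
  define U where "U x = (if 0 \<le> x then integral {0..x} g else - integral {x..0} g)" for x
  have U: "U b - U a = integral {a..b} g" if "a \<le> b" for a b
  proof -
    consider "0 \<le> a" | "a < 0" "0 \<le> b" | "b < 0" by linarith
    then show ?thesis
      using Henstock_Kurzweil_Integration.integral_combine[of 0 a b g]
        Henstock_Kurzweil_Integration.integral_combine[of a 0 b g]
        Henstock_Kurzweil_Integration.integral_combine[of a b 0 g] gi that
      by cases (auto simp: U_def)
  qed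
  have "\<exists>\<kappa>. AE x in lebesgue. x \<in> {-real (Suc n)..real (Suc n)} \<longrightarrow> u x = \<kappa> + U x" for n
  proof -
    obtain \<kappa> where \<kappa>: "AE x in lebesgue. x \<in> {-real (Suc n)..real (Suc n)} \<longrightarrow>
        u x = \<kappa> + integral {-real (Suc n)-1..x} g"
      using weak_derivative_local[OF weak, of "-real (Suc n)" "real (Suc n)"] by auto
    have "AE x in lebesgue. x \<in> {-real (Suc n)..real (Suc n)} \<longrightarrow> u x = (\<kappa> - U (-real (Suc n)-1)) + U x"
      using \<kappa>
    proof eventually_elim
      case (elim x)
      show ?case
      proof
        assume x: "x \<in> {-real (Suc n)..real (Suc n)}"
        then have "-real (Suc n) - 1 \<le> x" by simp
        from U[OF this] elim x show "u x = (\<kappa> - U (-real (Suc n)-1)) + U x" by simp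
      qed
    qed
    then show ?thesis by blast
  qed
  then obtain \<kappa> where \<kappa>: "\<And>n. AE x in lebesgue. x \<in> {-real (Suc n)..real (Suc n)} \<longrightarrow> u x = \<kappa> n + U x"
    by metis
  have const: "\<kappa> n = \<kappa> 0" for n
  proof (rule ccontr)
    assume ne: "\<kappa> n \<noteq> \<kappa> 0"
    have "AE x in lebesgue. x \<notin> {-1..1::real}"
      using \<kappa>[of n] \<kappa>[of 0] by eventually_elim (use ne in auto)
    then have "AE x in lborel. x \<notin> {-1..1::real}"
      by (simp add: AE_completion_iff)
    then have "emeasure lborel {-1..1::real} = 0"
      by (subst (asm) AE_iff_measurable[of "{-1..1}"]) auto
    then show False by simp
  qed
  show ?thesis
  proof (rule that[of "\<lambda>x. \<kappa> 0 + U x"])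
    have "AE x in lebesgue. \<forall>n. x \<in> {-real (Suc n)..real (Suc n)} \<longrightarrow> u x = \<kappa> n + U x"
      unfolding AE_all_countable using \<kappa> by blast
    then show "AE x in lebesgue. u x = \<kappa> 0 + U x"
    proof eventually_elim
      case (elim x)
      obtain n where "\<bar>x\<bar> \<le> real n" using real_arch_simple by blast
      then have "x \<in> {-real (Suc n)..real (Suc n)}" by auto
      then show ?case using elim const by metis
    qed
    show "\<kappa> 0 + U b - (\<kappa> 0 + U a) = integral {a..b} g" if "a \<le> b" for a b
      using U[OF that] by simp
  qed
qed

section \<open>Hoelder's inequality and the chain rule along an absolutely continuous path\<close>

lemma Holder_inequality_real:
  fixes f h :: "'a \<Rightarrow> real"
  assumes p: "1 < p" and p': "1 / p + 1 / p' = 1"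
    and fm: "f \<in> borel_measurable M" and hm: "h \<in> borel_measurable M"
    and f: "integrable M (\<lambda>x. \<bar>f x\<bar> powr p)" and h: "integrable M (\<lambda>x. \<bar>h x\<bar> powr p')"
  shows "integrable M (\<lambda>x. \<bar>f x\<bar> * \<bar>h x\<bar>)"
    and "(\<integral>x. \<bar>f x\<bar> * \<bar>h x\<bar> \<partial>M) \<le>
         (\<integral>x. \<bar>f x\<bar> powr p \<partial>M) powr (1 / p) * (\<integral>x. \<bar>h x\<bar> powr p' \<partial>M) powr (1 / p')"
proof -
  have p'1: "1 < p'"
  proof -
    have "1 / p' = 1 - 1 / p" using p' by simp
    moreover have "0 < 1 - 1 / p" "1 - 1 / p < 1" using p by (auto simp: field_simps)
    ultimately have "0 < 1 / p'" "1 / p' < 1" by auto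
    then show ?thesis by (simp add: zero_less_divide_iff)
  qed
  have young: "s * t \<le> s powr p / p + t powr p' / p'" if "0 \<le> s" "0 \<le> t" for s t
    by (rule Youngs_inequality) (use p p'1 p' that in auto)
  show int: "integrable M (\<lambda>x. \<bar>f x\<bar> * \<bar>h x\<bar>)"
  proof (rule Bochner_Integration.integrable_bound)
    show "integrable M (\<lambda>x. \<bar>f x\<bar> powr p / p + \<bar>h x\<bar> powr p' / p')" using f h by simp
    show "AE x in M. norm (\<bar>f x\<bar> * \<bar>h x\<bar>) \<le> norm (\<bar>f x\<bar> powr p / p + \<bar>h x\<bar> powr p' / p')"
    proof (rule AE_I2)
      fix x
      have "\<bar>f x\<bar> * \<bar>h x\<bar> \<le> \<bar>f x\<bar> powr p / p + \<bar>h x\<bar> powr p' / p'" by (rule young) auto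
      also have "\<dots> \<le> \<bar>\<bar>f x\<bar> powr p / p + \<bar>h x\<bar> powr p' / p'\<bar>" by (rule abs_ge_self)
      finally show "norm (\<bar>f x\<bar> * \<bar>h x\<bar>) \<le> norm (\<bar>f x\<bar> powr p / p + \<bar>h x\<bar> powr p' / p')"
        by (simp add: abs_mult)
    qed
  qed (use fm hm in auto)
  define A where "A = (\<integral>x. \<bar>f x\<bar> powr p \<partial>M)"
  define B where "B = (\<integral>x. \<bar>h x\<bar> powr p' \<partial>M)"
  have "0 \<le> A" "0 \<le> B" unfolding A_def B_def by (auto intro!: Bochner_Integration.integral_nonneg)
  have zero: "(\<integral>x. \<bar>f x\<bar> * \<bar>h x\<bar> \<partial>M) = 0" if "A = 0 \<or> B = 0"
  proof -
    have "AE x in M. \<bar>f x\<bar> * \<bar>h x\<bar> = 0"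
      using that
    proof
      assume "A = 0"
      then have "AE x in M. \<bar>f x\<bar> powr p = 0"
        using integral_nonneg_eq_0_iff_AE[OF f] unfolding A_def by simp
      then show ?thesis by eventually_elim simp
    next
      assume "B = 0"
      then have "AE x in M. \<bar>h x\<bar> powr p' = 0"
        using integral_nonneg_eq_0_iff_AE[OF h] unfolding B_def by simp
      then show ?thesis by eventually_elim simp
    qed
    then show ?thesis by (rule integral_eq_zero_AE)
  qed
  have "(\<integral>x. \<bar>f x\<bar> * \<bar>h x\<bar> \<partial>M) \<le> A powr (1 / p) * B powr (1 / p')"
  proof (cases "A = 0 \<or> B = 0")
    case True
    then show ?thesis using zero by simp
  next
    case False
    then have AB: "0 < A" "0 < B" using \<open>0 \<le> A\<close> \<open>0 \<le> B\<close> by auto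
    define a where "a = A powr (1 / p)"
    define b where "b = B powr (1 / p')"
    have ab: "0 < a" "0 < b" using AB by (auto simp: a_def b_def)
    have apb: "a powr p = A" "b powr p' = B"
      using AB p p'1 by (auto simp: a_def b_def powr_powr)
    have "(\<integral>x. \<bar>f x\<bar> * \<bar>h x\<bar> / (a * b) \<partial>M) \<le> (\<integral>x. \<bar>f x\<bar> powr p / (p * A) + \<bar>h x\<bar> powr p' / (p' * B) \<partial>M)"
    proof (rule Bochner_Integration.integral_mono)
      show "integrable M (\<lambda>x. \<bar>f x\<bar> * \<bar>h x\<bar> / (a * b))" using int by simp
      show "integrable M (\<lambda>x. \<bar>f x\<bar> powr p / (p * A) + \<bar>h x\<bar> powr p' / (p' * B))" using f h by simp
      fix x
      have "(\<bar>f x\<bar> / a) * (\<bar>h x\<bar> / b) \<le> (\<bar>f x\<bar> / a) powr p / p + (\<bar>h x\<bar> / b) powr p' / p'"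
        using ab by (intro young) auto
      also have "\<dots> = \<bar>f x\<bar> powr p / (p * A) + \<bar>h x\<bar> powr p' / (p' * B)"
        using ab by (simp add: powr_divide apb mult.commute)
      finally show "\<bar>f x\<bar> * \<bar>h x\<bar> / (a * b) \<le> \<bar>f x\<bar> powr p / (p * A) + \<bar>h x\<bar> powr p' / (p' * B)"
        by simp
    qed
    also have "\<dots> = A / (p * A) + B / (p' * B)"
      unfolding A_def B_def using f h by simp
    also have "\<dots> = 1" using AB p' by simp
    finally have "(\<integral>x. \<bar>f x\<bar> * \<bar>h x\<bar> \<partial>M) / (a * b) \<le> 1" by simp
    then show ?thesis using ab by (simp add: a_def b_def pos_divide_le_eq)
  qed
  then show "(\<integral>x. \<bar>f x\<bar> * \<bar>h x\<bar> \<partial>M) \<le>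
         (\<integral>x. \<bar>f x\<bar> powr p \<partial>M) powr (1 / p) * (\<integral>x. \<bar>h x\<bar> powr p' \<partial>M) powr (1 / p')"
    unfolding A_def B_def .
qed

text \<open>Here \<open>w\<close> need not be differentiable at any given point and \<open>G\<close>
  only inside \<open>{0..M}\<close>, so an inequality is proved by bisection instead of a chain
  rule. On a short interval the mean value theorem for \<open>G\<close> gives the factor
  \<open>W z\<close>, and the increment of \<open>\<bar>w\<bar>\<close> is at most the integral of
  \<open>\<bar>g\<bar>\<close>. A slack \<open>e\<close> in the weight absorbs the variation of
  \<open>W \<bar>w\<bar>\<close> and is removed at the end.\<close>

lemma chain_rule_bound_abs:
  fixes w g G W :: "real \<Rightarrow> real"
  assumes ab: "a \<le> b" and g: "g absolutely_integrable_on {a..b}"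
    and w: "\<And>x y. a \<le> x \<Longrightarrow> x \<le> y \<Longrightarrow> y \<le> b \<Longrightarrow> w y - w x = integral {x..y} g"
    and M: "\<And>x. x \<in> {a..b} \<Longrightarrow> \<bar>w x\<bar> \<le> M"
    and G: "continuous_on {0..M} G" and W: "continuous_on {0..M} W"
    and Wpos: "\<And>s. s \<in> {0..M} \<Longrightarrow> 0 \<le> W s"
    and deriv: "\<And>s. 0 < s \<Longrightarrow> s < M \<Longrightarrow> (G has_real_derivative W s) (at s)"
  shows "\<bar>G \<bar>w b\<bar> - G \<bar>w a\<bar>\<bar> \<le> integral {a..b} (\<lambda>x. W \<bar>w x\<bar> * \<bar>g x\<bar>)"
proof -
  have contw: "continuous_on {a..b} w"
    by (rule continuous_on_indefinite_integral[OF g]) (use w in auto)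
  define V where "V x = W \<bar>w x\<bar>" for x
  have contV: "continuous_on {a..b} V"
    unfolding V_def[abs_def]
    by (rule continuous_on_compose2[OF W]) (use M in \<open>auto intro!: continuous_intros contw\<close>)
  have Vpos: "0 \<le> V x" if "x \<in> {a..b}" for x
    unfolding V_def using M[OF that] by (intro Wpos) auto
  have gsub: "(\<lambda>t. \<bar>g t\<bar>) absolutely_integrable_on {x..y}" if "a \<le> x" "y \<le> b" for x y
  proof -
    have "g absolutely_integrable_on {x..y}"
      by (rule absolutely_integrable_on_subinterval[OF g]) (use that in auto)
    from absolutely_integrable_norm[OF this] show ?thesis by (simp add: o_def)
  qed
  have int: "(\<lambda>t. h t * \<bar>g t\<bar>) integrable_on {x..y}"
    if "continuous_on {a..b} h" "a \<le> x" "y \<le> b" for h x y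
    using absolutely_integrable_mult_continuous[OF gsub[OF that(2,3)] continuous_on_subset[OF that(1)]] that(2,3)
    by (auto simp: mult.commute dest: set_lebesgue_integral_eq_integral(1))
  have approx: "\<bar>G \<bar>w b\<bar> - G \<bar>w a\<bar>\<bar> \<le> integral {a..b} (\<lambda>x. (V x + e) * \<bar>g x\<bar>)" if e: "0 < e" for e
  proof -
    have contVe: "continuous_on {a..b} (\<lambda>x. V x + e)" by (intro continuous_intros contV)
    define P where "P x y \<longleftrightarrow> (a \<le> x \<and> x \<le> y \<and> y \<le> b \<longrightarrow>
      \<bar>G \<bar>w y\<bar> - G \<bar>w x\<bar>\<bar> \<le> integral {x..y} (\<lambda>t. (V t + e) * \<bar>g t\<bar>))" for x y
    have "P a b" using ab
    proof (induction rule: Bolzano)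
      case (trans x y z)
      show ?case
        unfolding P_def
      proof
        assume xz: "a \<le> x \<and> x \<le> z \<and> z \<le> b"
        have "integral {x..y} (\<lambda>t. (V t + e) * \<bar>g t\<bar>) + integral {y..z} (\<lambda>t. (V t + e) * \<bar>g t\<bar>)
            = integral {x..z} (\<lambda>t. (V t + e) * \<bar>g t\<bar>)"
          using xz trans by (intro Henstock_Kurzweil_Integration.integral_combine int contVe) auto
        moreover have "\<bar>G \<bar>w y\<bar> - G \<bar>w x\<bar>\<bar> \<le> integral {x..y} (\<lambda>t. (V t + e) * \<bar>g t\<bar>)"
          "\<bar>G \<bar>w z\<bar> - G \<bar>w y\<bar>\<bar> \<le> integral {y..z} (\<lambda>t. (V t + e) * \<bar>g t\<bar>)"
          using trans xz unfolding P_def by auto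
        ultimately show "\<bar>G \<bar>w z\<bar> - G \<bar>w x\<bar>\<bar> \<le> integral {x..z} (\<lambda>t. (V t + e) * \<bar>g t\<bar>)"
          by linarith
      qed
    next
      case (local x)
      then have "x \<in> {a..b}" by simp
      \<comment> \<open>Two values of \<open>V\<close> near \<open>x\<close> then differ by less
        than \<open>e\<close>, which is exactly the slack that pays for freezing \<open>V\<close> at
        one point.\<close>
      with contV e obtain d where "0 < d" and
        d: "\<And>t. t \<in> {a..b} \<Longrightarrow> dist t x < d \<Longrightarrow> dist (V t) (V x) < e / 2"
        unfolding continuous_on_iff by (metis half_gt_zero)
      have "P \<alpha> \<beta>" if \<alpha>\<beta>: "\<alpha> \<le> x" "x \<le> \<beta>" "\<beta> - \<alpha> < d" for \<alpha> \<beta>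
        unfolding P_def
      proof
        assume r: "a \<le> \<alpha> \<and> \<alpha> \<le> \<beta> \<and> \<beta> \<le> b"
        let ?s = "min \<bar>w \<alpha>\<bar> \<bar>w \<beta>\<bar>" and ?t = "max \<bar>w \<alpha>\<bar> \<bar>w \<beta>\<bar>"
        show "\<bar>G \<bar>w \<beta>\<bar> - G \<bar>w \<alpha>\<bar>\<bar> \<le> integral {\<alpha>..\<beta>} (\<lambda>t. (V t + e) * \<bar>g t\<bar>)"
        proof (cases "?s < ?t")
          case False
          then have "\<bar>w \<alpha>\<bar> = \<bar>w \<beta>\<bar>" by (simp add: min_def max_def split: if_splits)
          moreover have "0 \<le> integral {\<alpha>..\<beta>} (\<lambda>t. (V t + e) * \<bar>g t\<bar>)"
            using r Vpos e by (intro Henstock_Kurzweil_Integration.integral_nonneg int contVe)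
              (auto intro!: mult_nonneg_nonneg add_nonneg_nonneg)
          ultimately show ?thesis by simp
        next
          case True
          have tM: "?t \<le> M" and s0: "0 \<le> ?s" using M[of \<alpha>] M[of \<beta>] r by auto
          obtain l z where z: "?s < z" "z < ?t" and l: "(G has_real_derivative l) (at z)"
            and eq: "G ?t - G ?s = (?t - ?s) * l"
          proof -
            have "\<exists>l z. ?s < z \<and> z < ?t \<and> (G has_real_derivative l) (at z) \<and> G ?t - G ?s = (?t - ?s) * l"
            proof (rule MVT[OF True])
              show "continuous_on {?s..?t} G"
                by (rule continuous_on_subset[OF G]) (use tM s0 in auto)
              show "G differentiable at y" if "?s < y" "y < ?t" for y
                using deriv[of y] that tM s0 real_differentiable_def by force
            qed
            then show ?thesis using that by blast
          qed
          have "l = W z" using DERIV_unique[OF l deriv[of z]] z tM s0 by simp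
          \<comment> \<open>The mean value point lies strictly between the end values of
            \<open>\<bar>w\<bar>\<close>, so the path attains it and \<open>W z\<close> is a value
            of \<open>V\<close> on this short interval.\<close>
          obtain \<tau> where \<tau>: "\<tau> \<in> {\<alpha>..\<beta>}" "\<bar>w \<tau>\<bar> = z"
          proof -
            have c: "continuous_on {\<alpha>..\<beta>} (\<lambda>t. \<bar>w t\<bar>)"
              by (intro continuous_intros continuous_on_subset[OF contw]) (use r in auto)
            show ?thesis
            proof (cases "\<bar>w \<alpha>\<bar> \<le> \<bar>w \<beta>\<bar>")
              case True
              then show ?thesis
                using IVT'[of "\<lambda>t. \<bar>w t\<bar>" \<alpha> z \<beta>] c z r that by auto
            next
              case False
              then show ?thesis
                using IVT2'[of "\<lambda>t. \<bar>w t\<bar>" \<beta> z \<alpha>] c z r that by auto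
            qed
          qed
          have "\<bar>?t - ?s\<bar> \<le> \<bar>w \<beta> - w \<alpha>\<bar>"
            using abs_triangle_ineq3[of "w \<beta>" "w \<alpha>"]
            by (cases "\<bar>w \<alpha>\<bar> \<le> \<bar>w \<beta>\<bar>") (auto simp: max_def min_def)
          also have "\<dots> = \<bar>integral {\<alpha>..\<beta>} g\<bar>" using w r by simp
          also have "\<dots> \<le> integral {\<alpha>..\<beta>} (\<lambda>t. \<bar>g t\<bar>)"
          proof -
            have "g absolutely_integrable_on {\<alpha>..\<beta>}"
              by (rule absolutely_integrable_on_subinterval[OF g]) (use r in auto)
            then have "norm (integral {\<alpha>..\<beta>} g) \<le> integral {\<alpha>..\<beta>} (\<lambda>t. norm (g t))"
              unfolding absolutely_integrable_on_def
              by (intro integral_norm_bound_integral) auto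
            then show ?thesis by simp
          qed
          finally have ts: "\<bar>?t - ?s\<bar> \<le> integral {\<alpha>..\<beta>} (\<lambda>t. \<bar>g t\<bar>)" .
          have "\<bar>G \<bar>w \<beta>\<bar> - G \<bar>w \<alpha>\<bar>\<bar> = \<bar>G ?t - G ?s\<bar>" by (auto simp: max_def min_def abs_minus_commute)
          also have "\<dots> = V \<tau> * \<bar>?t - ?s\<bar>"
            using eq \<open>l = W z\<close> \<tau>(2) Vpos[of \<tau>] \<tau>(1) r by (simp add: V_def abs_mult mult.commute)
          also have "\<dots> \<le> V \<tau> * integral {\<alpha>..\<beta>} (\<lambda>t. \<bar>g t\<bar>)"
            by (rule mult_left_mono[OF ts]) (use Vpos[of \<tau>] \<tau>(1) r in auto)
          also have "\<dots> = integral {\<alpha>..\<beta>} (\<lambda>t. V \<tau> * \<bar>g t\<bar>)" by simp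
          also have "\<dots> \<le> integral {\<alpha>..\<beta>} (\<lambda>t. (V t + e) * \<bar>g t\<bar>)"
          proof (rule integral_le)
            show "(\<lambda>t. V \<tau> * \<bar>g t\<bar>) integrable_on {\<alpha>..\<beta>}"
              using r by (intro int[of "\<lambda>_. V \<tau>"] continuous_on_const) auto
            show "(\<lambda>t. (V t + e) * \<bar>g t\<bar>) integrable_on {\<alpha>..\<beta>}"
              using r by (intro int contVe) auto
            fix t assume t: "t \<in> {\<alpha>..\<beta>}"
            have "dist t x < d" "dist \<tau> x < d" using t \<tau>(1) \<alpha>\<beta> by (auto simp: dist_real_def)
            then have "dist (V t) (V x) < e / 2" "dist (V \<tau>) (V x) < e / 2"
              using d t \<tau>(1) r by auto
            then have "V \<tau> \<le> V t + e" unfolding dist_real_def by linarith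
            then show "V \<tau> * \<bar>g t\<bar> \<le> (V t + e) * \<bar>g t\<bar>" by (rule mult_right_mono) simp
          qed
          finally show ?thesis .
        qed
      qed
      then show ?case using \<open>0 < d\<close> by blast
    qed
    then show ?thesis using ab by (simp add: P_def)
  qed
  define I where "I = integral {a..b} (\<lambda>x. V x * \<bar>g x\<bar>)"
  define J where "J = integral {a..b} (\<lambda>x. \<bar>g x\<bar>)"
  have bound: "\<bar>G \<bar>w b\<bar> - G \<bar>w a\<bar>\<bar> \<le> I + e * J" if "0 < e" for e
  proof -
    have "integral {a..b} (\<lambda>x. (V x + e) * \<bar>g x\<bar>) = integral {a..b} (\<lambda>x. V x * \<bar>g x\<bar> + e * \<bar>g x\<bar>)"
      by (simp add: distrib_right)
    also have "\<dots> = I + e * J"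
      unfolding I_def J_def using int[OF contV] int[of "\<lambda>_. e"]
      by (subst Henstock_Kurzweil_Integration.integral_add) auto
    finally show ?thesis using approx[OF that] by simp
  qed
  have "\<bar>G \<bar>w b\<bar> - G \<bar>w a\<bar>\<bar> \<le> I"
  proof (rule tendsto_lowerbound)
    show "((\<lambda>e. I + e * J) \<longlongrightarrow> I) (at_right 0)"
      by (auto intro!: tendsto_eq_intros)
    show "\<forall>\<^sub>F e in at_right 0. \<bar>G \<bar>w b\<bar> - G \<bar>w a\<bar>\<bar> \<le> I + e * J"
      using bound by (auto simp: eventually_at_right_field intro!: exI[of _ 1])
  qed simp
  then show ?thesis by (simp add: I_def V_def)
qed

section \<open>The sharp inequality\<close>

text \<open>Weighted means of \<open>t / a\<close> and \<open>(1 - t) / b\<close> with weights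
  \<open>a / (a + b)\<close> and \<open>b / (a + b)\<close>: the arithmetic mean is
  \<open>1 / (a + b)\<close> whatever \<open>t\<close> is. The bound is the value at
  \<open>t = a / (a + b)\<close>.\<close>

lemma powr_mult_le_max:
  fixes a b t :: real
  assumes "0 < a" "0 < b" "0 < t" "t < 1"
  shows "t powr a * (1 - t) powr b \<le> (a / (a + b)) powr a * (b / (a + b)) powr b"
proof -
  have s: "0 < a + b" using assms by simp
  have "(t / a) powr (a / (a + b)) * ((1 - t) / b) powr (b / (a + b))
      \<le> a / (a + b) * (t / a) + b / (a + b) * ((1 - t) / b)"
    by (rule Youngs_inequality_0) (use assms s in \<open>auto simp: add_divide_distrib[symmetric]\<close>)
  also have "\<dots> = 1 / (a + b)"
    using assms s by (simp add: add_divide_distrib[symmetric])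
  finally have "((t / a) powr (a / (a + b)) * ((1 - t) / b) powr (b / (a + b))) powr (a + b) \<le> (1 / (a + b)) powr (a + b)"
    using s assms by (intro powr_mono2) auto
  moreover have "((t / a) powr (a / (a + b)) * ((1 - t) / b) powr (b / (a + b))) powr (a + b) = (t / a) powr a * ((1 - t) / b) powr b"
    using s by (simp add: powr_mult powr_powr)
  ultimately have "a powr a * b powr b * ((t / a) powr a * ((1 - t) / b) powr b) \<le> a powr a * b powr b * (1 / (a + b)) powr (a + b)"
    by (intro mult_left_mono) auto
  moreover have "a powr a * b powr b * ((t / a) powr a * ((1 - t) / b) powr b) = t powr a * (1 - t) powr b"
    using assms by (simp add: powr_divide)
  moreover have "a powr a * b powr b * (1 / (a + b)) powr (a + b) = (a / (a + b)) powr a * (b / (a + b)) powr b"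
    using assms s by (simp add: powr_divide powr_add)
  ultimately show ?thesis by simp
qed

lemma interval_integral_le_lebesgue:
  fixes f :: "real \<Rightarrow> real"
  assumes f: "integrable lebesgue f" and nn: "\<And>x. 0 \<le> f x"
  shows "integral {y..z} f \<le> (\<integral>x. f x \<partial>lebesgue)"
proof -
  have i: "integrable lebesgue (\<lambda>x. indicator {y..z} x *\<^sub>R f x)"
    using f by (intro integrable_mult_indicator) auto
  then have "set_integrable lebesgue {y..z} f"
    by (simp only: set_integrable_def)
  from set_lebesgue_integral_eq_integral(2)[OF this]
  have "integral {y..z} f = (\<integral>x. indicator {y..z} x *\<^sub>R f x \<partial>lebesgue)"
    by (simp only: set_lebesgue_integral_def)
  moreover have "(\<integral>x. indicator {y..z} x *\<^sub>R f x \<partial>lebesgue) \<le> (\<integral>x. f x \<partial>lebesgue)"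
    by (rule Bochner_Integration.integral_mono[OF i f]) (use nn in \<open>auto simp: indicator_def\<close>)
  ultimately show ?thesis by simp
qed

lemma in_Lp_AE_cong:
  assumes "in_Lp s u" "w \<in> borel_measurable lebesgue" "AE x in lebesgue. u x = w x"
  shows "in_Lp s w" and "Lp_norm s u = Lp_norm s w"
proof -
  have um: "u \<in> borel_measurable lebesgue" and ui: "integrable lebesgue (\<lambda>x. \<bar>u x\<bar> powr s)"
    using assms by (auto simp: in_Lp_def)
  have ae: "AE x in lebesgue. \<bar>u x\<bar> powr s = \<bar>w x\<bar> powr s"
    using assms(3) by eventually_elim simp
  have "integrable lebesgue (\<lambda>x. \<bar>w x\<bar> powr s)"
    by (rule integrable_cong_AE_imp[OF ui]) (use assms(2) ae in \<open>auto elim: eventually_mono\<close>)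
  then show "in_Lp s w" using assms by (simp add: in_Lp_def)
  have "(\<integral>x. \<bar>u x\<bar> powr s \<partial>lebesgue) = (\<integral>x. \<bar>w x\<bar> powr s \<partial>lebesgue)"
    by (rule integral_cong_AE) (use um assms(2) ae in auto)
  then show "Lp_norm s u = Lp_norm s w" by (simp add: Lp_norm_def)
qed

text \<open>Otherwise \<open>f\<close> would be at least \<open>e\<close> on intervals of every
  length. This serves in place of decay at infinity: the path only has to start and end near
  0.\<close>

lemma integrable_arbitrarily_small:
  fixes f :: "real \<Rightarrow> real"
  assumes f: "integrable lebesgue f" and nn: "\<And>x. 0 \<le> f x" and e: "0 < e"
  shows "\<exists>y\<le>x. f y < e" and "\<exists>z\<ge>x. f z < e"
proof -
  have large: "e * real n \<le> (\<integral>t. f t \<partial>lebesgue)" if "\<And>t. t \<in> {a..a + real n} \<Longrightarrow> e \<le> f t" for a n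
  proof -
    have "(\<integral>t. e * indicator {a..a + real n} t \<partial>lebesgue) \<le> (\<integral>t. f t \<partial>lebesgue)"
    proof (rule Bochner_Integration.integral_mono[OF _ f])
      show "integrable lebesgue (\<lambda>t. e * indicator {a..a + real n} t)"
        by (intro integrable_mult_right integrable_real_indicator) (auto simp: emeasure_completion)
      show "e * indicator {a..a + real n} t \<le> f t" for t
        using that[of t] nn[of t] by (auto simp: indicator_def)
    qed
    then show ?thesis by (simp add: measure_completion)
  qed
  obtain n where n: "(\<integral>t. f t \<partial>lebesgue) / e < real n" using reals_Archimedean2 by blast
  then have n: "(\<integral>t. f t \<partial>lebesgue) < e * real n"
    using e by (simp add: pos_divide_less_eq mult.commute)
  show "\<exists>y\<le>x. f y < e"
  proof (rule ccontr)
    assume "\<not> (\<exists>y\<le>x. f y < e)"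
    then have "e \<le> f t" if "t \<in> {x - real n..x - real n + real n}" for t
      using that by (auto simp: not_less)
    from large[of "x - real n" n, OF this] n show False by simp
  qed
  show "\<exists>z\<ge>x. f z < e"
  proof (rule ccontr)
    assume "\<not> (\<exists>z\<ge>x. f z < e)"
    then have "e \<le> f t" if "t \<in> {x..x + real n}" for t
      using that by (auto simp: not_less)
    from large[of x n, OF this] n show False by simp
  qed
qed

context gn_exponents
begin

text \<open>The weight needs a finite supremum, so boundedness comes first, from the same Hoelder
  argument with a plain power in place of the weight. Boundedness also controls the power
  \<open>m + 1\<close> by the power \<open>q + 1\<close>. The remaining estimate takes
  \<open>M\<close> to be the supremum of \<open>\<bar>w\<bar>\<close>.\<close>

lemma GN_core:
  fixes w g :: "real \<Rightarrow> real"
  assumes w: "\<And>a b. a \<le> b \<Longrightarrow> w b - w a = integral {a..b} g"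
    and ga: "\<And>a b. g absolutely_integrable_on {a..b}"
    and Lw: "in_Lp (q + 1) w" and Lg: "in_Lp p g"
  shows "in_Lp (m + 1) w"
    and "(\<forall>x. w x = 0) \<or> (\<exists>M>0.
       0 \<le> (\<integral>x. \<bar>w x\<bar> powr (q + 1) \<partial>lebesgue) - M powr (q - m) * (\<integral>x. \<bar>w x\<bar> powr (m + 1) \<partial>lebesgue) \<and>
       K * M powr (\<eta>2 / p) \<le> (\<integral>x. \<bar>g x\<bar> powr p \<partial>lebesgue) powr (1 / p) *
       ((\<integral>x. \<bar>w x\<bar> powr (q + 1) \<partial>lebesgue) - M powr (q - m) * (\<integral>x. \<bar>w x\<bar> powr (m + 1) \<partial>lebesgue)) powr ((p - 1) / p))"
proof -
  have wm: "w \<in> borel_measurable lebesgue" and iw: "integrable lebesgue (\<lambda>x. \<bar>w x\<bar> powr (q + 1))"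
    using Lw by (auto simp: in_Lp_def)
  have gm: "g \<in> borel_measurable lebesgue" and ig: "integrable lebesgue (\<lambda>x. \<bar>g x\<bar> powr p)"
    using Lg by (auto simp: in_Lp_def)
  have conj: "1 / p + 1 / (p / (p - 1)) = 1" using p by (simp add: field_simps)
  have small: "\<exists>y\<le>x. \<bar>w y\<bar> < e" "\<exists>z\<ge>x. \<bar>w z\<bar> < e" if "0 < e" for x e
  proof -
    have e: "0 < e powr (q + 1)" using that by simp
    have "\<bar>w y\<bar> < e" if "\<bar>w y\<bar> powr (q + 1) < e powr (q + 1)" for y
      using that q \<open>0 < e\<close> powr_mono2[of "q + 1" e "\<bar>w y\<bar>"] by (meson abs_ge_zero add_pos_pos less_imp_le linorder_not_le zero_less_one)
    then show "\<exists>y\<le>x. \<bar>w y\<bar> < e" "\<exists>z\<ge>x. \<bar>w z\<bar> < e"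
      using integrable_arbitrarily_small[OF iw _ e] by (metis powr_ge_zero)+
  qed
  have contw: "continuous_on {a..b} w" for a b
    by (rule continuous_on_indefinite_integral[OF ga]) (use w in auto)
  have "\<exists>M0. \<forall>x. \<bar>w x\<bar> \<le> M0"
  proof -
    \<comment> \<open>Chosen so that the conjugate power \<open>p / (p - 1)\<close> of
      \<open>\<bar>w\<bar> powr \<sigma>\<close> is \<open>\<bar>w\<bar> powr (q + 1)\<close>, whose
      integral is finite.\<close>
    define \<sigma> where "\<sigma> = (q + 1) * ((p - 1) / p)"
    have \<sigma>: "0 < \<sigma>" using p q by (simp add: \<sigma>_def)
    have hp: "\<bar>\<bar>w x\<bar> powr \<sigma>\<bar> powr (p / (p - 1)) = \<bar>w x\<bar> powr (q + 1)" for x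
      using p by (simp add: \<sigma>_def powr_powr)
    have int: "integrable lebesgue (\<lambda>x. \<bar>g x\<bar> * \<bar>\<bar>w x\<bar> powr \<sigma>\<bar>)"
      by (rule Holder_inequality_real(1)[OF p conj gm _ ig]) (use wm iw hp in auto)
    define I where "I = (\<integral>x. \<bar>g x\<bar> * \<bar>\<bar>w x\<bar> powr \<sigma>\<bar> \<partial>lebesgue)"
    have "\<bar>w x\<bar> powr (\<sigma> + 1) \<le> 1 + (\<sigma> + 1) * I" for x
    proof -
      obtain y where y: "y \<le> x" "\<bar>w y\<bar> < 1" using small(1)[of 1] by auto
      obtain N where N: "\<And>t. t \<in> {y..x} \<Longrightarrow> \<bar>w t\<bar> \<le> N"
        using compact_imp_bounded[OF compact_continuous_image[OF contw[of y x]]]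
        unfolding bounded_iff by fastforce
      have "\<bar>\<bar>w x\<bar> powr (\<sigma> + 1) / (\<sigma> + 1) - \<bar>w y\<bar> powr (\<sigma> + 1) / (\<sigma> + 1)\<bar> \<le>
          integral {y..x} (\<lambda>t. \<bar>w t\<bar> powr \<sigma> * \<bar>g t\<bar>)"
      proof (rule chain_rule_bound_abs[where G="\<lambda>s. s powr (\<sigma> + 1) / (\<sigma> + 1)" and W="\<lambda>s. s powr \<sigma>" and M=N, OF y(1) ga])
        show "continuous_on {0..N} (\<lambda>s. s powr (\<sigma> + 1) / (\<sigma> + 1))"
          using \<sigma> by (intro continuous_intros continuous_on_powr') auto
        show "continuous_on {0..N} (\<lambda>s. s powr \<sigma>)"
          using \<sigma> by (intro continuous_intros continuous_on_powr') auto
        show "((\<lambda>s. s powr (\<sigma> + 1) / (\<sigma> + 1)) has_real_derivative s powr \<sigma>) (at s)" if "0 < s" for s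
          using that \<sigma> by (auto intro!: derivative_eq_intros)
      qed (use w N in auto)
      also have "\<dots> \<le> I"
        using interval_integral_le_lebesgue[OF int] unfolding I_def by (simp add: mult.commute)
      finally have "\<bar>w x\<bar> powr (\<sigma> + 1) / (\<sigma> + 1) \<le> I + \<bar>w y\<bar> powr (\<sigma> + 1) / (\<sigma> + 1)" by linarith
      also have "\<dots> \<le> I + 1 / (\<sigma> + 1)"
        using y \<sigma> powr_le1[of "\<sigma> + 1" "\<bar>w y\<bar>"] by (intro add_left_mono divide_right_mono) auto
      finally have "\<bar>w x\<bar> powr (\<sigma> + 1) \<le> (I + 1 / (\<sigma> + 1)) * (\<sigma> + 1)"
        using \<sigma> by (subst (asm) pos_divide_le_eq) auto
      also have "\<dots> = 1 + (\<sigma> + 1) * I"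
        using \<sigma> by (simp add: field_simps)
      finally show ?thesis .
    qed
    then have "\<bar>w x\<bar> \<le> (1 + (\<sigma> + 1) * I) powr (1 / (\<sigma> + 1))" for x
      using \<sigma> powr_mono2[of "1 / (\<sigma> + 1)" "\<bar>w x\<bar> powr (\<sigma> + 1)"] by (fastforce simp: powr_powr)
    then show ?thesis by blast
  qed
  then obtain M0 where M0: "\<And>x. \<bar>w x\<bar> \<le> M0" by blast
  define M where "M = (SUP x. \<bar>w x\<bar>)"
  have bdd: "bdd_above (range (\<lambda>x. \<bar>w x\<bar>))" using M0 by (auto intro!: bdd_aboveI)
  have wM: "\<bar>w x\<bar> \<le> M" for x unfolding M_def by (rule cSUP_upper[OF _ bdd]) simp
  have M_nonneg: "0 \<le> M" using wM[of 0] by linarith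
  have iwm: "integrable lebesgue (\<lambda>x. \<bar>w x\<bar> powr (m + 1))"
  proof (rule Bochner_Integration.integrable_bound)
    show "integrable lebesgue (\<lambda>x. M powr (m - q) * \<bar>w x\<bar> powr (q + 1))" using iw by simp
    show "AE x in lebesgue. norm (\<bar>w x\<bar> powr (m + 1)) \<le> norm (M powr (m - q) * \<bar>w x\<bar> powr (q + 1))"
    proof (rule AE_I2)
      fix x
      have "\<bar>w x\<bar> powr (m + 1) = \<bar>w x\<bar> powr (m - q) * \<bar>w x\<bar> powr (q + 1)"
        by (simp add: powr_add[symmetric])
      also have "\<dots> \<le> M powr (m - q) * \<bar>w x\<bar> powr (q + 1)"
        using wM m by (intro mult_right_mono powr_mono2) auto
      finally show "norm (\<bar>w x\<bar> powr (m + 1)) \<le> norm (M powr (m - q) * \<bar>w x\<bar> powr (q + 1))"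
        by simp
    qed
  qed (use wm in auto)
  show "in_Lp (m + 1) w" using wm iwm by (simp add: in_Lp_def)
  show "(\<forall>x. w x = 0) \<or> (\<exists>M>0.
       0 \<le> (\<integral>x. \<bar>w x\<bar> powr (q + 1) \<partial>lebesgue) - M powr (q - m) * (\<integral>x. \<bar>w x\<bar> powr (m + 1) \<partial>lebesgue) \<and>
       K * M powr (\<eta>2 / p) \<le> (\<integral>x. \<bar>g x\<bar> powr p \<partial>lebesgue) powr (1 / p) *
       ((\<integral>x. \<bar>w x\<bar> powr (q + 1) \<partial>lebesgue) - M powr (q - m) * (\<integral>x. \<bar>w x\<bar> powr (m + 1) \<partial>lebesgue)) powr ((p - 1) / p))"
  proof (cases "M = 0")
    case True
    then show ?thesis using wM by simp
  next
    case False
    then have M: "0 < M" using M_nonneg by simp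
    let ?h = "\<lambda>x. weight M \<bar>w x\<bar>"
    let ?v = "\<lambda>x. \<bar>w x\<bar> powr (q + 1) - M powr (q - m) * \<bar>w x\<bar> powr (m + 1)"
    have hp: "\<bar>?h x\<bar> powr (p / (p - 1)) = ?v x" for x
      using weight_base_nonneg[OF M, of "\<bar>w x\<bar>"] wM[of x] p by (simp add: weight_def powr_powr)
    have hm: "?h \<in> borel_measurable lebesgue" unfolding weight_def using wm by measurable
    have iv: "integrable lebesgue ?v" using iw iwm by simp
    have H: "integrable lebesgue (\<lambda>x. \<bar>g x\<bar> * \<bar>?h x\<bar>)"
      "(\<integral>x. \<bar>g x\<bar> * \<bar>?h x\<bar> \<partial>lebesgue) \<le>
         (\<integral>x. \<bar>g x\<bar> powr p \<partial>lebesgue) powr (1 / p) * (\<integral>x. \<bar>?h x\<bar> powr (p / (p - 1)) \<partial>lebesgue) powr (1 / (p / (p - 1)))"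
      by (rule Holder_inequality_real[OF p conj gm hm ig]; use iv hp in simp)+
    define I where "I = (\<integral>x. \<bar>g x\<bar> * \<bar>?h x\<bar> \<partial>lebesgue)"
    have contG: "continuous_on {0..M} (antideriv M)" by (rule antideriv_continuous[OF M])
    have step: "\<bar>antideriv M \<bar>w b\<bar> - antideriv M \<bar>w a\<bar>\<bar> \<le> integral {a..b} (\<lambda>x. \<bar>g x\<bar> * \<bar>?h x\<bar>)" if "a \<le> b" for a b
      using chain_rule_bound_abs[of a b g w M "antideriv M" "weight M", OF that ga w wM contG weight_continuous[OF M] weight_nonneg antideriv_deriv]
      by (simp add: weight_nonneg mult.commute)
    \<comment> \<open>From a point \<open>y\<close> to the left up to \<open>x\<close> and on to a
      point \<open>z\<close> to the right, each leg contributes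
      \<open>antideriv M \<bar>w x\<bar>\<close> up to \<open>e / 2\<close>, by continuity of
      \<open>antideriv M\<close> at 0.\<close>
    have half: "2 * antideriv M \<bar>w x\<bar> \<le> I" for x
    proof (rule field_le_epsilon)
      fix e :: real assume e: "0 < e"
      have "continuous (at 0 within {0..M}) (antideriv M)"
        using contG M by (simp add: continuous_on_eq_continuous_within)
      then obtain d where "0 < d" and d: "\<And>s. s \<in> {0..M} \<Longrightarrow> dist s 0 < d \<Longrightarrow> dist (antideriv M s) (antideriv M 0) < e / 2"
        using e unfolding continuous_within_eps_delta by (metis half_gt_zero)
      obtain y z where yz: "y \<le> x" "x \<le> z" "\<bar>w y\<bar> < d" "\<bar>w z\<bar> < d"
        using small[OF \<open>0 < d\<close>] by blast
      have "antideriv M \<bar>w y\<bar> < e / 2" "antideriv M \<bar>w z\<bar> < e / 2"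
        using d[of "\<bar>w y\<bar>"] d[of "\<bar>w z\<bar>"] wM yz by (auto simp: dist_real_def)
      moreover have "integral {y..x} (\<lambda>x. \<bar>g x\<bar> * \<bar>?h x\<bar>) + integral {x..z} (\<lambda>x. \<bar>g x\<bar> * \<bar>?h x\<bar>) = integral {y..z} (\<lambda>x. \<bar>g x\<bar> * \<bar>?h x\<bar>)"
      proof (rule Henstock_Kurzweil_Integration.integral_combine[OF yz(1,2)])
        have "set_integrable lebesgue {y..z} (\<lambda>x. \<bar>g x\<bar> * \<bar>?h x\<bar>)"
          unfolding set_integrable_def using H(1) by (intro integrable_mult_indicator) auto
        then show "(\<lambda>x. \<bar>g x\<bar> * \<bar>?h x\<bar>) integrable_on {y..z}"
          by (rule set_lebesgue_integral_eq_integral(1))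
      qed
      moreover have "integral {y..z} (\<lambda>x. \<bar>g x\<bar> * \<bar>?h x\<bar>) \<le> I"
        unfolding I_def by (rule interval_integral_le_lebesgue[OF H(1)]) simp
      ultimately show "2 * antideriv M \<bar>w x\<bar> \<le> I + e"
        using step[OF yz(1)] step[OF yz(2)] by linarith
    qed
    \<comment> \<open>The supremum is approached by values of \<open>\<bar>w\<bar>\<close>;
      continuity of \<open>antideriv M\<close> at \<open>M\<close> replaces a maximum point.\<close>
    have "2 * antideriv M M \<le> I"
    proof (rule field_le_epsilon)
      fix e :: real assume e: "0 < e"
      have "continuous (at M within {0..M}) (antideriv M)"
        using contG M by (simp add: continuous_on_eq_continuous_within)
      then obtain d where "0 < d" and d: "\<And>s. s \<in> {0..M} \<Longrightarrow> dist s M < d \<Longrightarrow> dist (antideriv M s) (antideriv M M) < e / 2"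
        using e unfolding continuous_within_eps_delta by (metis half_gt_zero)
      obtain x where "M - d < \<bar>w x\<bar>"
        using less_cSUP_iff[OF _ bdd, of "M - d"] \<open>0 < d\<close> by (auto simp: M_def)
      then have "dist (antideriv M \<bar>w x\<bar>) (antideriv M M) < e / 2"
        using wM[of x] by (intro d) (auto simp: dist_real_def)
      then show "2 * antideriv M M \<le> I + e"
        using half[of x] unfolding dist_real_def by linarith
    qed
    then have "K * M powr (\<eta>2 / p) \<le> I" using antideriv_end[OF M] by simp
    also have "I \<le> (\<integral>x. \<bar>g x\<bar> powr p \<partial>lebesgue) powr (1 / p) * (\<integral>x. ?v x \<partial>lebesgue) powr ((p - 1) / p)"
      using H(2) unfolding I_def hp by simp
    also have v_eq: "(\<integral>x. ?v x \<partial>lebesgue) = (\<integral>x. \<bar>w x\<bar> powr (q + 1) \<partial>lebesgue) - M powr (q - m) * (\<integral>x. \<bar>w x\<bar> powr (m + 1) \<partial>lebesgue)"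
      using iw iwm by simp
    finally have "K * M powr (\<eta>2 / p) \<le> (\<integral>x. \<bar>g x\<bar> powr p \<partial>lebesgue) powr (1 / p) *
       ((\<integral>x. \<bar>w x\<bar> powr (q + 1) \<partial>lebesgue) - M powr (q - m) * (\<integral>x. \<bar>w x\<bar> powr (m + 1) \<partial>lebesgue)) powr ((p - 1) / p)" .
    moreover have "0 \<le> (\<integral>x. ?v x \<partial>lebesgue)"
      by (rule Bochner_Integration.integral_nonneg) (metis hp powr_ge_zero)
    ultimately show ?thesis using M unfolding v_eq by blast
  qed
qed


section \<open>Optimisation over the height and the sharp constant\<close>

definition a_exp :: real where "a_exp = \<eta>2 / (m - q)"
definition l_exp :: real where "l_exp = (m - q) / ((m + 1) * \<eta>2)"
definition \<theta> :: real where "\<theta> = p * (m - q) / ((m + 1) * \<eta>2)"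

text \<open>\<open>K powr p\<close> divided by the maximum of
  \<open>t powr a_exp * (1 - t) powr (p - 1)\<close>. In the variable
  \<open>x = M powr (m - q)\<close> the power \<open>M powr \<eta>2\<close> is
  \<open>x powr a_exp\<close>.\<close>

definition best_base :: real
  where "best_base = K powr p * (a_exp + (p - 1)) powr (a_exp + (p - 1)) /
     (a_exp powr a_exp * (p - 1) powr (p - 1))"

definition best :: real where "best = best_base powr (- l_exp)"

lemma exps_pos: "0 < a_exp" "0 < p - 1" "0 < l_exp" "0 < best_base" "0 < best"
proof -
  show a: "0 < a_exp" using \<eta>_pos m by (simp add: a_exp_def)
  show b: "0 < p - 1" using p by simp
  show "0 < l_exp" using \<eta>_pos m q by (simp add: l_exp_def)
  have "0 < a_exp + (p - 1)" using a b by (rule add_pos_pos)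
  then show "0 < best_base" using a b K_pos by (simp add: best_base_def)
  then show "0 < best" by (simp add: best_def)
qed

lemma a_exp_add: "a_exp + (p - 1) = \<eta>1 / (m - q)"
proof -
  have "a_exp + (p - 1) = (\<eta>2 + (p - 1) * (m - q)) / (m - q)"
    using m by (simp add: a_exp_def add_divide_distrib)
  also have "\<eta>2 + (p - 1) * (m - q) = \<eta>1" by (simp add: \<eta>1_def \<eta>2_def algebra_simps)
  finally show ?thesis .
qed

text \<open>As \<open>a_exp\<close> and \<open>a_exp + (p - 1)\<close> are \<open>\<eta>2\<close>
  and \<open>\<eta>1\<close> over \<open>m - q\<close>, the powers of \<open>m - q\<close> collect
  to the exponent \<open>p + (a_exp + (p - 1)) - a_exp = 2 * p - 1\<close>.\<close>

lemma best_base_eq: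
  "best_base = 2 powr p * (p - 1) powr (1 - p) * \<eta>1 powr (\<eta>1 / (m - q)) /
            ((m - q) powr (2 * p - 1) * \<eta>2 powr (\<eta>2 / (m - q))) *
            Beta (\<eta>2 / (p * (m - q))) ((2 * p - 1) / p) powr p"
proof -
  define k where "k = m - q"
  define E where "E = \<eta>1 / k"
  have k: "0 < k" using m by (simp add: k_def)
  have E: "E = a_exp + (p - 1)" using a_exp_add by (simp add: E_def k_def)
  have a: "a_exp = \<eta>2 / k" by (simp add: a_exp_def k_def)
  have K: "K powr p = 2 powr p / k powr p * Beta (\<eta>2 / (p * (m - q))) ((2 * p - 1) / p) powr p"
    using k by (simp add: K_def k_def powr_mult powr_divide)
  have e1: "(a_exp + (p - 1)) powr (a_exp + (p - 1)) = \<eta>1 powr E / k powr E"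
    using k \<eta>_pos unfolding E[symmetric] by (subst E_def) (simp add: powr_divide)
  have e2: "a_exp powr a_exp = \<eta>2 powr a_exp / k powr a_exp"
    using k \<eta>_pos by (subst a) (simp add: powr_divide)
  have e3: "(p - 1) powr (1 - p) = inverse ((p - 1) powr (p - 1))"
    by (simp add: powr_minus[symmetric])
  have e4: "k powr (2 * p - 1) = k powr p * k powr E / k powr a_exp"
  proof -
    have "2 * p - 1 = p + E - a_exp" by (simp add: E)
    then show ?thesis by (simp only: powr_add powr_diff)
  qed
  have "k powr p \<noteq> 0" "k powr E \<noteq> 0" "k powr a_exp \<noteq> 0" "\<eta>2 powr a_exp \<noteq> 0" "(p - 1) powr (p - 1) \<noteq> 0"
    using k \<eta>_pos p by auto
  then have "best_base = 2 powr p * (p - 1) powr (1 - p) * \<eta>1 powr E / (k powr (2 * p - 1) * \<eta>2 powr a_exp) *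
      Beta (\<eta>2 / (p * (m - q))) ((2 * p - 1) / p) powr p"
    unfolding best_base_def K e1 e2 e3 e4 by (simp add: divide_simps)
  then show ?thesis by (simp add: E_def a_exp_def k_def)
qed

text \<open>Puts the right-hand side under the common power \<open>l_exp\<close>;
  \<open>GN_lhs_eq\<close> does the same for the left. The exponent of \<open>B\<close> comes from
  the identity \<open>(m + 1) * \<eta>2 - p * (m - q) = (q + 1) * \<eta>1\<close>.\<close>

lemma GN_rhs_eq:
  assumes "0 < A" "0 < B"
  shows "best * (B powr (1 / (q + 1))) powr (1 - \<theta>) * (A powr (1 / p)) powr \<theta>
    = (A * B powr (a_exp + (p - 1)) / best_base) powr l_exp"
proof -
  have l: "1 / p * \<theta> = l_exp" using p by (simp add: \<theta>_def l_exp_def)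
  have "(1 - \<theta>) / (q + 1) = (a_exp + (p - 1)) * l_exp"
  proof -
    have nz: "m + 1 \<noteq> 0" "\<eta>2 \<noteq> 0" "q + 1 \<noteq> 0" "m - q \<noteq> 0" using q m \<eta>_pos by auto
    have "1 - \<theta> = ((m + 1) * \<eta>2 - p * (m - q)) / ((m + 1) * \<eta>2)"
      using nz by (simp add: \<theta>_def diff_divide_distrib)
    also have "(m + 1) * \<eta>2 - p * (m - q) = (q + 1) * \<eta>1"
      by (simp add: \<eta>1_def \<eta>2_def algebra_simps)
    finally have "(1 - \<theta>) / (q + 1) = \<eta>1 / ((m + 1) * \<eta>2)" using nz by simp
    moreover have "\<eta>1 / (m - q) * l_exp = \<eta>1 / ((m + 1) * \<eta>2)" using nz by (simp add: l_exp_def)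
    ultimately show ?thesis by (simp add: a_exp_add)
  qed
  then have e: "1 / (q + 1) * (1 - \<theta>) = (a_exp + (p - 1)) * l_exp" by simp
  have "best = inverse (best_base powr l_exp)" by (simp add: best_def powr_minus)
  moreover have "(A * B powr (a_exp + (p - 1)) / best_base) powr l_exp =
      A powr l_exp * B powr ((a_exp + (p - 1)) * l_exp) / best_base powr l_exp"
    using assms exps_pos by (simp add: powr_divide powr_mult powr_powr)
  ultimately show ?thesis
    unfolding powr_powr l e by (simp add: divide_inverse mult_ac)
qed

lemma GN_lhs_eq: "D powr (1 / (m + 1)) = (D powr a_exp) powr l_exp"
proof -
  have "a_exp * l_exp = 1 / (m + 1)"
    using q m \<eta>_pos by (simp add: a_exp_def l_exp_def)
  then show ?thesis by (simp add: powr_powr)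
qed

lemma GN_substitution:
  assumes "0 < B" "0 < D" "0 < x"
  shows "x powr a_exp = D powr a_exp / ((D / (x * B)) powr a_exp * B powr a_exp)"
    and "B - D / x = B * (1 - D / (x * B))"
  using assms by (auto simp: powr_divide powr_mult field_simps)

text \<open>Writing \<open>t = D / (x * B)\<close> eliminates the unknown \<open>x\<close>: the
  hypothesis becomes a bound of \<open>K powr p * D powr a_exp\<close> by
  \<open>A * B powr (a_exp + (p - 1))\<close> times
  \<open>t powr a_exp * (1 - t) powr (p - 1)\<close>, whose maximum is known.\<close>

lemma GN_optimise:
  assumes pos: "0 < A" "0 < B" "0 < D" "0 < x" "0 < B - D / x"
    and le: "K powr p * x powr a_exp \<le> A * (B - D / x) powr (p - 1)"
  shows "D powr a_exp \<le> A * B powr (a_exp + (p - 1)) / best_base"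
proof -
  define t where "t = D / (x * B)"
  define b where "b = p - 1"
  have b: "0 < b" using p by (simp add: b_def)
  note a = exps_pos(1)
  have t0: "0 < t" using pos by (simp add: t_def)
  have t1: "t < 1" using pos by (simp add: t_def field_simps)
  have "K powr p * (D powr a_exp / (t powr a_exp * B powr a_exp)) \<le> A * (B * (1 - t)) powr b"
    using le GN_substitution[OF pos(2,3,4)] by (simp add: t_def b_def)
  then have "K powr p * D powr a_exp \<le> A * (B * (1 - t)) powr b * (t powr a_exp * B powr a_exp)"
    using t0 pos by (simp add: pos_divide_le_eq)
  also have "\<dots> = A * B powr (a_exp + b) * (t powr a_exp * (1 - t) powr b)"
    using t1 pos by (simp add: powr_mult powr_add)
  also have "\<dots> \<le> A * B powr (a_exp + b) * ((a_exp / (a_exp + b)) powr a_exp * (b / (a_exp + b)) powr b)"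
    using powr_mult_le_max[OF a b t0 t1] pos by (intro mult_left_mono) auto
  also have "\<dots> = A * B powr (a_exp + b) / best_base * K powr p"
    using a b K_pos by (simp add: best_base_def b_def[symmetric] powr_divide powr_add)
  finally have "K powr p * D powr a_exp \<le> A * B powr (a_exp + b) / best_base * K powr p" .
  moreover have "s \<le> t" if "k * s \<le> t * k" "0 < k" for k s t :: real
    using that by (simp add: mult.commute)
  moreover have "0 < K powr p" using K_pos by simp
  ultimately show ?thesis unfolding b_def by blast
qed

text \<open>The condition \<open>crit\<close> says that \<open>t = D / (x * B)\<close> is the
  maximiser \<open>a_exp / (a_exp + (p - 1))\<close>, so every step of \<open>GN_optimise\<close> is
  an equality.\<close>

lemma GN_optimal:
  assumes pos: "0 < A" "0 < B" "0 < D" "0 < x"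
    and eq: "K powr p * x powr a_exp = A * (B - D / x) powr (p - 1)"
    and crit: "D * (a_exp + (p - 1)) = x * B * a_exp"
  shows "D powr a_exp = A * B powr (a_exp + (p - 1)) / best_base"
proof -
  define b where "b = p - 1"
  have b: "0 < b" using p by (simp add: b_def)
  note a = exps_pos(1)
  define t where "t = D / (x * B)"
  have t: "t = a_exp / (a_exp + b)" "1 - t = b / (a_exp + b)"
    using crit pos a b by (auto simp: t_def b_def[symmetric] field_simps)
  have tp: "0 < t" "0 < 1 - t" using a b by (auto simp: t)
  have "K powr p * (D powr a_exp / (t powr a_exp * B powr a_exp)) = A * (B * (1 - t)) powr b"
    using eq GN_substitution[OF pos(2,3,4)] by (simp add: t_def b_def)
  then have "K powr p * D powr a_exp = A * (B * (1 - t)) powr b * (t powr a_exp * B powr a_exp)"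
    using tp pos by (simp add: divide_eq_eq)
  also have "\<dots> = A * B powr (a_exp + b) * (t powr a_exp * (1 - t) powr b)"
    using tp pos by (simp add: powr_mult powr_add)
  also have "\<dots> = A * B powr (a_exp + b) / best_base * K powr p"
    unfolding t(2) unfolding t(1) using a b K_pos by (simp add: best_base_def b_def[symmetric] powr_divide powr_add)
  finally have "K powr p * D powr a_exp = A * B powr (a_exp + b) / best_base * K powr p" .
  moreover have "s = t" if "k * s = t * k" "0 < k" for k s t :: real
    using that by (simp add: mult.commute)
  moreover have "0 < K powr p" using K_pos by simp
  ultimately show ?thesis unfolding b_def by blast
qed

lemma GN_best: "GN_inequality q m p best"
proof -
  have "in_Lp (m + 1) u \<and>
        Lp_norm (m + 1) u \<le> best * Lp_norm (q + 1) u powr (1 - \<theta>) * Lp_norm p g powr \<theta>"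
    if Lu: "in_Lp (q + 1) u" and Lg: "in_Lp p g" and weak: "has_weak_derivative u g" for u g
  proof -
    obtain w where ae: "AE x in lebesgue. u x = w x" and w: "\<And>a b. a \<le> b \<Longrightarrow> w b - w a = integral {a..b} g"
      using weak_derivative_representative[OF weak] by blast
    have ga: "g absolutely_integrable_on {a..b}" for a b
      using weak by (auto simp: has_weak_derivative_def locally_integrable_def)
    have "isCont w x" for x
    proof -
      have "continuous_on {x-1..x+1} w"
        by (rule continuous_on_indefinite_integral[OF ga]) (use w in auto)
      then show ?thesis by (rule continuous_on_interior) (simp add: interior_atLeastAtMost_real)
    qed
    then have "w \<in> borel_measurable borel"
      by (intro borel_measurable_continuous_onI continuous_at_imp_continuous_on) auto
    then have wm: "w \<in> borel_measurable lebesgue" by (intro measurable_completion) simp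
    have ae': "AE x in lebesgue. w x = u x" using ae by eventually_elim simp
    note Lw = in_Lp_AE_cong[OF Lu wm ae]
    note core = GN_core[OF w ga Lw(1) Lg]
    have um: "u \<in> borel_measurable lebesgue" using Lu by (simp add: in_Lp_def)
    note Lm = in_Lp_AE_cong[OF core(1) um ae']
    define A where "A = (\<integral>x. \<bar>g x\<bar> powr p \<partial>lebesgue)"
    define B where "B = (\<integral>x. \<bar>w x\<bar> powr (q + 1) \<partial>lebesgue)"
    define D where "D = (\<integral>x. \<bar>w x\<bar> powr (m + 1) \<partial>lebesgue)"
    have "D powr (1 / (m + 1)) \<le> best * (B powr (1 / (q + 1))) powr (1 - \<theta>) * (A powr (1 / p)) powr \<theta>"
      using core(2)
    proof
      assume "\<forall>x. w x = 0"
      then have "D = 0" by (simp add: D_def)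
      then show ?thesis using exps_pos(5) by simp
    next
      assume "\<exists>M>0. 0 \<le> (\<integral>x. \<bar>w x\<bar> powr (q + 1) \<partial>lebesgue) - M powr (q - m) * (\<integral>x. \<bar>w x\<bar> powr (m + 1) \<partial>lebesgue) \<and>
       K * M powr (\<eta>2 / p) \<le> (\<integral>x. \<bar>g x\<bar> powr p \<partial>lebesgue) powr (1 / p) *
       ((\<integral>x. \<bar>w x\<bar> powr (q + 1) \<partial>lebesgue) - M powr (q - m) * (\<integral>x. \<bar>w x\<bar> powr (m + 1) \<partial>lebesgue)) powr ((p - 1) / p)"
      then obtain M where M: "0 < M" and Q0: "0 \<le> B - M powr (q - m) * D"
        and le: "K * M powr (\<eta>2 / p) \<le> A powr (1 / p) * (B - M powr (q - m) * D) powr ((p - 1) / p)"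
        unfolding A_def B_def D_def by blast
      define x where "x = M powr (m - q)"
      have x: "0 < x" using M by (simp add: x_def)
      have Q_eq: "B - M powr (q - m) * D = B - D / x"
      proof -
        have "M powr (q - m) = inverse x" unfolding x_def by (simp add: powr_minus[symmetric])
        then show ?thesis by (simp add: divide_inverse mult.commute)
      qed
      have lhs: "0 < K * M powr (\<eta>2 / p)" using K_pos M by simp
      have A0: "0 \<le> A" unfolding A_def by (rule Bochner_Integration.integral_nonneg) simp
      \<comment> \<open>The left-hand side of \<open>le\<close> is positive and a zero base has
        power 0, so neither factor on the right can vanish.\<close>
      have A: "0 < A" using A0 le lhs by (cases "A = 0") auto
      have Q: "0 < B - D / x" using Q0 le lhs unfolding Q_eq by (cases "B - D / x = 0") auto
      have "0 \<le> D" unfolding D_def by (rule Bochner_Integration.integral_nonneg) simp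
      \<comment> \<open>If \<open>D\<close> were 0, then \<open>w\<close> would vanish almost
        everywhere and \<open>B\<close> would be 0 too, contradicting \<open>Q\<close>.\<close>
      have D: "0 < D"
      proof (rule ccontr)
        assume "\<not> 0 < D"
        then have "D = 0" using \<open>0 \<le> D\<close> by simp
        have iwm: "integrable lebesgue (\<lambda>x. \<bar>w x\<bar> powr (m + 1))" using core(1) by (simp add: in_Lp_def)
        have "AE x in lebesgue. \<bar>w x\<bar> powr (m + 1) = 0"
          using integral_nonneg_eq_0_iff_AE[OF iwm] \<open>D = 0\<close> unfolding D_def by simp
        then have "AE x in lebesgue. \<bar>w x\<bar> powr (q + 1) = 0" by eventually_elim simp
        then have "B = 0" unfolding B_def by (rule integral_eq_zero_AE)
        then show False using Q \<open>D = 0\<close> by simp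
      qed
      have B: "0 < B" using Q D x by (smt (verit) divide_pos_pos)
      \<comment> \<open>The p-th power clears the fractional exponents and turns the estimate into
        the form that \<open>GN_optimise\<close> expects.\<close>
      have "(K * M powr (\<eta>2 / p)) powr p \<le> (A powr (1 / p) * (B - D / x) powr ((p - 1) / p)) powr p"
        using le lhs p unfolding Q_eq by (intro powr_mono2) auto
      moreover have "(K * M powr (\<eta>2 / p)) powr p = K powr p * x powr a_exp"
        using p m by (simp add: powr_mult powr_powr x_def a_exp_def)
      moreover have "(A powr (1 / p) * (B - D / x) powr ((p - 1) / p)) powr p = A * (B - D / x) powr (p - 1)"
        using p A by (simp add: powr_mult powr_powr)
      ultimately have "D powr a_exp \<le> A * B powr (a_exp + (p - 1)) / best_base"
        by (intro GN_optimise[OF A B D x Q]) simp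
      then show ?thesis
        unfolding GN_rhs_eq[OF A B] GN_lhs_eq using exps_pos(3) by (intro powr_mono2) auto
    qed
    then have "Lp_norm (m + 1) w \<le> best * Lp_norm (q + 1) w powr (1 - \<theta>) * Lp_norm p g powr \<theta>"
      by (simp add: Lp_norm_def A_def B_def D_def)
    then show ?thesis using Lw(2) Lm by simp
  qed
  then show ?thesis
    unfolding GN_inequality_def Let_def \<theta>_def \<eta>2_def by blast
qed

section \<open>Extremality of the free boundary solution\<close>

lemma sol'_outside: "radius \<le> \<bar>r\<bar> \<Longrightarrow> sol' r = 0"
  by (simp add: sol'_def sol_outside)

text \<open>\<open>sol\<close> has a continuous derivative everywhere and vanishes at
  \<open>radius\<close> and \<open>- radius\<close>, so integration by parts leaves no boundary
  terms.\<close>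

lemma sol_weak_derivative: "has_weak_derivative sol sol'"
  unfolding has_weak_derivative_def
proof (intro conjI allI impI)
  show "locally_integrable sol" "locally_integrable sol'"
    unfolding locally_integrable_def
    by (intro allI absolutely_integrable_continuous_real continuous_on_subset[OF sol_continuous]
          continuous_on_subset[OF sol'_continuous] subset_UNIV)+
  fix \<phi> assume "test_function \<phi>"
  then have d: "(deriv ^^ n) \<phi> differentiable (at x)" for n x
    by (simp add: test_function_def)
  have \<phi>: "(\<phi> has_real_derivative deriv \<phi> x) (at x)" for x
    using d[of 0 x] DERIV_deriv_iff_real_differentiable by auto
  have \<phi>': "(deriv \<phi> has_real_derivative deriv (deriv \<phi>) x) (at x)" for x
    using d[of 1 x] DERIV_deriv_iff_real_differentiable by auto
  have cont: "continuous_on UNIV \<phi>" "continuous_on UNIV (deriv \<phi>)"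
    by (rule DERIV_continuous_on, rule has_field_derivative_at_within[OF \<phi>])
       (rule DERIV_continuous_on, rule has_field_derivative_at_within[OF \<phi>'])
  have c1: "continuous_on UNIV (\<lambda>x. sol x * deriv \<phi> x)" and c2: "continuous_on UNIV (\<lambda>x. sol' x * \<phi> x)"
    by (intro continuous_intros sol_continuous sol'_continuous cont)+
  note cs1 = lebesgue_integral_compact_support[of _ radius, OF c1]
  note cs2 = lebesgue_integral_compact_support[of _ radius, OF c2]
  have "((\<lambda>x. sol' x * \<phi> x + deriv \<phi> x * sol x) has_integral
      (sol radius * \<phi> radius - sol (- radius) * \<phi> (- radius))) {- radius..radius}"
  proof (rule fundamental_theorem_of_calculus)
    show "((\<lambda>x. sol x * \<phi> x) has_vector_derivative sol' x * \<phi> x + deriv \<phi> x * sol x) (at x within {- radius..radius})" for x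
      by (rule has_vector_derivative_at_within)
         (use DERIV_mult[OF sol_deriv[of x] \<phi>[of x]] in
           \<open>simp only: has_real_derivative_iff_has_vector_derivative\<close>)
  qed (use radius_pos in simp)
  then have "integral {- radius..radius} (\<lambda>x. sol' x * \<phi> x + sol x * deriv \<phi> x) = 0"
    using radius_pos by (simp add: sol_outside integral_unique mult.commute)
  moreover have "integral {- radius..radius} (\<lambda>x. sol' x * \<phi> x + sol x * deriv \<phi> x) =
      integral {- radius..radius} (\<lambda>x. sol' x * \<phi> x) + integral {- radius..radius} (\<lambda>x. sol x * deriv \<phi> x)"
    by (rule Henstock_Kurzweil_Integration.integral_add) (auto intro!: cs1(3) cs2(3) simp: sol_outside sol'_outside)
  ultimately show "(\<integral>x. sol x * deriv \<phi> x \<partial>lebesgue) = - (\<integral>x. sol' x * \<phi> x \<partial>lebesgue)"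
    using cs1(2) cs2(2) by (simp add: sol_outside sol'_outside)
qed

text \<open>The first integral and the equation tested with \<open>sol\<close> are two linear
  relations between the three integrals. Eliminating \<open>intA\<close> gives
  \<open>intD * \<eta>1 * (q + 1) = intB * \<eta>2 * (m + 1)\<close>, the condition for the
  maximiser at \<open>x = height powr (m - q)\<close>. The last claim is the p-th power of
  \<open>potential_integral_K\<close>. Positivity starts from \<open>K\<close> and passes through
  the integral of the potential to \<open>intA\<close>, \<open>intD\<close> and
  \<open>intB\<close>.\<close>

lemma sol_integrals_pos: "0 < intA" "0 < intB" "0 < intD"
  and sol_critical: "intD * (a_exp + (p - 1)) = height powr (m - q) * intB * a_exp"
  and sol_equality: "K powr p * (height powr (m - q)) powr a_exp =
      intA * (intB - intD / height powr (m - q)) powr (p - 1)"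
proof -
  define P where "P = intB / (q + 1) - intD / (m + 1)"
  define c where "c = p / (p - 1)"
  have c: "0 < c" using p by (simp add: c_def)
  have q1: "0 < q + 1" "0 < m + 1" using q m by auto
  have KP: "c powr (1 / p) * (q + 1) powr ((p - 1) / p) * P = K * height powr (\<eta>2 / p)"
    using potential_integral_K unfolding potential_integral_eq P_def c_def .
  have "0 < K * height powr (\<eta>2 / p)" using K_pos height_pos by simp
  then have "0 < c powr (1 / p) * (q + 1) powr ((p - 1) / p) * P" by (simp only: KP)
  moreover have "0 < c powr (1 / p) * (q + 1) powr ((p - 1) / p)" using c q1 by simp
  ultimately have P: "0 < P" by (rule zero_less_mult_pos)
  have A: "intA = c * P" using intA_eq by (simp add: P_def c_def)
  show Apos: "0 < intA" using A P c by simp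
  have B0: "0 \<le> intB" unfolding intB_def by (rule Bochner_Integration.integral_nonneg) simp
  show Dpos: "0 < intD" using B0 Apos intB_intD_intA by simp
  have crit: "intD * \<eta>1 * (q + 1) = intB * \<eta>2 * (m + 1)"
  proof -
    have "(p - 1) * (q + 1) * (m + 1) * (intD - intB) = p * (intB * (m + 1) - intD * (q + 1))"
    proof -
      have "X * Q * N * (p / X * (B / Q - D / N)) = p * (B * N - D * Q)"
        if "X \<noteq> 0" "Q \<noteq> 0" "N \<noteq> 0" for X Q N B D :: real
        using that by (simp add: field_simps)
      moreover have "intD - intB = p / (p - 1) * (intB / (q + 1) - intD / (m + 1))"
        unfolding intA_eq[symmetric] using intB_intD_intA by simp
      moreover have "p - 1 \<noteq> 0" "q + 1 \<noteq> 0" "m + 1 \<noteq> 0" using p q1 by auto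
      ultimately show ?thesis by (simp only:)
    qed
    then show ?thesis by (simp add: \<eta>1_def \<eta>2_def algebra_simps)
  qed
  show Bpos: "0 < intB"
  proof -
    have "0 < intB * \<eta>2 * (m + 1)" unfolding crit[symmetric] using Dpos \<eta>_pos q1 by simp
    then show ?thesis using \<eta>_pos q1 by (simp add: zero_less_mult_iff)
  qed
  show "intD * (a_exp + (p - 1)) = height powr (m - q) * intB * a_exp"
  proof -
    have "D * (e1 / k) = N / Q * B * (e2 / k)" if "D * e1 * Q = B * e2 * N" "Q \<noteq> 0" "k \<noteq> 0"
      for D B Q N e1 e2 k :: real
      using that by (simp add: field_simps)
    from this[OF crit] show ?thesis
      unfolding a_exp_add height_powr unfolding a_exp_def using q1 m by simp
  qed
  have Q: "intB - intD / height powr (m - q) = (q + 1) * P"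
  proof -
    have "B - D / (N / Q) = Q * (B / Q - D / N)" if "Q \<noteq> 0" "N \<noteq> 0" for B D N Q :: real
      using that by (simp add: field_simps)
    then show ?thesis unfolding height_powr P_def using q1 by simp
  qed
  have "K powr p * (height powr (m - q)) powr a_exp = (K * height powr (\<eta>2 / p)) powr p"
    using p m by (simp add: powr_mult powr_powr a_exp_def)
  also have "\<dots> = (c powr (1 / p) * (q + 1) powr ((p - 1) / p) * P) powr p"
    by (simp only: KP)
  also have "\<dots> = c * (q + 1) powr (p - 1) * P powr p"
    using p c by (simp add: powr_mult powr_powr)
  also have "\<dots> = (c * P) * ((q + 1) * P) powr (p - 1)"
  proof -
    have "P powr p = P powr 1 * P powr (p - 1)"
      by (simp only: powr_add[symmetric]) simp
    then show ?thesis using P by (simp add: powr_mult)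
  qed
  finally show "K powr p * (height powr (m - q)) powr a_exp =
      intA * (intB - intD / height powr (m - q)) powr (p - 1)"
    unfolding Q A .
qed

text \<open>For \<open>sol\<close> the inequality with constant \<open>best\<close> is an equality
  between positive numbers, so a smaller constant fails on it.\<close>

lemma best_le:
  assumes "GN_inequality q m p C"
  shows "best \<le> C"
proof -
  note pos = sol_integrals_pos
  have x: "0 < height powr (m - q)" using height_pos by simp
  have sm: "sol \<in> borel_measurable lebesgue" "sol' \<in> borel_measurable lebesgue"
    using borel_measurable_continuous_onI[OF sol_continuous] borel_measurable_continuous_onI[OF sol'_continuous]
    by (auto intro: measurable_completion)
  have "in_Lp (q + 1) sol" "in_Lp p sol'"
    using sm sol_powr_integral(1)[of "q + 1"] integrable_sol'_powr q by (auto simp: in_Lp_def)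
  with assms sol_weak_derivative
  have "Lp_norm (m + 1) sol \<le> C * Lp_norm (q + 1) sol powr (1 - \<theta>) * Lp_norm p sol' powr \<theta>"
    unfolding GN_inequality_def Let_def \<theta>_def \<eta>2_def by blast
  then have le: "intD powr (1 / (m + 1)) \<le> C * ((intB powr (1 / (q + 1))) powr (1 - \<theta>) * (intA powr (1 / p)) powr \<theta>)"
    unfolding Lp_norm_def intA_def[symmetric] intB_def[symmetric] intD_def[symmetric] by (simp add: mult.assoc)
  have "intD powr (1 / (m + 1)) = best * ((intB powr (1 / (q + 1))) powr (1 - \<theta>) * (intA powr (1 / p)) powr \<theta>)"
    unfolding GN_lhs_eq GN_optimal[OF pos x sol_equality sol_critical] GN_rhs_eq[OF pos(1,2), symmetric]
    by (simp add: mult.assoc)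
  with le have "best * ((intB powr (1 / (q + 1))) powr (1 - \<theta>) * (intA powr (1 / p)) powr \<theta>)
      \<le> C * ((intB powr (1 / (q + 1))) powr (1 - \<theta>) * (intA powr (1 / p)) powr \<theta>)" by simp
  then show ?thesis using pos by simp
qed

lemma C_best_eq: "C_best q m p = best"
  unfolding C_best_def by (rule Least_equality) (use GN_best best_le in auto)

section \<open>Closed forms\<close>

lemma ex1_free_boundary_solution: "\<exists>!w. case w of (R, u) \<Rightarrow> free_boundary_solution p q m R u"
proof (rule ex1I[of _ "(radius, sol)"])
  show "case (radius, sol) of (R, u) \<Rightarrow> free_boundary_solution p q m R u"
    using free_boundary_solution_sol by simp
  show "w = (radius, sol)" if "case w of (R, u) \<Rightarrow> free_boundary_solution p q m R u" for w
    using that free_boundary_solution_unique[OF _ free_boundary_solution_sol] by (cases w) auto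
qed

lemma the_free_boundary_solution:
  "(THE w. case w of (R, u) \<Rightarrow> free_boundary_solution p q m R u) = (radius, sol)"
  by (rule the1_equality[OF ex1_free_boundary_solution]) (simp add: free_boundary_solution_sol)

lemma R_c_eq: "R_c p q m = radius" and u_c_eq: "u_c p q m = sol"
  using the_free_boundary_solution by (simp_all add: R_c_def u_c_def)

text \<open>All exponents are expressed by \<alpha>, in particular
  \<open>(p - m - 1) / (p * (m - q)) = \<alpha> - 1 / p\<close>; the rest is symmetry of the Beta
  function.\<close>

lemma radius_eq:
  "radius = ((p - 1) / p) powr (1 / p) *
       ((m + 1) powr ((p - q - 1) / (p * (m - q))) *
        (q + 1) powr (1 / p - (p - q - 1) / (p * (m - q))) / (m - q)) *
       Beta (1 - 1 / p) ((p - (q + 1)) / (p * (m - q)))"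
proof -
  have e1: "(p - q - 1) / (p * (m - q)) = \<alpha>" "(p - (q + 1)) / (p * (m - q)) = \<alpha>"
    by (simp_all add: \<alpha>_def algebra_simps)
  have e2: "(1 + q - p) / (p * (m - q)) = - \<alpha>"
    by (simp add: \<alpha>_def minus_divide_left)
  have e3: "(p - m - 1) / (p * (m - q)) = - (1 / p - \<alpha>)"
    using m p by (simp add: \<alpha>_def field_simps)
  have e4: "((p - 1) / p) powr (1 / p) = inverse ((p / (p - 1)) powr (1 / p))"
  proof -
    have "(p - 1) / p = inverse (p / (p - 1))" by simp
    then show ?thesis by (simp only: inverse_powr) 
  qed
  show ?thesis
    unfolding radius_def rate_def e1 e2 e3 e4 powr_minus \<beta>_def[symmetric] Beta_commute[of \<beta> \<alpha>]
    by (simp add: divide_inverse mult_ac)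
qed

text \<open>The Beta variable \<open>t\<close> of \<open>profile\<close> stays in
  \<open>{0..1}\<close>, where the incomplete Beta function is invertible, and
  \<open>height powr (m - q) * t\<close> is \<open>sol r powr (m - q)\<close>.\<close>

lemma sol_closed_form:
  assumes "r \<in> {0..radius}"
  shows "sol r = ((m + 1) / (q + 1) * inv_inc_beta (rate * (radius - r)) \<alpha> \<beta>) powr (1 / (m - q))"
proof -
  define t where "t = (sol r / height) powr (m - q)"
  have s: "0 \<le> sol r" "sol r \<le> height" using sol_range[of r] by auto
  have "t \<in> {0..1}"
    using s height_pos m by (auto simp: t_def intro!: powr_le1)
  then have "inv_inc_beta (inc_beta t \<alpha> \<beta>) \<alpha> \<beta> = t"
    by (rule inv_inc_beta_inc_beta[OF \<alpha>_pos \<beta>_pos])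
  moreover have "inc_beta t \<alpha> \<beta> = rate * (radius - r)"
    using sol_profile(2)[of r] assms by (simp add: profile_def t_def)
  ultimately have "inv_inc_beta (rate * (radius - r)) \<alpha> \<beta> = t" by simp
  moreover have "(m + 1) / (q + 1) * t = sol r powr (m - q)"
    using s height_pos unfolding t_def height_powr[symmetric] by (simp add: powr_divide)
  ultimately show ?thesis
    using s m by (simp add: powr_powr)
qed

end

text \<open>Two clauses guard the definitions by description: unique existence makes
  \<open>R_c\<close> and \<open>u_c\<close> the actual solution, and the inequality for
  \<open>C_best q m p\<close> itself shows that the least constant is attained.\<close>

theorem theorem6p1:
  fixes p q m :: real
  assumes "p > 1" and "0 < q" and "q < min (p - 1) m"
  shows
    "(\<exists>!w. case w of (R, u) \<Rightarrow> free_boundary_solution p q m R u) \<and>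
     R_c p q m =
       ((p - 1) / p) powr (1 / p) *
       ((m + 1) powr ((p - q - 1) / (p * (m - q))) *
        (q + 1) powr (1 / p - (p - q - 1) / (p * (m - q))) / (m - q)) *
       Beta (1 - 1 / p) ((p - (q + 1)) / (p * (m - q))) \<and>
     (let C = (p / (p - 1)) powr (1 / p) * (m - q) *
              (m + 1) powr ((1 + q - p) / (p * (m - q))) *
              (q + 1) powr ((p - m - 1) / (p * (m - q)))
      in \<forall>r\<in>{0..R_c p q m}.
           u_c p q m r =
             ((m + 1) / (q + 1) *
              inv_inc_beta (C * (R_c p q m - r)) ((p - 1 - q) / (p * (m - q))) (1 - 1 / p))
             powr (1 / (m - q))) \<and>
     u_c p q m 0 = ((m + 1) / (q + 1)) powr (1 / (m - q)) \<and>
     GN_inequality q m p (C_best q m p) \<and>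
     (let \<eta>1 = (p - 1) * (m + 1) + p;
          \<eta>2 = (p - 1) * (q + 1) + p;
          l = (m - q) / ((m + 1) * ((p - 1) * (q + 1) + p))
      in C_best q m p =
           (2 powr p * (p - 1) powr (1 - p) * \<eta>1 powr (\<eta>1 / (m - q)) /
            ((m - q) powr (2 * p - 1) * \<eta>2 powr (\<eta>2 / (m - q))) *
            Beta (\<eta>2 / (p * (m - q))) ((2 * p - 1) / p) powr p)
           powr (- l))"
proof -
  interpret gn_exponents p q m
    using assms by unfold_locales auto
  show ?thesis
    unfolding Let_def R_c_eq u_c_eq C_best_eq
  proof (intro conjI ballI)
    show "sol r = ((m + 1) / (q + 1) * inv_inc_beta ((p / (p - 1)) powr (1 / p) * (m - q) *
              (m + 1) powr ((1 + q - p) / (p * (m - q))) *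
              (q + 1) powr ((p - m - 1) / (p * (m - q))) * (radius - r)) ((p - 1 - q) / (p * (m - q))) (1 - 1 / p))
             powr (1 / (m - q))" if "r \<in> {0..radius}" for r
      using sol_closed_form[OF that] unfolding rate_def \<alpha>_def \<beta>_def .
    show "sol 0 = ((m + 1) / (q + 1)) powr (1 / (m - q))"
      using sol_0 unfolding height_def .
    show "best = (2 powr p * (p - 1) powr (1 - p) * ((p - 1) * (m + 1) + p) powr (((p - 1) * (m + 1) + p) / (m - q)) /
            ((m - q) powr (2 * p - 1) * ((p - 1) * (q + 1) + p) powr (((p - 1) * (q + 1) + p) / (m - q))) *
            Beta (((p - 1) * (q + 1) + p) / (p * (m - q))) ((2 * p - 1) / p) powr p)
           powr (- ((m - q) / ((m + 1) * ((p - 1) * (q + 1) + p))))"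
      unfolding best_def l_exp_def best_base_eq \<eta>1_def \<eta>2_def ..
  qed (rule ex1_free_boundary_solution radius_eq GN_best)+
qed

end
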